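(* Let $M^{2n+s}(f,Q,\xi_i,\eta^i,g)$, $n\ge1$, $s\ge1$, be a weak $\beta f$-Kenmotsu manifold with $\beta=\mathrm{const}\ne0$ that is $\eta$-Einstein, i.e. $$\mathrm{Ric}=a\,g-a\sum_i\eta^i\otimes\eta^i+(a+b)\,\bar\eta\otimes\bar\eta\quad\text{for some } a,b\in C^\infty(M).$$ Suppose that $(g,V)$ represents a $\ast$-$\eta$-Ricci soliton with constants $\lambda,\mu\in\mathbb{R}$, that is, $V$ is a vector field on $M$ and $$\tfrac12\,\pounds_V g+\mathrm{Ric}^\ast=\lambda\Big\{g-\sum_i\eta^i\otimes\eta^i\Big\}+(\lambda+\mu)\,\bar\eta\otimes\bar\eta ,$$ and, if $s>1$, assume that $V\in\mathcal{D}$. Then $a=-2sn\beta^2$, $b=2(s-1)n\beta^2$, and the scalar curvature is $r=-2sn(2n+1)\beta^2$; moreover, if $s=1$ then $(M,g)$ is an Einstein manifold.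
   Context: A weak metric $f$-structure on a smooth manifold $M^{2n+s}$ is a set $(f,Q,\xi_i,\eta^i,g)$, where $f$ is a skew-symmetric $(1,1)$-tensor of rank $2n$, $Q$ is a self-adjoint nonsingular $(1,1)$-tensor, $\xi_i$ ($1\le i\le s$) are orthonormal vector fields, $\eta^i$ are dual 1-forms, and $g$ is a Riemannian metric, such that $f^2=-Q+\sum_i\eta^i\otimes\xi_i$, $\eta^i(\xi_j)=\delta^i_j$, $Q\xi_i=\xi_i$, and $g(fX,fY)=g(X,QY)-\sum_i\eta^i(X)\eta^i(Y)$ for all vector fields $X,Y$. (For $s=1$ this is a weak almost contact metric structure.) Put $\bar\xi=\sum_i\xi_i$, $\bar\eta=\sum_i\eta^i$, and $\mathcal{D}=\bigcap_{i=1}^s\ker\eta^i$; $V\in\mathcal{D}$ means that the vector field $V$ is tangent to $\mathcal{D}$. The structure is normal if $[f,f](X,Y)+2\sum_i d\eta^i(X,Y)\,\xi_i=0$ for all $X,Y$, where $[f,f](X,Y)=f^2[X,Y]+[fX,fY]-f[fX,Y]-f[X,fY]$ and $d\omega(X,Y)=\tfrac12\{X(\omega(Y))-Y(\omega(X))-\omega([X,Y])\}$. A weak $\beta f$-Kenmotsu manifold is a weak metric $f$-manifold, normal (i.e. $[f,f](X,Y)+2\sum_i d\eta^i(X,Y)\,\xi_i=0$ for all vector fields $X,Y$), satisfying $(\nabla_Xf)Y=\beta\{g(fX,Y)\,\bar\xi-\bar\eta(Y)fX\}$ for all $X,Y$, where $\nabla$ is the Levi-Civita connection of $g$. Conventions: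 $R_{X,Y}=[\nabla_X,\nabla_Y]-\nabla_{[X,Y]}$; $\mathrm{Ric}(X,Y)=\mathrm{trace}(Z\mapsto R_{Z,X}Y)$; $r=\mathrm{trace}_g\,\mathrm{Ric}$; the $\ast$-Ricci tensor is $\mathrm{Ric}^\ast(X,Y)=\tfrac12\,\mathrm{trace}\{Z\mapsto R_{X,fY}fZ\}$; $\pounds$ is the Lie derivative. *)

theory Defs
  imports "HOL-Analysis.Analysis" "HOL-Library.Function_Algebras"
begin

instantiation "fun" :: (type, real_vector) real_vector
begin

definition scaleR_fun :: "real \<Rightarrow> ('a \<Rightarrow> 'b) \<Rightarrow> 'a \<Rightarrow> 'b"
  where "scaleR_fun c F = (\<lambda>x. c *\<^sub>R F x)"

instance
  by standard (auto simp: scaleR_fun_def fun_eq_iff algebra_simps)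

end

text \<open>Meant for open \<open>S\<close>, where differentiability at and within coincide.\<close>

primrec Ck_on :: "nat \<Rightarrow> 'a::real_normed_vector set \<Rightarrow> ('a \<Rightarrow> 'b::real_normed_vector) \<Rightarrow> bool"
  where
    "Ck_on 0 S F \<longleftrightarrow> continuous_on S F"
  | "Ck_on (Suc k) S F \<longleftrightarrow>
       (\<forall>x\<in>S. F differentiable (at x)) \<and> (\<forall>v. Ck_on k S (\<lambda>x. frechet_derivative F (at x) v))"

definition Cinf_on :: "'a::real_normed_vector set \<Rightarrow> ('a \<Rightarrow> 'b::real_normed_vector) \<Rightarrow> bool"
  where "Cinf_on S F \<longleftrightarrow> (\<forall>k. Ck_on k S F)"

text \<open>The manifold is the whole topological space \<open>'m\<close>; a chart is a pair of its domain and its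
  coordinate map, the latter being relevant on the domain only.  The atlas need not be maximal.\<close>

type_synonym ('m, 'e) chart = "'m set \<times> ('m \<Rightarrow> 'e)"

definition smooth_atlas ::
  "('m::{t2_space,second_countable_topology}, 'e::euclidean_space) chart set \<Rightarrow> bool"
  where "smooth_atlas A \<longleftrightarrow>
    (\<Union>(U, \<phi>)\<in>A. U) = UNIV \<and>
    (\<forall>(U, \<phi>)\<in>A. open U \<and> open (\<phi> ` U) \<and> homeomorphism U (\<phi> ` U) \<phi> (inv_into U \<phi>)) \<and>
    (\<forall>(U, \<phi>)\<in>A. \<forall>(W, \<psi>)\<in>A. Cinf_on (\<phi> ` (U \<inter> W)) (\<psi> \<circ> inv_into U \<phi>))"

definition smooth_functions :: "('m, 'e::euclidean_space) chart set \<Rightarrow> ('m \<Rightarrow> real) set"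
  where "smooth_functions A = {h. \<forall>(U, \<phi>)\<in>A. Cinf_on (\<phi> ` U) (h \<circ> inv_into U \<phi>)}"

text \<open>A tangent vector at \<open>p\<close> is a derivation at \<open>p\<close> of the algebra of smooth functions.  Setting
  it to zero off that algebra makes equality of tangent vectors the equality of HOL functions.\<close>

type_synonym 'm tangent = "('m \<Rightarrow> real) \<Rightarrow> real"

definition tangent_space :: "('m, 'e::euclidean_space) chart set \<Rightarrow> 'm \<Rightarrow> 'm tangent set"
  where "tangent_space A p = {v.
    (\<forall>h\<in>smooth_functions A. \<forall>k\<in>smooth_functions A.
       v (\<lambda>q. h q + k q) = v h + v k \<and>
       v (\<lambda>q. h q * k q) = v h * k p + h p * v k) \<and>
    (\<forall>h\<in>smooth_functions A. \<forall>c. v (\<lambda>q. c * h q) = c * v h) \<and>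
    (\<forall>h. h \<notin> smooth_functions A \<longrightarrow> v h = 0)}"

text \<open>Tensor fields are given pointwise; their values outside the tangent spaces are irrelevant.
  Smoothness is expressed by evaluation on smooth vector fields.\<close>

type_synonym 'm vfield = "'m \<Rightarrow> 'm tangent"
type_synonym 'm oneform = "'m \<Rightarrow> 'm tangent \<Rightarrow> real"
type_synonym 'm endofield = "'m \<Rightarrow> 'm tangent \<Rightarrow> 'm tangent"
type_synonym 'm bilinfield = "'m \<Rightarrow> 'm tangent \<Rightarrow> 'm tangent \<Rightarrow> real"
type_synonym 'm connection = "'m vfield \<Rightarrow> 'm vfield \<Rightarrow> 'm vfield"

definition vector_fields :: "('m, 'e::euclidean_space) chart set \<Rightarrow> 'm vfield set"
  where "vector_fields A = {X. (\<forall>p. X p \<in> tangent_space A p) \<and>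
    (\<forall>h\<in>smooth_functions A. (\<lambda>p. X p h) \<in> smooth_functions A)}"

definition fscale :: "('m \<Rightarrow> real) \<Rightarrow> 'm vfield \<Rightarrow> 'm vfield"
  where "fscale h X = (\<lambda>p. h p *\<^sub>R X p)"

definition act :: "'m endofield \<Rightarrow> 'm vfield \<Rightarrow> 'm vfield"
  where "act F X = (\<lambda>p. F p (X p))"

definition lie_bracket :: "'m vfield \<Rightarrow> 'm vfield \<Rightarrow> 'm vfield"
  where "lie_bracket X Y = (\<lambda>p h. X p (\<lambda>q. Y q h) - Y p (\<lambda>q. X q h))"

definition linear_on_set :: "'a::real_vector set \<Rightarrow> ('a \<Rightarrow> 'b::real_vector) \<Rightarrow> bool"
  where "linear_on_set S L \<longleftrightarrow>
    (\<forall>u\<in>S. \<forall>v\<in>S. L (u + v) = L u + L v) \<and> (\<forall>c. \<forall>u\<in>S. L (c *\<^sub>R u) = c *\<^sub>R L u)"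

definition one_forms :: "('m, 'e::euclidean_space) chart set \<Rightarrow> 'm oneform set"
  where "one_forms A = {\<omega>. (\<forall>p. linear_on_set (tangent_space A p) (\<omega> p)) \<and>
    (\<forall>X\<in>vector_fields A. (\<lambda>p. \<omega> p (X p)) \<in> smooth_functions A)}"

definition endo_fields :: "('m, 'e::euclidean_space) chart set \<Rightarrow> 'm endofield set"
  where "endo_fields A = {F.
    (\<forall>p. F p ` tangent_space A p \<subseteq> tangent_space A p \<and>
         linear_on_set (tangent_space A p) (F p)) \<and>
    (\<forall>X\<in>vector_fields A. act F X \<in> vector_fields A)}"

definition riemannian_metric :: "('m, 'e::euclidean_space) chart set \<Rightarrow> 'm bilinfield \<Rightarrow> bool"
  where "riemannian_metric A g \<longleftrightarrow>
    (\<forall>p. \<forall>u\<in>tangent_space A p. linear_on_set (tangent_space A p) (g p u)) \<and>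
    (\<forall>p. \<forall>u\<in>tangent_space A p. \<forall>v\<in>tangent_space A p. g p u v = g p v u) \<and>
    (\<forall>p. \<forall>u\<in>tangent_space A p. u \<noteq> 0 \<longrightarrow> g p u u > 0) \<and>
    (\<forall>X\<in>vector_fields A. \<forall>Y\<in>vector_fields A. (\<lambda>p. g p (X p) (Y p)) \<in> smooth_functions A)"

text \<open>The factor 1/2 is the normalisation of \<open>d\<close> used in the normality condition.\<close>

definition ext_deriv :: "'m oneform \<Rightarrow> 'm vfield \<Rightarrow> 'm vfield \<Rightarrow> 'm \<Rightarrow> real"
  where "ext_deriv \<omega> X Y p =
    (X p (\<lambda>q. \<omega> q (Y q)) - Y p (\<lambda>q. \<omega> q (X q)) - \<omega> p (lie_bracket X Y p)) / 2"

definition lie_deriv :: "'m vfield \<Rightarrow> 'm bilinfield \<Rightarrow> 'm vfield \<Rightarrow> 'm vfield \<Rightarrow> 'm \<Rightarrow> real"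
  where "lie_deriv V g X Y p =
    V p (\<lambda>q. g q (X q) (Y q)) - g p (lie_bracket V X p) (Y p) - g p (X p) (lie_bracket V Y p)"

definition affine_connection :: "('m, 'e::euclidean_space) chart set \<Rightarrow> 'm connection \<Rightarrow> bool"
  where "affine_connection A D \<longleftrightarrow>
    (\<forall>X\<in>vector_fields A. \<forall>Y\<in>vector_fields A. D X Y \<in> vector_fields A) \<and>
    (\<forall>X\<in>vector_fields A. \<forall>Y\<in>vector_fields A. \<forall>Z\<in>vector_fields A.
       D (X + Y) Z = D X Z + D Y Z \<and> D X (Y + Z) = D X Y + D X Z) \<and>
    (\<forall>h\<in>smooth_functions A. \<forall>X\<in>vector_fields A. \<forall>Y\<in>vector_fields A.
       D (fscale h X) Y = fscale h (D X Y) \<and>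
       D X (fscale h Y) = fscale (\<lambda>p. X p h) Y + fscale h (D X Y))"

definition levi_civita ::
  "('m, 'e::euclidean_space) chart set \<Rightarrow> 'm bilinfield \<Rightarrow> 'm connection \<Rightarrow> bool"
  where "levi_civita A g D \<longleftrightarrow> affine_connection A D \<and>
    (\<forall>X\<in>vector_fields A. \<forall>Y\<in>vector_fields A. D X Y - D Y X = lie_bracket X Y) \<and>
    (\<forall>X\<in>vector_fields A. \<forall>Y\<in>vector_fields A. \<forall>Z\<in>vector_fields A. \<forall>p.
       X p (\<lambda>q. g q (Y q) (Z q)) = g p (D X Y p) (Z p) + g p (Y p) (D X Z p))"

definition curvature :: "'m connection \<Rightarrow> 'm vfield \<Rightarrow> 'm vfield \<Rightarrow> 'm vfield \<Rightarrow> 'm vfield"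
  where "curvature D X Y Z = D X (D Y Z) - D Y (D X Z) - D (lie_bracket X Y) Z"

definition trace_on :: "'a::real_vector set \<Rightarrow> ('a \<Rightarrow> 'a) \<Rightarrow> real"
  where "trace_on S L =
    (let B = (SOME B. independent B \<and> span B = S) in \<Sum>b\<in>B. representation B (L b) b)"

text \<open>A smooth vector field extending a tangent vector.  The choice does not matter where it is
  used below, namely in operators that are linear over the smooth functions.\<close>

definition extend :: "('m, 'e::euclidean_space) chart set \<Rightarrow> 'm \<Rightarrow> 'm tangent \<Rightarrow> 'm vfield"
  where "extend A p v = (SOME X. X \<in> vector_fields A \<and> X p = v)"

definition trace_at ::
  "('m, 'e::euclidean_space) chart set \<Rightarrow> ('m vfield \<Rightarrow> 'm vfield) \<Rightarrow> 'm \<Rightarrow> real"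
  where "trace_at A L p = trace_on (tangent_space A p) (\<lambda>v. L (extend A p v) p)"

definition ricci ::
  "('m, 'e::euclidean_space) chart set \<Rightarrow> 'm connection \<Rightarrow> 'm vfield \<Rightarrow> 'm vfield \<Rightarrow> 'm \<Rightarrow> real"
  where "ricci A D X Y p = trace_at A (\<lambda>Z. curvature D Z X Y) p"

definition star_ricci ::
  "('m, 'e::euclidean_space) chart set \<Rightarrow> 'm connection \<Rightarrow> 'm endofield \<Rightarrow>
    'm vfield \<Rightarrow> 'm vfield \<Rightarrow> 'm \<Rightarrow> real"
  where "star_ricci A D f X Y p = trace_at A (\<lambda>Z. curvature D X (act f Y) (act f Z)) p / 2"

definition orthonormal_basis_at ::
  "('m, 'e::euclidean_space) chart set \<Rightarrow> 'm bilinfield \<Rightarrow> 'm \<Rightarrow> 'm tangent set \<Rightarrow> bool"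
  where "orthonormal_basis_at A g p B \<longleftrightarrow> independent B \<and> span B = tangent_space A p \<and>
    (\<forall>u\<in>B. \<forall>v\<in>B. g p u v = (if u = v then 1 else 0))"

definition scalar_curvature ::
  "('m, 'e::euclidean_space) chart set \<Rightarrow> 'm bilinfield \<Rightarrow> 'm connection \<Rightarrow> 'm \<Rightarrow> real"
  where "scalar_curvature A g D p =
    (let B = (SOME B. orthonormal_basis_at A g p B)
     in \<Sum>e\<in>B. ricci A D (extend A p e) (extend A p e) p)"

definition einstein ::
  "('m, 'e::euclidean_space) chart set \<Rightarrow> 'm bilinfield \<Rightarrow> 'm connection \<Rightarrow> bool"
  where "einstein A g D \<longleftrightarrow>
    (\<exists>c::real. \<forall>X\<in>vector_fields A. \<forall>Y\<in>vector_fields A. \<forall>p.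
       ricci A D X Y p = c * g p (X p) (Y p))"

definition weak_metric_f_structure ::
  "('m::{t2_space,second_countable_topology}, 'e::euclidean_space) chart set \<Rightarrow> nat \<Rightarrow> nat \<Rightarrow>
    'm endofield \<Rightarrow> 'm endofield \<Rightarrow> (nat \<Rightarrow> 'm vfield) \<Rightarrow> (nat \<Rightarrow> 'm oneform) \<Rightarrow>
    'm bilinfield \<Rightarrow> bool"
  where "weak_metric_f_structure A n s f Q \<xi> \<eta> g \<longleftrightarrow>
    smooth_atlas A \<and> DIM('e) = 2 * n + s \<and>
    riemannian_metric A g \<and> f \<in> endo_fields A \<and> Q \<in> endo_fields A \<and>
    (\<forall>i\<in>{1..s}. \<xi> i \<in> vector_fields A \<and> \<eta> i \<in> one_forms A) \<and>
    (\<forall>p. \<forall>u\<in>tangent_space A p. \<forall>v\<in>tangent_space A p.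
       g p (f p u) v = - g p u (f p v) \<and> g p (Q p u) v = g p u (Q p v)) \<and>
    (\<forall>p. dim (f p ` tangent_space A p) = 2 * n) \<and>
    (\<forall>p. bij_betw (Q p) (tangent_space A p) (tangent_space A p)) \<and>
    (\<forall>p. \<forall>i\<in>{1..s}. \<forall>j\<in>{1..s}.
       g p (\<xi> i p) (\<xi> j p) = (if i = j then 1 else 0) \<and>
       \<eta> i p (\<xi> j p) = (if i = j then 1 else 0)) \<and>
    (\<forall>p. \<forall>i\<in>{1..s}. Q p (\<xi> i p) = \<xi> i p) \<and>
    (\<forall>p. \<forall>u\<in>tangent_space A p. f p (f p u) = - Q p u + (\<Sum>i=1..s. \<eta> i p u *\<^sub>R \<xi> i p)) \<and>
    (\<forall>p. \<forall>u\<in>tangent_space A p. \<forall>v\<in>tangent_space A p.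
       g p (f p u) (f p v) = g p u (Q p v) - (\<Sum>i=1..s. \<eta> i p u * \<eta> i p v))"

definition nijenhuis :: "'m endofield \<Rightarrow> 'm vfield \<Rightarrow> 'm vfield \<Rightarrow> 'm vfield"
  where "nijenhuis f X Y =
    act f (act f (lie_bracket X Y)) + lie_bracket (act f X) (act f Y)
    - act f (lie_bracket (act f X) Y) - act f (lie_bracket X (act f Y))"

definition normal_structure ::
  "('m, 'e::euclidean_space) chart set \<Rightarrow> nat \<Rightarrow> 'm endofield \<Rightarrow> (nat \<Rightarrow> 'm vfield) \<Rightarrow>
    (nat \<Rightarrow> 'm oneform) \<Rightarrow> bool"
  where "normal_structure A s f \<xi> \<eta> \<longleftrightarrow>
    (\<forall>X\<in>vector_fields A. \<forall>Y\<in>vector_fields A. \<forall>p.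
       nijenhuis f X Y p + 2 *\<^sub>R (\<Sum>i=1..s. ext_deriv (\<eta> i) X Y p *\<^sub>R \<xi> i p) = 0)"

definition xi_bar :: "nat \<Rightarrow> (nat \<Rightarrow> 'm vfield) \<Rightarrow> 'm vfield"
  where "xi_bar s \<xi> p = (\<Sum>i=1..s. \<xi> i p)"

definition eta_bar :: "nat \<Rightarrow> (nat \<Rightarrow> 'm oneform) \<Rightarrow> 'm oneform"
  where "eta_bar s \<eta> p u = (\<Sum>i=1..s. \<eta> i p u)"

text \<open>The left-hand side of the last equation is \<open>(\<nabla>\<^sub>X f) Y\<close>.\<close>

definition weak_beta_f_kenmotsu ::
  "('m::{t2_space,second_countable_topology}, 'e::euclidean_space) chart set \<Rightarrow> nat \<Rightarrow> nat \<Rightarrow>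
    'm endofield \<Rightarrow> 'm endofield \<Rightarrow> (nat \<Rightarrow> 'm vfield) \<Rightarrow> (nat \<Rightarrow> 'm oneform) \<Rightarrow>
    'm bilinfield \<Rightarrow> 'm connection \<Rightarrow> ('m \<Rightarrow> real) \<Rightarrow> bool"
  where "weak_beta_f_kenmotsu A n s f Q \<xi> \<eta> g D \<beta> \<longleftrightarrow>
    weak_metric_f_structure A n s f Q \<xi> \<eta> g \<and> levi_civita A g D \<and>
    normal_structure A s f \<xi> \<eta> \<and> \<beta> \<in> smooth_functions A \<and>
    (\<forall>X\<in>vector_fields A. \<forall>Y\<in>vector_fields A. \<forall>p.
       D X (act f Y) p - f p (D X Y p) =
       \<beta> p *\<^sub>R (g p (f p (X p)) (Y p) *\<^sub>R xi_bar s \<xi> p - eta_bar s \<eta> p (Y p) *\<^sub>R f p (X p)))"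

definition eta_einstein ::
  "('m, 'e::euclidean_space) chart set \<Rightarrow> nat \<Rightarrow> (nat \<Rightarrow> 'm oneform) \<Rightarrow> 'm bilinfield \<Rightarrow>
    'm connection \<Rightarrow> ('m \<Rightarrow> real) \<Rightarrow> ('m \<Rightarrow> real) \<Rightarrow> bool"
  where "eta_einstein A s \<eta> g D a b \<longleftrightarrow>
    a \<in> smooth_functions A \<and> b \<in> smooth_functions A \<and>
    (\<forall>X\<in>vector_fields A. \<forall>Y\<in>vector_fields A. \<forall>p.
       ricci A D X Y p =
         a p * g p (X p) (Y p) - a p * (\<Sum>i=1..s. \<eta> i p (X p) * \<eta> i p (Y p))
         + (a p + b p) * (eta_bar s \<eta> p (X p) * eta_bar s \<eta> p (Y p)))"

definition star_eta_ricci_soliton ::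
  "('m, 'e::euclidean_space) chart set \<Rightarrow> nat \<Rightarrow> 'm endofield \<Rightarrow> (nat \<Rightarrow> 'm oneform) \<Rightarrow>
    'm bilinfield \<Rightarrow> 'm connection \<Rightarrow> 'm vfield \<Rightarrow> real \<Rightarrow> real \<Rightarrow> bool"
  where "star_eta_ricci_soliton A s f \<eta> g D V lam mu \<longleftrightarrow>
    V \<in> vector_fields A \<and>
    (\<forall>X\<in>vector_fields A. \<forall>Y\<in>vector_fields A. \<forall>p.
       lie_deriv V g X Y p / 2 + star_ricci A D f X Y p =
         lam * (g p (X p) (Y p) - (\<Sum>i=1..s. \<eta> i p (X p) * \<eta> i p (Y p)))
         + (lam + mu) * (eta_bar s \<eta> p (X p) * eta_bar s \<eta> p (Y p)))"

definition tangent_to_D :: "nat \<Rightarrow> (nat \<Rightarrow> 'm oneform) \<Rightarrow> 'm vfield \<Rightarrow> bool"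
  where "tangent_to_D s \<eta> V \<longleftrightarrow> (\<forall>p. \<forall>i\<in>{1..s}. \<eta> i p (V p) = 0)"

end

theory Submission
  imports Defs
begin

text \<open>The defining relation and normality give \<open>\<nabla>\<^sub>X \<xi>\<^sub>i = \<beta> P X\<close>, where \<open>P\<close> is the projection
  along the \<open>\<xi>\<^sub>i\<close>.  Hence \<open>Ric(X, \<xi>\<^sub>i) = -2n\<beta>\<^sup>2 \<eta>(X)\<close> with \<open>\<eta>\<close> the sum of the \<open>\<eta>\<^sup>i\<close>, so that
  \<open>a + b = -2n\<beta>\<^sup>2\<close>, and the star-Ricci tensor is \<open>c g(fX, fY)\<close> with \<open>c = a + s(2n-1)\<beta>\<^sup>2\<close>.  The Lie
  derivative of \<open>Ric\<close> along \<open>\<xi>\<^sub>i\<close> gives \<open>\<xi>\<^sub>i(a) = -2\<beta>(a + 2sn\<beta>\<^sup>2)\<close>.  Evaluating the Lie derivative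
  of \<open>g\<close> along \<open>[\<xi>\<^sub>i, V]\<close> in two ways determines the Hessians of \<open>u\<^sub>i = \<eta>\<^sup>i(V)\<close>: if all \<open>u\<^sub>i\<close> are
  zero, then they vanish, which forces \<open>\<xi>\<^sub>i(a) = 0\<close>.

  Let \<open>s = 1\<close> and \<open>k = a + 2n\<beta>\<^sup>2\<close>.  The trace of the integrability condition of the Hessian of \<open>u\<close>
  gives \<open>\<lambda> + \<mu> = 0\<close> and expresses the differential of \<open>k\<close> through that of \<open>u\<close>.  The Lie
  derivative of \<open>Ric\<close> along \<open>W = V - \<nabla>u/(2\<beta>)\<close> shows that
  \<open>W(k)\<close> is a constant multiple of \<open>k\<close> and that \<open>g(fX, fY) = q g(PX, PY)\<close> wherever \<open>k \<noteq> 0\<close>.  Computing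
  the derivative of \<open>|\<nabla>u|\<^sup>2\<close> along \<open>W\<close> in two ways and differentiating the outcome twice along
  \<open>\<nabla>u\<close> yields \<open>\<nabla>u = 0\<close> there; then the Hessian of \<open>u\<close> vanishes, and with it \<open>k\<close>.\<close>

subsection \<open>Smooth maps\<close>

text \<open>As \<open>Q\<close> is arbitrary on horizontal vectors, the form \<open>gF\<close> =
  g(fX, fY) need not be a multiple of the horizontal metric \<open>gP\<close>. The horizontal part
  of the Ricci tensor is a multiple of \<open>gP\<close>, whereas the soliton equation brings in
  \<open>gF\<close>; this is the obstacle for s = 1, where V may also have a vertical part. The
  Hessian of u contains \<open>gF\<close> with the coefficient \<open>- 2 * \<beta> * k\<close>, and
  subtracting the gradient of u over 2\<beta> from V removes exactly the terms with k from the Lie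
  derivative of g. The comparison of the two forms along the corrected field carries a factor k,
  hence proportionality only where k is nonzero. The factor q is the trace of \<open>gF\<close> over
  2n. Its differential vanishes because the covariant derivative of f\<circ>f has only terms that
  mix horizontal and vertical directions. Along the gradient of u the coefficients built from q are
  thus constant, while u grows at the rate |grad u|^2, so that differentiation eliminates u. Tangent
  vectors are derivations of the global smooth functions, so that even local frames, on which all
  traces rest, require bump functions and Hadamard's lemma.\<close>

abbreviation fd :: "('a::real_normed_vector \<Rightarrow> 'b::real_normed_vector) \<Rightarrow> 'a \<Rightarrow> 'a \<Rightarrow> 'b"
  where "fd F x \<equiv> frechet_derivative F (at x)"

lemma Ck_on_cong:
  assumes "open S" "\<And>x. x \<in> S \<Longrightarrow> F x = G x" "Ck_on k S F"
  shows "Ck_on k S G"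
  using assms(2,3)
proof (induction k arbitrary: F G)
  case 0
  then show ?case using continuous_on_cong by (metis Ck_on.simps(1))
next
  case (Suc k)
  have G: "(G has_derivative fd F x) (at x)" if "x \<in> S" for x
    using Suc.prems that assms(1)
    by (metis Ck_on.simps(2) frechet_derivative_works has_derivative_transform_within_open)
  have "Ck_on k S (\<lambda>x. fd G x v)" for v
  proof (rule Suc.IH)
    show "fd F x v = fd G x v" if "x \<in> S" for x
      using frechet_derivative_at[OF G[OF that]] by simp
    show "Ck_on k S (\<lambda>x. fd F x v)" using Suc.prems by simp
  qed
  with G show ?case by (auto intro: differentiableI)
qed

lemma Ck_on_subset: "Ck_on k T F \<Longrightarrow> S \<subseteq> T \<Longrightarrow> Ck_on k S F"
  by (induction k arbitrary: F) (auto intro: continuous_on_subset)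

text \<open>\<open>Ck_on\<close> looks at F near the points of S only, so smoothness can be glued
  from neighbourhoods.\<close>

lemma Ck_on_local:
  assumes "\<And>x. x \<in> S \<Longrightarrow> \<exists>T. open T \<and> x \<in> T \<and> Ck_on k T F"
  shows "Ck_on k S F"
  using assms
proof (induction k arbitrary: F)
  case 0
  have "isCont F x" if "x \<in> S" for x
    using 0[OF that] continuous_on_eq_continuous_at by auto
  then show ?case by (simp add: continuous_at_imp_continuous_on)
next
  case (Suc k)
  have "F differentiable (at x)" if "x \<in> S" for x
    using Suc.prems[OF that] Ck_on.simps(2) by blast
  moreover have "Ck_on k S (\<lambda>x. fd F x v)" for v
    by (rule Suc.IH) (metis Suc.prems Ck_on.simps(2))
  ultimately show ?case unfolding Ck_on.simps by blast
qed

lemma Ck_on_SucD: "Ck_on (Suc k) S F \<Longrightarrow> Ck_on k S F"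
proof (induction k arbitrary: F)
  case 0
  then show ?case
    by (auto intro!: continuous_at_imp_continuous_on differentiable_imp_continuous_within)
qed auto

lemma Ck_imp_continuous_on: "Ck_on k S F \<Longrightarrow> continuous_on S F"
proof (induction k)
  case (Suc k)
  from Suc.IH[OF Ck_on_SucD[OF Suc.prems]] show ?case .
qed simp

text \<open>The derivative at a point is unique, so an explicit candidate \<open>F'\<close> may
  stand for the one chosen by \<open>frechet_derivative\<close>.\<close>

lemma Ck_on_SucI:
  assumes "open S" "\<And>x. x \<in> S \<Longrightarrow> (F has_derivative F' x) (at x)"
    "\<And>v. Ck_on k S (\<lambda>x. F' x v)"
  shows "Ck_on (Suc k) S F"
proof -
  have "Ck_on k S (\<lambda>x. fd F x v)" for v
  proof (rule Ck_on_cong[OF assms(1) _ assms(3)])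
    show "F' x v = fd F x v" if "x \<in> S" for x
      using frechet_derivative_at[OF assms(2)[OF that]] by simp
  qed
  with assms(2) show ?thesis by (auto intro: differentiableI)
qed

lemma Ck_on_SucE:
  assumes "Ck_on (Suc k) S F"
  shows "x \<in> S \<Longrightarrow> (F has_derivative fd F x) (at x)"
    and "Ck_on k S (\<lambda>x. fd F x v)"
  using assms by (auto simp: frechet_derivative_works)

lemma Ck_on_const: "open S \<Longrightarrow> Ck_on k S (\<lambda>_. c)"
proof (induction k arbitrary: c)
  case (Suc k)
  show ?case by (rule Ck_on_SucI[where F' = "\<lambda>_ _. 0"]) (use Suc in auto)
qed auto

lemma Ck_on_bounded_linear:
  assumes "open S" "bounded_linear L" "Ck_on k S F"
  shows "Ck_on k S (\<lambda>x. L (F x))"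
  using assms(3)
proof (induction k arbitrary: F)
  case 0
  then show ?case using bounded_linear.continuous_on[OF assms(2)] by simp
next
  case (Suc k)
  show ?case
    by (rule Ck_on_SucI[where F' = "\<lambda>x v. L (fd F x v)"])
      (use Suc Ck_on_SucE[OF Suc.prems] assms in \<open>auto intro: bounded_linear.has_derivative\<close>)
qed

lemma Ck_on_id: "open S \<Longrightarrow> Ck_on k S (\<lambda>x. x)"
proof (cases k)
  case (Suc l)
  assume "open S"
  then show ?thesis unfolding Suc
    by (intro Ck_on_SucI[where F' = "\<lambda>_ v. v"]) (auto intro: Ck_on_const)
qed auto

lemma Ck_on_add:
  assumes "open S" "Ck_on k S F" "Ck_on k S G"
  shows "Ck_on k S (\<lambda>x. F x + G x)"
  using assms(2,3)
proof (induction k arbitrary: F G)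
  case 0
  then show ?case by (simp add: continuous_on_add)
next
  case (Suc k)
  note FG = Ck_on_SucE[OF Suc.prems(1)] Ck_on_SucE[OF Suc.prems(2)]
  show ?case
    by (rule Ck_on_SucI[where F' = "\<lambda>x v. fd F x v + fd G x v"])
      (use Suc.IH FG assms in \<open>auto intro: has_derivative_add\<close>)
qed

lemma Ck_on_scaleR:
  assumes "open S" "Ck_on k S F" "Ck_on k S G"
  shows "Ck_on k S (\<lambda>x. F x *\<^sub>R G x)"
  using assms(2,3)
proof (induction k arbitrary: F G)
  case 0
  then show ?case by (simp add: continuous_on_scaleR)
next
  case (Suc k)
  note FG = Ck_on_SucE[OF Suc.prems(1)] Ck_on_SucE[OF Suc.prems(2)]
  show ?case
  proof (rule Ck_on_SucI[OF assms(1) has_derivative_scaleR[OF FG(1) FG(3)]])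
    show "Ck_on k S (\<lambda>x. F x *\<^sub>R fd G x v
        + fd F x v *\<^sub>R G x)" for v
      by (intro Ck_on_add assms(1) Suc.IH[OF Ck_on_SucD[OF Suc.prems(1)] FG(4)]
          Suc.IH[OF FG(2) Ck_on_SucD[OF Suc.prems(2)]])
  qed
qed

lemma Ck_on_sum:
  assumes "open S" "\<And>i. i \<in> I \<Longrightarrow> Ck_on k S (F i)"
  shows "Ck_on k S (\<lambda>x. \<Sum>i\<in>I. F i x)"
  using assms(2) by (induction I rule: infinite_finite_induct)
    (auto intro: Ck_on_const Ck_on_add assms(1))

text \<open>In the chain rule the direction \<open>fd F x v\<close> moves with x, whereas the
  induction hypothesis covers fixed directions. Expanding it in \<open>Basis\<close> leaves products
  of smooth coefficients with compositions covered by the hypothesis.\<close>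

lemma Ck_on_compose:
  fixes F :: "'a::real_normed_vector \<Rightarrow> 'b::euclidean_space"
  assumes "open S" "open T" "F ` S \<subseteq> T" "Ck_on k S F" "Ck_on k T G"
  shows "Ck_on k S (\<lambda>x. G (F x))"
  using assms(4,5)
proof (induction k arbitrary: G)
  case 0
  then show ?case using assms(3) continuous_on_compose2 by (metis Ck_on.simps(1))
next
  case (Suc k)
  note F = Ck_on_SucE[OF Suc.prems(1)] and G = Ck_on_SucE[OF Suc.prems(2)]
  have lin: "fd G y v
      = (\<Sum>b\<in>Basis. (v \<bullet> b) *\<^sub>R fd G y b)" if "y \<in> T" for y v
  proof -
    have "linear (fd G y)"
      using G(1)[OF that] has_derivative_linear by blast
    then have "fd G y (\<Sum>b\<in>Basis. (v \<bullet> b) *\<^sub>R b)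
        = (\<Sum>b\<in>Basis. (v \<bullet> b) *\<^sub>R fd G y b)"
      by (simp only: linear_sum linear_scale)
    then show ?thesis by (simp only: euclidean_representation)
  qed
  show ?case
  proof (rule Ck_on_SucI[where F' = "\<lambda>x v. \<Sum>b\<in>Basis. (fd F x v \<bullet> b) *\<^sub>R
      fd G (F x) b"])
    show "((\<lambda>x. G (F x)) has_derivative (\<lambda>v. \<Sum>b\<in>Basis. (fd F x v \<bullet> b) *\<^sub>R
      fd G (F x) b)) (at x)" if "x \<in> S" for x
    proof -
      have "F x \<in> T" using that assms(3) by auto
      then show ?thesis
        using diff_chain_at[OF F(1)[OF that] G(1)] lin by (auto simp: o_def)
    qed
    fix v
    have "Ck_on k S (\<lambda>x. (fd F x v \<bullet> b) *\<^sub>R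
        fd G (F x) b)" for b
      by (rule Ck_on_scaleR[OF assms(1) Ck_on_bounded_linear[OF assms(1) bounded_linear_inner_left F(2)]
            Suc.IH[OF Ck_on_SucD[OF Suc.prems(1)] G(2)]])
    then show "Ck_on k S (\<lambda>x. \<Sum>b\<in>Basis. (fd F x v \<bullet> b) *\<^sub>R
        fd G (F x) b)"
      by (rule Ck_on_sum[OF assms(1)])
  qed (rule assms)
qed

lemma CinfD: "Cinf_on S F \<Longrightarrow> Ck_on k S F"
  by (simp only: Cinf_on_def)

lemma Cinf_on_deriv:
  "Cinf_on S F \<Longrightarrow> Cinf_on S (\<lambda>x. fd F x v)"
  by (subst Cinf_on_def) (intro allI Ck_on_SucE(2) CinfD)

lemma Cinf_on_has_derivative:
  "Cinf_on S F \<Longrightarrow> x \<in> S \<Longrightarrow> (F has_derivative fd F x) (at x)"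
  by (rule Ck_on_SucE(1)[OF CinfD])

subsection \<open>A flat function\<close>

text \<open>The powers of \<open>inverse t\<close> make the family closed under differentiation up
  to linear combinations, so one induction on the order of smoothness serves all k.\<close>

definition flat_fun :: "nat \<Rightarrow> real \<Rightarrow> real"
  where "flat_fun k t = (if t > 0 then exp (- inverse t) * inverse t ^ k else 0)"

lemma flat_fun_0: "(flat_fun k \<longlongrightarrow> 0) (at_right 0)"
proof -
  have "((\<lambda>y::real. y ^ k / exp y) \<longlongrightarrow> 0) at_top" by (rule tendsto_power_div_exp_0)
  then have "((\<lambda>t::real. inverse t ^ k / exp (inverse t)) \<longlongrightarrow> 0) (at_right 0)"
    using filterlim_inverse_at_top_right filterlim_compose by blast
  then show ?thesis
    by (rule Lim_transform_eventually)
      (auto simp: eventually_at_filter flat_fun_def exp_minus field_simps)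
qed

lemma flat_fun_has_derivative:
  "(flat_fun k has_real_derivative flat_fun (k + 2) t - k * flat_fun (k + 1) t) (at t)"
proof -
  consider "t > 0" | "t < 0" | "t = 0" by linarith
  then show ?thesis
  proof cases
    case 1
    have "((\<lambda>t. inverse t ^ k) has_real_derivative - (k * inverse t ^ (k + 1))) (at t)"
    proof (cases k)
      case (Suc m)
      have "((\<lambda>t. inverse t ^ k) has_real_derivative
          real k * (- (inverse t ^ Suc (Suc 0)) * inverse t ^ (k - Suc 0))) (at t)"
        by (rule DERIV_power[OF DERIV_inverse]) (use 1 in simp)
      then show ?thesis by (rule DERIV_cong) (simp add: Suc)
    qed simp
    moreover have "((\<lambda>t. exp (- inverse t)) has_real_derivative exp (- inverse t) * inverse t ^ 2) (at t)"
      using 1 by (auto intro!: derivative_eq_intros simp: power2_eq_square)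
    ultimately have "((\<lambda>t. exp (- inverse t) * inverse t ^ k) has_real_derivative
        exp (- inverse t) * inverse t ^ 2 * inverse t ^ k
        + - (k * inverse t ^ (k + 1)) * exp (- inverse t)) (at t)"
      by (rule DERIV_mult[rotated])
    then have "((\<lambda>t. exp (- inverse t) * inverse t ^ k) has_real_derivative
        flat_fun (k + 2) t - k * flat_fun (k + 1) t) (at t)"
      by (rule DERIV_cong) (use 1 in \<open>simp add: flat_fun_def power_add power2_eq_square\<close>)
    then show ?thesis
      by (rule has_field_derivative_transform_within_open[where S = "{0<..}"])
        (use 1 in \<open>auto simp: flat_fun_def\<close>)
  next
    case 2
    have "((\<lambda>t::real. 0::real) has_real_derivative 0) (at t)" by simp
    then have "(flat_fun k has_real_derivative 0) (at t)"
      by (rule has_field_derivative_transform_within_open[where S = "{..<0}"])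
        (use 2 in \<open>auto simp: flat_fun_def\<close>)
    then show ?thesis using 2 by (simp add: flat_fun_def)
  next
    case 3
    \<comment> \<open>At 0 the difference quotient is 0 on the left and
      \<open>flat_fun (Suc k)\<close> on the right, which tends to 0.\<close>
    have "((\<lambda>y. (flat_fun k y - flat_fun k 0) / (y - 0)) \<longlongrightarrow> 0) (at 0)"
    proof (rule filterlim_split_at)
      show "((\<lambda>y. (flat_fun k y - flat_fun k 0) / (y - 0)) \<longlongrightarrow> 0) (at_left 0)"
        by (rule Lim_transform_eventually[OF tendsto_const])
          (auto simp: eventually_at_filter flat_fun_def)
      show "((\<lambda>y. (flat_fun k y - flat_fun k 0) / (y - 0)) \<longlongrightarrow> 0) (at_right 0)"
        by (rule Lim_transform_eventually[OF flat_fun_0[of "Suc k"]])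
          (auto simp: eventually_at_filter flat_fun_def field_simps)
    qed
    moreover have "flat_fun (k + 2) t - k * flat_fun (k + 1) t = 0"
      by (simp add: 3 flat_fun_def)
    ultimately show ?thesis by (simp only: has_field_derivative_iff 3)
  qed
qed

lemma Ck_on_flat_fun: "Ck_on n UNIV (flat_fun k)"
proof (induction n arbitrary: k)
  case 0
  then show ?case
    using flat_fun_has_derivative
    by (auto intro!: continuous_at_imp_continuous_on DERIV_isCont)
next
  case (Suc n)
  have "Ck_on n UNIV (\<lambda>t. v *\<^sub>R (flat_fun (k + 2) t + (- real k) *\<^sub>R flat_fun (k + 1) t))" for v :: real
    by (intro Ck_on_scaleR Ck_on_add Ck_on_const Suc.IH open_UNIV)
  then show ?case
    using flat_fun_has_derivative[of k, unfolded has_field_derivative_def]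
    by (intro Ck_on_SucI[where F' = "\<lambda>t v. v *\<^sub>R (flat_fun (k + 2) t + (- real k) *\<^sub>R flat_fun (k + 1) t)"])
      (auto simp: mult_commute_abs)
qed

text \<open>The argument \<open>F(1 - t)\<close> dominates \<open>F(1)\<close> for \<open>t \<le> 0\<close> and vanishes for \<open>t \<ge> 1\<close>.\<close>

definition plateau :: "real \<Rightarrow> real"
  where "plateau t = flat_fun 0 (flat_fun 0 1 - flat_fun 0 (1 - t)) / flat_fun 0 (flat_fun 0 1)"

lemma plateau_0: "t \<le> 0 \<Longrightarrow> plateau t = 0"
proof -
  assume "t \<le> 0"
  then have "flat_fun 0 1 \<le> flat_fun 0 (1 - t)" by (simp add: flat_fun_def inverse_le_1_iff)
  then show ?thesis by (simp add: plateau_def flat_fun_def)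
qed

lemma plateau_1: "t \<ge> 1 \<Longrightarrow> plateau t = 1"
  by (simp add: plateau_def flat_fun_def)

lemma Ck_on_plateau: "Ck_on k UNIV plateau"
proof -
  have "Ck_on k UNIV (\<lambda>t. inverse (flat_fun 0 (flat_fun 0 1)) *\<^sub>R
      flat_fun 0 (flat_fun 0 1 + (-1) *\<^sub>R flat_fun 0 (1 + (-1) *\<^sub>R t)))"
    by (intro Ck_on_scaleR Ck_on_const Ck_on_add Ck_on_id open_UNIV
        Ck_on_compose[OF open_UNIV open_UNIV _ _ Ck_on_flat_fun] subset_UNIV)
  then show ?thesis unfolding plateau_def by (simp add: field_simps)
qed

text \<open>The squared distance keeps the argument smooth at y. The factor is the inverse of r^2 -
  (r/2)^2 = 3r^2/4, so the argument reaches 1 at distance r/2 and 0 at distance r.\<close>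

definition bump :: "'a::euclidean_space \<Rightarrow> real \<Rightarrow> 'a \<Rightarrow> real"
  where "bump y r x = plateau ((4 / (3 * r\<^sup>2)) * (r\<^sup>2 - (x - y) \<bullet> (x - y)))"

lemma bump_1:
  assumes "r > 0" "x \<in> ball y (r / 2)"
  shows "bump y r x = 1"
proof -
  have "(norm (x - y))\<^sup>2 \<le> (r / 2)\<^sup>2"
    using assms by (intro power_mono) (auto simp: dist_norm norm_minus_commute)
  then have "r\<^sup>2 - (x - y) \<bullet> (x - y) \<ge> 3 / 4 * r\<^sup>2"
    by (simp add: power2_norm_eq_inner[symmetric] field_simps)
  then have "(4 / (3 * r\<^sup>2)) * (r\<^sup>2 - (x - y) \<bullet> (x - y)) \<ge> (4 / (3 * r\<^sup>2)) * (3 / 4 * r\<^sup>2)"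
    by (intro mult_left_mono) auto
  then show ?thesis using assms(1) by (auto simp: bump_def intro!: plateau_1)
qed

lemma bump_0:
  assumes "r > 0" "x \<notin> ball y r"
  shows "bump y r x = 0"
proof -
  have "(norm (x - y))\<^sup>2 \<ge> r\<^sup>2"
    using assms by (intro power_mono) (auto simp: dist_norm norm_minus_commute)
  then have "r\<^sup>2 - (x - y) \<bullet> (x - y) \<le> 0" by (simp add: power2_norm_eq_inner[symmetric])
  then show ?thesis unfolding bump_def
    by (intro plateau_0 mult_nonneg_nonpos) auto
qed

lemma Ck_on_inner:
  assumes "open S" "Ck_on k S F" "Ck_on k S G"
  shows "Ck_on k S (\<lambda>x. F x \<bullet> (G x :: 'b::euclidean_space))"
proof -
  have "F x \<bullet> G x = (\<Sum>b\<in>Basis. (F x \<bullet> b) *\<^sub>R (G x \<bullet> b))" for x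
    by (simp only: real_scaleR_def) (rule euclidean_inner)
  then show ?thesis
    by (simp only:) (rule Ck_on_sum[OF assms(1)],
      rule Ck_on_scaleR[OF assms(1) Ck_on_bounded_linear[OF assms(1) bounded_linear_inner_left assms(2)]
        Ck_on_bounded_linear[OF assms(1) bounded_linear_inner_left assms(3)]])
qed

lemma Cinf_on_bump: "open S \<Longrightarrow> Cinf_on S (bump y r)"
proof -
  assume S: "open S"
  have "Ck_on k S (\<lambda>x. plateau ((4 / (3 * r\<^sup>2)) *\<^sub>R (r\<^sup>2 + (-1) *\<^sub>R ((x + (- y)) \<bullet> (x + (- y))))))" for k
    by (intro Ck_on_compose[OF S open_UNIV _ _ Ck_on_plateau] Ck_on_scaleR Ck_on_const Ck_on_add
        Ck_on_inner Ck_on_id S subset_UNIV)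
  then show ?thesis by (simp add: Cinf_on_def bump_def[abs_def])
qed

subsection \<open>Hadamard's lemma\<close>

abbreviation seg :: "'a::real_vector \<Rightarrow> 'a \<Rightarrow> real \<Rightarrow> 'a"
  where "seg y x t \<equiv> y + t *\<^sub>R (x - y)"

lemma radial_segment:
  assumes "convex S" "y \<in> S" "x \<in> S" "t \<in> {0..1}"
  shows "seg y x t \<in> S"
proof -
  have "(1 - t) *\<^sub>R y + t *\<^sub>R x = seg y x t"
    by (simp add: scaleR_diff_left scaleR_diff_right)
  moreover have "(1 - t) *\<^sub>R y + t *\<^sub>R x \<in> S"
    by (rule convexD_alt[OF assms(1-3)]) (use assms(4) in simp_all)
  ultimately show ?thesis by (simp only:)
qed

lemma continuous_on_radial:
  fixes G :: "'a::euclidean_space \<Rightarrow> real"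
  assumes "convex S" "y \<in> S" "continuous_on S G" "continuous_on {0..1} w"
  shows "continuous_on (S \<times> {0..1}) (\<lambda>z. w (snd z) * G (y + snd z *\<^sub>R (fst z - y)))"
proof (rule continuous_on_mult)
  show "continuous_on (S \<times> {0..1}) (\<lambda>z. w (snd z))"
    by (rule continuous_on_compose2[OF assms(4) continuous_on_snd[OF continuous_on_id]]) auto
  have "continuous_on (S \<times> {0..1}) (\<lambda>z. y + snd z *\<^sub>R (fst z - y))"
    by (intro continuous_on_add continuous_on_scaleR continuous_on_diff continuous_on_const
        continuous_on_fst continuous_on_snd continuous_on_id)
  then show "continuous_on (S \<times> {0..1}) (\<lambda>z. G (y + snd z *\<^sub>R (fst z - y)))"
    by (rule continuous_on_compose2[OF assms(3)]) (use radial_segment[OF assms(1,2)] in auto)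
qed

lemma integrable_on_radial:
  fixes G :: "'a::euclidean_space \<Rightarrow> real"
  assumes "convex S" "y \<in> S" "continuous_on S G" "continuous_on {0..1} w" "x \<in> S"
  shows "(\<lambda>t. w t * G (seg y x t)) integrable_on cbox 0 1"
proof (rule integrable_continuous)
  have "continuous_on {0..1} (\<lambda>t. (x, t))"
    by (intro continuous_on_Pair continuous_on_const continuous_on_id)
  from continuous_on_compose2[OF continuous_on_radial[OF assms(1-4)] this]
  show "continuous_on (cbox 0 1) (\<lambda>t. w t * G (seg y x t))"
    using assms(5) by auto
qed

text \<open>Each differentiation under the integral sign brings out a factor t. The weight w absorbs
  it, which is why the induction ranges over w.\<close>

lemma Ck_on_radial_integral:
  fixes G :: "'a::euclidean_space \<Rightarrow> real"
  assumes "open S" "convex S" "y \<in> S" "Ck_on k S G" "continuous_on {0..1} w"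
  shows "Ck_on k S (\<lambda>x. integral (cbox 0 1) (\<lambda>t. w t * G (seg y x t)))"
  using assms(4,5)
proof (induction k arbitrary: G w)
  case 0
  then have "continuous_on (S \<times> cbox 0 1) (\<lambda>(x, t). w t * G (seg y x t))"
    using continuous_on_radial[OF assms(2,3)] by (simp add: split_beta)
  then show ?case using integral_continuous_on_param[of S 0 1 "\<lambda>x t. w t * G (seg y x t)"] by simp
next
  case (Suc k)
  note seg = radial_segment[OF assms(2,3)]
  note G = Ck_on_SucE[OF Suc.prems(1)]
  define G' where "G' x v = fd G x v" for x v
  have contG': "continuous_on S (\<lambda>x. G' x v)" for v
    using Ck_imp_continuous_on[OF G(2)[of v]] unfolding G'_def .
  have contG: "continuous_on S G"
    by (rule Ck_imp_continuous_on[OF Suc.prems(1)])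
  \<comment> \<open>The x-derivative of the integrand as a bounded linear map, so that its integral
    is the total derivative of the parameter integral. Its continuity is checked direction by
    direction.\<close>
  define fx where "fx x t = Blinfun (\<lambda>v. (w t * t) * G' (seg y x t) v)" for x t
  have bl: "bounded_linear (\<lambda>v. (w t * t) * G' (seg y x t) v)" if "x \<in> S" "t \<in> {0..1}" for x t
    using G(1)[OF seg[OF that]] unfolding G'_def
    by (intro bounded_linear_const_mult) (auto dest: has_derivative_bounded_linear)
  have fx: "blinfun_apply (fx x t) = (\<lambda>v. (w t * t) * G' (seg y x t) v)"
    if "x \<in> S" "t \<in> {0..1}" for x t
    unfolding fx_def using bl[OF that] by (rule bounded_linear_Blinfun_apply)
  have cont: "continuous_on (S \<times> cbox 0 1) (\<lambda>(x, t). (w t * t) * G' (seg y x t) v)" for v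
    using continuous_on_radial[OF assms(2,3) contG' continuous_on_mult[OF Suc.prems(2) continuous_on_id]]
    by (simp add: split_beta)
  have contfx: "continuous_on (S \<times> cbox 0 1) (\<lambda>(x, t). fx x t)"
    unfolding split_beta
  proof (rule continuous_on_blinfun_componentwise)
    fix v :: 'a
    show "continuous_on (S \<times> cbox 0 1) (\<lambda>z. blinfun_apply (fx (fst z) (snd z)) v)"
      using cont[of v] unfolding split_beta
      by (rule continuous_on_eq) (auto simp: fx)
  qed
  have int: "(\<lambda>t. w t * G (seg y x t)) integrable_on cbox 0 1" if "x \<in> S" for x
    by (rule integrable_on_radial[OF assms(2,3) contG Suc.prems(2) that])
  have der: "((\<lambda>x. integral (cbox 0 1) (\<lambda>t. w t * G (seg y x t))) has_derivative
      blinfun_apply (integral (cbox 0 1) (fx x))) (at x)" if "x \<in> S" for x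
  proof -
    have "((\<lambda>x. w t * G (seg y x t)) has_derivative blinfun_apply (fx x t)) (at x within S)"
      if "x \<in> S" "t \<in> cbox 0 1" for x t
    proof -
      have "((\<lambda>x. seg y x t) has_derivative (\<lambda>v. t *\<^sub>R v)) (at x)"
        by (auto intro!: derivative_eq_intros)
      from diff_chain_at[OF this G(1)[OF seg]]
      have "((\<lambda>x. G (seg y x t)) has_derivative
          (\<lambda>v. G' (seg y x t) (t *\<^sub>R v))) (at x)"
        using that by (simp add: o_def G'_def)
      moreover have "linear (G' (seg y x t))"
        using G(1)[OF seg, of x t] that unfolding G'_def
        by (auto dest: has_derivative_linear)
      ultimately have "((\<lambda>x. w t * G (seg y x t)) has_derivative
          (\<lambda>v. w t * (t * G' (seg y x t) v))) (at x)"
        by (intro has_derivative_mult_right) (simp add: linear_scale)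
      then show ?thesis using that fx[of x t]
        by (auto simp: mult.assoc intro: has_derivative_at_withinI)
    qed
    from leibniz_rule[of S 0 1 "\<lambda>x t. w t * G (seg y x t)", OF this int contfx that assms(2)]
    have "((\<lambda>x. integral (cbox 0 1) (\<lambda>t. w t * G (seg y x t))) has_derivative
      blinfun_apply (integral (cbox 0 1) (fx x))) (at x within S)" by simp
    then show ?thesis using at_within_open[OF that assms(1)] by simp
  qed
  show ?case
  proof (rule Ck_on_SucI[OF assms(1) der])
    fix v
    have "Ck_on k S (\<lambda>x. integral (cbox 0 1) (\<lambda>t. (w t * t) * G' (seg y x t) v))"
      unfolding G'_def by (intro Suc.IH G(2) continuous_on_mult Suc.prems(2) continuous_on_id)
    moreover have "integral (cbox 0 1) (\<lambda>t. (w t * t) * G' (seg y x t) v) =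
        blinfun_apply (integral (cbox 0 1) (fx x)) v" if "x \<in> S" for x
    proof -
      have "continuous_on (cbox 0 1) (\<lambda>t. (\<lambda>(x, t). fx x t) (x, t))"
        using that by (intro continuous_on_compose2[OF contfx] continuous_on_Pair
            continuous_on_const continuous_on_id) auto
      then have "continuous_on (cbox 0 1) (fx x)" by simp
      then have "fx x integrable_on cbox 0 1" by (rule integrable_continuous)
      from blinfun_apply_integral[OF this, of v]
      have "blinfun_apply (integral (cbox 0 1) (fx x)) v = integral (cbox 0 1) (\<lambda>t. blinfun_apply (fx x t) v)" .
      also have "\<dots> = integral (cbox 0 1) (\<lambda>t. (w t * t) * G' (seg y x t) v)"
        by (rule integral_cong) (use that fx in auto)
      finally show ?thesis by simp
    qed
    ultimately show "Ck_on k S (\<lambda>x. blinfun_apply (integral (cbox 0 1) (fx x)) v)"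
      by (rule Ck_on_cong[OF assms(1), rotated])
  qed
qed

text \<open>F x - F y is the integral of the derivative of F along the segment from y to x;
  \<open>G b\<close> averages the partial derivative in direction b over that segment.\<close>

lemma hadamard:
  fixes F :: "'a::euclidean_space \<Rightarrow> real"
  assumes "open S" "convex S" "y \<in> S" "Cinf_on S F"
  obtains G where "\<And>b. Cinf_on S (G b)"
    "\<And>b. G b y = fd F y b"
    "\<And>x. x \<in> S \<Longrightarrow> F x = F y + (\<Sum>b\<in>Basis. ((x - y) \<bullet> b) * G b x)"
proof
  define G where "G b x = integral (cbox 0 1) (\<lambda>t. 1 * fd F (seg y x t) b)" for b x
  show "Cinf_on S (G b)" for b
    unfolding G_def
    by (subst Cinf_on_def)
      (intro allI Ck_on_radial_integral assms CinfD[OF Cinf_on_deriv] continuous_on_const)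
  show "G b y = fd F y b" for b by (simp add: G_def)
  fix x assume x: "x \<in> S"
  have seg: "seg y x t \<in> S" if "t \<in> {0..1}" for t
    using convexD_alt[OF assms(2) assms(3) x, of t] that by (simp add: algebra_simps)
  note F = Cinf_on_has_derivative[OF assms(4)]
  have contF': "continuous_on S (\<lambda>x. fd F x v)" for v
    by (rule Ck_imp_continuous_on[OF CinfD[OF Cinf_on_deriv[OF assms(4)]]])
  have int: "(\<lambda>t. fd F (seg y x t) b) integrable_on cbox 0 1" for b
    using integrable_on_radial[OF assms(2,3) contF', of "\<lambda>_. 1" x] x by simp
  have "((\<lambda>t. fd F (seg y x t) (x - y)) has_integral
      F (y + 1 *\<^sub>R (x - y)) - F (y + 0 *\<^sub>R (x - y))) {0..1}"
  proof (rule fundamental_theorem_of_calculus)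
    fix t :: real assume t: "t \<in> {0..1}"
    have "((\<lambda>t. seg y x t) has_derivative (\<lambda>s. s *\<^sub>R (x - y))) (at t)"
      by (auto intro!: derivative_eq_intros)
    from diff_chain_at[OF this F[OF seg[OF t]]]
    have "((\<lambda>t. F (seg y x t)) has_derivative
        (\<lambda>s. fd F (seg y x t) (s *\<^sub>R (x - y)))) (at t)"
      by (simp add: o_def)
    moreover have "linear (fd F (seg y x t))"
      using F[OF seg[OF t]] has_derivative_linear by blast
    ultimately show "((\<lambda>t. F (seg y x t)) has_vector_derivative
        fd F (seg y x t) (x - y)) (at t within {0..1})"
      unfolding has_vector_derivative_def
      by (auto simp: linear_scale intro: has_derivative_at_withinI)
  qed simp
  then have "F x - F y = integral (cbox 0 1) (\<lambda>t. fd F (seg y x t) (x - y))"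
    by (simp add: integral_unique)
  also have "\<dots> = integral (cbox 0 1) (\<lambda>t. \<Sum>b\<in>Basis. ((x - y) \<bullet> b) * fd F (seg y x t) b)"
  proof (rule integral_cong)
    fix t :: real assume "t \<in> cbox 0 1"
    then have "linear (fd F (seg y x t))"
      using F[OF seg] has_derivative_linear by auto
    then have "fd F (seg y x t) (\<Sum>b\<in>Basis. ((x - y) \<bullet> b) *\<^sub>R b) =
        (\<Sum>b\<in>Basis. ((x - y) \<bullet> b) * fd F (seg y x t) b)"
      by (simp add: linear_sum linear_scale)
    then show "fd F (seg y x t) (x - y) =
        (\<Sum>b\<in>Basis. ((x - y) \<bullet> b) * fd F (seg y x t) b)"
      by (simp add: euclidean_representation)
  qed
  also have "\<dots> = (\<Sum>b\<in>Basis. ((x - y) \<bullet> b) * G b x)"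
    unfolding G_def using int by (subst integral_sum) (auto intro: integrable_on_mult_right)
  finally show "F x = F y + (\<Sum>b\<in>Basis. ((x - y) \<bullet> b) * G b x)" by simp
qed

lemma sum_apply: "(\<Sum>i\<in>I. F i) x = (\<Sum>i\<in>I. F i x)"
  for F :: "'i \<Rightarrow> 'a \<Rightarrow> 'b::comm_monoid_add"
  by (induction I rule: infinite_finite_induct) auto

subsection \<open>Smooth functions on a manifold\<close>

locale smooth_manifold =
  fixes A :: "('m::{t2_space,second_countable_topology}, 'e::euclidean_space) chart set"
  assumes atlas: "smooth_atlas A"
begin

abbreviation "SF \<equiv> smooth_functions A"
abbreviation "VF \<equiv> vector_fields A"
abbreviation "T p \<equiv> tangent_space A p"
abbreviation "br \<equiv> lie_bracket"

lemma chart_open: "(U, \<phi>) \<in> A \<Longrightarrow> open U" "(U, \<phi>) \<in> A \<Longrightarrow> open (\<phi> ` U)"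
  using atlas unfolding smooth_atlas_def by auto

lemma chart_homeo: "(U, \<phi>) \<in> A \<Longrightarrow> homeomorphism U (\<phi> ` U) \<phi> (inv_into U \<phi>)"
  using atlas unfolding smooth_atlas_def by auto

lemma chart_inv:
  "(U, \<phi>) \<in> A \<Longrightarrow> q \<in> U \<Longrightarrow> inv_into U \<phi> (\<phi> q) = q"
  "(U, \<phi>) \<in> A \<Longrightarrow> x \<in> \<phi> ` U \<Longrightarrow> \<phi> (inv_into U \<phi> x) = x"
  "(U, \<phi>) \<in> A \<Longrightarrow> x \<in> \<phi> ` U \<Longrightarrow> inv_into U \<phi> x \<in> U"
  using chart_homeo by (auto simp: homeomorphism_def f_inv_into_f inv_into_into)

lemma chart_at: obtains U \<phi> where "(U, \<phi>) \<in> A" "p \<in> U"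
proof -
  have "p \<in> (\<Union>(U, \<phi>)\<in>A. U)" using atlas by (simp add: smooth_atlas_def)
  then show ?thesis using that by auto
qed

lemma chart_transition:
  "(U, \<phi>) \<in> A \<Longrightarrow> (W, \<psi>) \<in> A \<Longrightarrow> Cinf_on (\<phi> ` (U \<inter> W)) (\<psi> \<circ> inv_into U \<phi>)"
  using atlas unfolding smooth_atlas_def by fast

lemma chart_image_open:
  assumes "(U, \<phi>) \<in> A" "open N"
  shows "open (\<phi> ` (U \<inter> N))"
proof -
  have "\<phi> ` (U \<inter> N) = \<phi> ` U \<inter> inv_into U \<phi> -` N"
    using chart_inv[OF assms(1)] by (auto simp: image_iff)
  moreover have "open (\<phi> ` U \<inter> inv_into U \<phi> -` N)"
    using chart_homeo[OF assms(1)] chart_open(2)[OF assms(1)] assms(2)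
    by (simp add: homeomorphism_def continuous_on_open_vimage Int_commute)
  ultimately show ?thesis by simp
qed

lemma chart_preimage_open:
  assumes "(U, \<phi>) \<in> A" "open N"
  shows "open {q \<in> U. \<phi> q \<in> N}"
proof -
  have "open (\<phi> -` N \<inter> U)"
    using chart_homeo[OF assms(1)] chart_open(1)[OF assms(1)] assms(2)
    by (simp add: homeomorphism_def continuous_on_open_vimage)
  then show ?thesis by (simp add: vimage_def Int_def conj_commute)
qed

lemma smooth_functionsD: "h \<in> SF \<Longrightarrow> (U, \<phi>) \<in> A \<Longrightarrow> Cinf_on (\<phi> ` U) (\<lambda>x. h (inv_into U \<phi> x))"
  unfolding smooth_functions_def by (auto simp: o_def)

lemma smooth_functionsI:
  "(\<And>U \<phi> k. (U, \<phi>) \<in> A \<Longrightarrow> Ck_on k (\<phi> ` U) (\<lambda>x. h (inv_into U \<phi> x))) \<Longrightarrow> h \<in> SF"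
  unfolding smooth_functions_def by (auto simp: o_def Cinf_on_def)

lemma SF_const [simp, intro]: "(\<lambda>_. c) \<in> SF"
  by (rule smooth_functionsI) (auto intro: Ck_on_const chart_open)

lemma SF_add [simp, intro]: "h \<in> SF \<Longrightarrow> k \<in> SF \<Longrightarrow> (\<lambda>q. h q + k q) \<in> SF"
  by (rule smooth_functionsI) (intro Ck_on_add chart_open CinfD[OF smooth_functionsD])

lemma SF_mult [simp, intro]:
  assumes "h \<in> SF" "k \<in> SF"
  shows "(\<lambda>q. h q * k q) \<in> SF"
proof (rule smooth_functionsI)
  fix U \<phi> n assume U: "(U, \<phi>) \<in> A"
  have "Ck_on n (\<phi> ` U) (\<lambda>x. h (inv_into U \<phi> x) *\<^sub>R k (inv_into U \<phi> x))"
    by (rule Ck_on_scaleR[OF chart_open(2)[OF U] CinfD[OF smooth_functionsD[OF assms(1) U]]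
          CinfD[OF smooth_functionsD[OF assms(2) U]]])
  then show "Ck_on n (\<phi> ` U) (\<lambda>x. h (inv_into U \<phi> x) * k (inv_into U \<phi> x))" by simp
qed

lemma SF_minus [simp, intro]: "h \<in> SF \<Longrightarrow> (\<lambda>q. - h q) \<in> SF"
  using SF_mult[OF SF_const[of "-1"]] by simp

lemma SF_diff [simp, intro]: "h \<in> SF \<Longrightarrow> k \<in> SF \<Longrightarrow> (\<lambda>q. h q - k q) \<in> SF"
  using SF_add[OF _ SF_minus] by simp

lemma SF_sum [intro]: "(\<And>i. i \<in> I \<Longrightarrow> h i \<in> SF) \<Longrightarrow> (\<lambda>q. \<Sum>i\<in>I. h i q) \<in> SF"
  by (induction I rule: infinite_finite_induct) auto

text \<open>The preimage K of the ball is compact, hence closed since the manifold is Hausdorff.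
  Near a point of U the chart transition gives smoothness; near a point outside U the complement of
  K is a neighbourhood on which the function is 0.\<close>

lemma smooth_extend_by_zero:
  assumes U: "(U, \<phi>) \<in> A" and cb: "cball y r \<subseteq> \<phi> ` U"
    and F: "Cinf_on (\<phi> ` U) F" "\<And>x. x \<in> \<phi> ` U \<Longrightarrow> x \<notin> cball y r \<Longrightarrow> F x = 0"
  shows "(\<lambda>q. if q \<in> U then F (\<phi> q) else 0) \<in> SF"
proof (rule smooth_functionsI)
  fix W \<psi> k assume W: "(W, \<psi>) \<in> A"
  define u where "u = (\<lambda>q. if q \<in> U then F (\<phi> q) else 0)"
  define K where "K = inv_into U \<phi> ` cball y r"
  have "compact K" unfolding K_def
    using chart_homeo[OF U] cb
    by (intro compact_continuous_image) (auto simp: homeomorphism_def intro: continuous_on_subset)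
  then have "open (- K)" using compact_imp_closed by blast
  show "Ck_on k (\<psi> ` W) (\<lambda>x. u (inv_into W \<psi> x))"
  proof (rule Ck_on_local)
    fix x assume "x \<in> \<psi> ` W"
    then obtain q where q: "q \<in> W" "x = \<psi> q" by auto
    show "\<exists>S. open S \<and> x \<in> S \<and> Ck_on k S (\<lambda>x. u (inv_into W \<psi> x))"
    proof (cases "q \<in> U")
      case True
      have o: "open (\<psi> ` (W \<inter> U))" using chart_image_open[OF W] chart_open(1)[OF U] by simp
      have "Ck_on k (\<psi> ` (W \<inter> U)) (\<lambda>x. F ((\<phi> \<circ> inv_into W \<psi>) x))"
        using chart_inv(1)[OF W]
        by (intro Ck_on_compose[OF o chart_open(2)[OF U] _ CinfD[OF chart_transition[OF W U]]
              CinfD[OF F(1)]]) auto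
      then have "Ck_on k (\<psi> ` (W \<inter> U)) (\<lambda>x. u (inv_into W \<psi> x))"
        by (rule Ck_on_cong[OF o, rotated]) (use chart_inv(1)[OF W] in \<open>auto simp: u_def\<close>)
      then show ?thesis using True q o by blast
    next
      case False
      have o: "open (\<psi> ` (W \<inter> - K))" using chart_image_open[OF W \<open>open (- K)\<close>] .
      have "u q' = 0" if "q' \<notin> K" for q'
      proof -
        have "\<phi> q' \<notin> cball y r" if "q' \<in> U"
          using \<open>q' \<notin> K\<close> chart_inv(1)[OF U that] unfolding K_def by (metis imageI)
        then show ?thesis using F(2) by (auto simp: u_def)
      qed
      then have "Ck_on k (\<psi> ` (W \<inter> - K)) (\<lambda>x. u (inv_into W \<psi> x))"
        by (intro Ck_on_cong[OF o _ Ck_on_const[OF o, of k 0]])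
          (use chart_inv(1)[OF W] in auto)
      moreover have "q \<notin> K"
        using False cb chart_inv(3)[OF U] unfolding K_def by auto
      ultimately show ?thesis using q o by blast
    qed
  qed
qed

lemma exists_bump:
  assumes "open N" "p \<in> N"
  obtains \<rho> N' where "\<rho> \<in> SF" "open N'" "p \<in> N'" "N' \<subseteq> N" "\<And>q. q \<in> N' \<Longrightarrow> \<rho> q = 1"
    "\<And>q. q \<notin> N \<Longrightarrow> \<rho> q = 0"
proof -
  obtain U \<phi> where U: "(U, \<phi>) \<in> A" "p \<in> U" by (rule chart_at)
  have "open (\<phi> ` (U \<inter> N))" "\<phi> p \<in> \<phi> ` (U \<inter> N)" using chart_image_open U assms by auto
  then obtain r where r: "r > 0" "cball (\<phi> p) r \<subseteq> \<phi> ` (U \<inter> N)"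
    using open_contains_cball by blast
  define \<rho> where "\<rho> = (\<lambda>q. if q \<in> U then bump (\<phi> p) r (\<phi> q) else 0)"
  have cb: "cball (\<phi> p) r \<subseteq> \<phi> ` U" using r by auto
  have in_N: "q \<in> N" if "q \<in> U" "\<phi> q \<in> ball (\<phi> p) r" for q
  proof -
    have "\<phi> q \<in> \<phi> ` (U \<inter> N)" using r(2) that(2) ball_subset_cball by blast
    then show ?thesis using that(1) chart_inv(1)[OF U(1)] by (metis IntD1 IntD2 imageE)
  qed
  show ?thesis
  proof
    show "\<rho> \<in> SF" unfolding \<rho>_def
      by (rule smooth_extend_by_zero[OF U(1) cb Cinf_on_bump[OF chart_open(2)[OF U(1)]]])
        (rule bump_0[OF r(1)], auto)
    show "open {q \<in> U. \<phi> q \<in> ball (\<phi> p) (r / 2)}" by (rule chart_preimage_open[OF U(1)]) simp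
    show "p \<in> {q \<in> U. \<phi> q \<in> ball (\<phi> p) (r / 2)}" using U(2) r(1) by simp
    show "{q \<in> U. \<phi> q \<in> ball (\<phi> p) (r / 2)} \<subseteq> N" using in_N r(1) by auto
    show "\<rho> q = 1" if "q \<in> {q \<in> U. \<phi> q \<in> ball (\<phi> p) (r / 2)}" for q
      using that bump_1[OF r(1)] by (auto simp: \<rho>_def)
    show "\<rho> q = 0" if "q \<notin> N" for q
      using that in_N bump_0[OF r(1)] by (auto simp: \<rho>_def)
  qed
qed

subsection \<open>Tangent vectors\<close>

lemma tangentD:
  assumes "v \<in> T p"
  shows "h \<in> SF \<Longrightarrow> k \<in> SF \<Longrightarrow> v (\<lambda>q. h q + k q) = v h + v k"
    and "h \<in> SF \<Longrightarrow> k \<in> SF \<Longrightarrow> v (\<lambda>q. h q * k q) = v h * k p + h p * v k"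
    and "h \<in> SF \<Longrightarrow> v (\<lambda>q. c * h q) = c * v h"
    and "h \<notin> SF \<Longrightarrow> v h = 0"
  using assms unfolding tangent_space_def by auto

text \<open>The product rule for 1 = 1 * 1 gives v(1) = 2 v(1).\<close>

lemma tangent_const: "v \<in> T p \<Longrightarrow> v (\<lambda>_. c) = 0"
  using tangentD(2)[of v p "\<lambda>_. 1" "\<lambda>_. 1"] tangentD(3)[of v p "\<lambda>_. 1" c] by simp

lemma tangent_minus: "v \<in> T p \<Longrightarrow> h \<in> SF \<Longrightarrow> v (\<lambda>q. - h q) = - v h"
  using tangentD(3)[of v p h "-1"] by simp

lemma tangent_diff:
  "v \<in> T p \<Longrightarrow> h \<in> SF \<Longrightarrow> k \<in> SF \<Longrightarrow> v (\<lambda>q. h q - k q) = v h - v k"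
  using tangentD(1)[of v p h "\<lambda>q. - k q"] tangent_minus[of v p k] by simp

lemma tangent_sum:
  assumes "v \<in> T p" "\<And>i. i \<in> I \<Longrightarrow> h i \<in> SF"
  shows "v (\<lambda>q. \<Sum>i\<in>I. h i q) = (\<Sum>i\<in>I. v (h i))"
  using assms(2) by (induction I rule: infinite_finite_induct)
    (auto simp: tangent_const[OF assms(1)] tangentD(1)[OF assms(1)] SF_sum)

text \<open>A bump \<rho> at p supported in N makes \<rho> (h - k) vanish identically, and the
  product rule at p leaves v(h - k).\<close>

lemma tangent_local:
  assumes v: "v \<in> T p" and hk: "h \<in> SF" "k \<in> SF" and N: "open N" "p \<in> N"
    and eq: "\<And>q. q \<in> N \<Longrightarrow> h q = k q"
  shows "v h = v k"
proof -
  obtain \<rho> N' where \<rho>: "\<rho> \<in> SF" "p \<in> N'" "\<And>q. q \<in> N' \<Longrightarrow> \<rho> q = 1" "\<And>q. q \<notin> N \<Longrightarrow> \<rho> q = 0"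
    using exists_bump[OF N] by metis
  have "(\<lambda>q. \<rho> q * (h q - k q)) = (\<lambda>_. 0)" using eq \<rho>(4) by fastforce
  then have "0 = v \<rho> * (h p - k p) + \<rho> p * v (\<lambda>q. h q - k q)"
    using tangentD(2)[OF v \<rho>(1) SF_diff[OF hk]] tangent_const[OF v, of 0] by simp
  then show ?thesis
    using tangent_diff[OF v hk] \<rho>(3)[OF \<rho>(2)] eq[OF N(2)] by simp
qed

lemma tangentI:
  assumes "\<And>h k. h \<in> SF \<Longrightarrow> k \<in> SF \<Longrightarrow> v (\<lambda>q. h q + k q) = v h + v k"
    "\<And>h k. h \<in> SF \<Longrightarrow> k \<in> SF \<Longrightarrow> v (\<lambda>q. h q * k q) = v h * k p + h p * v k"
    "\<And>h c. h \<in> SF \<Longrightarrow> v (\<lambda>q. c * h q) = c * v h" "\<And>h. h \<notin> SF \<Longrightarrow> v h = 0"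
  shows "v \<in> T p"
  using assms unfolding tangent_space_def by simp

lemma tangent_subspace: "subspace (T p)"
proof (rule subspaceI)
  show "0 \<in> T p" by (rule tangentI) auto
  fix u v c assume u: "u \<in> T p"
  show "u + v \<in> T p" if v: "v \<in> T p"
    by (rule tangentI, simp add: tangentD(1)[OF u] tangentD(1)[OF v],
        simp add: tangentD(2)[OF u] tangentD(2)[OF v] algebra_simps,
        simp add: tangentD(3)[OF u] tangentD(3)[OF v] distrib_left,
        simp add: tangentD(4)[OF u] tangentD(4)[OF v])
  show "c *\<^sub>R u \<in> T p"
    by (rule tangentI, simp add: scaleR_fun_def tangentD(1)[OF u] distrib_left,
        simp add: scaleR_fun_def tangentD(2)[OF u] algebra_simps,
        simp add: scaleR_fun_def tangentD(3)[OF u], simp add: scaleR_fun_def tangentD(4)[OF u])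
qed

lemma VF_tangent [simp]: "X \<in> VF \<Longrightarrow> X p \<in> T p"
  unfolding vector_fields_def by auto

lemma VF_smooth: "X \<in> VF \<Longrightarrow> h \<in> SF \<Longrightarrow> (\<lambda>p. X p h) \<in> SF"
  unfolding vector_fields_def by auto

lemma VF_I: "(\<And>p. X p \<in> T p) \<Longrightarrow> (\<And>h. h \<in> SF \<Longrightarrow> (\<lambda>p. X p h) \<in> SF) \<Longrightarrow> X \<in> VF"
  unfolding vector_fields_def by auto

lemma VF_add [simp, intro]: "X \<in> VF \<Longrightarrow> Y \<in> VF \<Longrightarrow> X + Y \<in> VF"
  by (rule VF_I) (simp_all add: subspace_add[OF tangent_subspace] VF_smooth)

lemma VF_fscale [simp, intro]: "h \<in> SF \<Longrightarrow> X \<in> VF \<Longrightarrow> fscale h X \<in> VF"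
  by (rule VF_I) (simp_all add: fscale_def subspace_scale[OF tangent_subspace],
    simp add: scaleR_fun_def VF_smooth)

lemma VF_minus [simp, intro]: "X \<in> VF \<Longrightarrow> - X \<in> VF"
  by (rule VF_I) (simp_all add: subspace_neg[OF tangent_subspace] VF_smooth)

lemma VF_diff [simp, intro]: "X \<in> VF \<Longrightarrow> Y \<in> VF \<Longrightarrow> X - Y \<in> VF"
  using VF_add[OF _ VF_minus] by (metis diff_conv_add_uminus)

lemma VF_zero [simp, intro]: "0 \<in> VF"
  by (rule VF_I) (simp_all add: subspace_0[OF tangent_subspace])

lemma VF_sum [simp, intro]: "(\<And>i. i \<in> I \<Longrightarrow> X i \<in> VF) \<Longrightarrow> (\<Sum>i\<in>I. X i) \<in> VF"
  by (induction I rule: infinite_finite_induct) auto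

lemma VF_bracket [simp, intro]:
  assumes X: "X \<in> VF" and Y: "Y \<in> VF"
  shows "br X Y \<in> VF"
proof (rule VF_I)
  note XT = VF_tangent[OF X] and YT = VF_tangent[OF Y]
    and VF_smooth[OF X, simp] and VF_smooth[OF Y, simp]
  show "br X Y p \<in> T p" for p
  proof (rule tangentI)
    fix h c assume h: "h \<in> SF"
    have "X p (\<lambda>q. Y q (\<lambda>q. c * h q)) = c * X p (\<lambda>q. Y q h)"
      "Y p (\<lambda>q. X q (\<lambda>q. c * h q)) = c * Y p (\<lambda>q. X q h)"
      using X Y h by (simp_all add: tangentD(3)[OF XT] tangentD(3)[OF YT])
    then show "br X Y p (\<lambda>q. c * h q) = c * br X Y p h"
      by (simp add: lie_bracket_def algebra_simps)
  next
    \<comment> \<open>Off the smooth functions both inner derivatives are the zero function, so the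
      bracket respects the convention for tangent vectors.\<close>
    fix h assume "h \<notin> SF"
    then show "br X Y p h = 0"
      using tangentD(4)[OF XT] tangentD(4)[OF YT]
      by (simp add: lie_bracket_def tangent_const[OF XT] tangent_const[OF YT])
  qed (simp_all add: lie_bracket_def tangentD(1,2)[OF XT] tangentD(1,2)[OF YT] algebra_simps)
  show "(\<lambda>p. br X Y p h) \<in> SF" if "h \<in> SF" for h
    using that by (simp add: lie_bracket_def)
qed

lemma VF_eqI:
  assumes "X \<in> VF" "Y \<in> VF" "\<And>p h. h \<in> SF \<Longrightarrow> X p h = Y p h"
  shows "X = Y"
  using tangentD(4)[OF VF_tangent[OF assms(1)]] tangentD(4)[OF VF_tangent[OF assms(2)]] assms(3)
  by (metis ext)

subsection \<open>Coordinate frames\<close>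

text \<open>The fields and the coordinates are global and form a frame with its coordinates on N
  only. This avoids vector fields on open subsets.\<close>

definition coordinate_frame :: "'m \<Rightarrow> 'm set \<Rightarrow> ('e \<Rightarrow> 'm vfield) \<Rightarrow> ('e \<Rightarrow> 'm \<Rightarrow> real) \<Rightarrow> bool"
  where "coordinate_frame p N E x \<longleftrightarrow> open N \<and> p \<in> N \<and>
    (\<forall>b\<in>Basis. E b \<in> VF) \<and> (\<forall>b\<in>Basis. x b \<in> SF) \<and>
    (\<forall>q\<in>N. \<forall>b\<in>Basis. \<forall>c\<in>Basis. E b q (x c) = (if b = c then 1 else 0)) \<and>
    (\<forall>q\<in>N. \<forall>v\<in>T q. v = (\<Sum>b\<in>Basis. v (x b) *\<^sub>R E b q))"

lemma coordinate_frameD: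
  assumes "coordinate_frame p N E x"
  shows "open N" "p \<in> N" "b \<in> Basis \<Longrightarrow> E b \<in> VF" "b \<in> Basis \<Longrightarrow> x b \<in> SF"
    "q \<in> N \<Longrightarrow> b \<in> Basis \<Longrightarrow> c \<in> Basis \<Longrightarrow> E b q (x c) = (if b = c then 1 else 0)"
    "q \<in> N \<Longrightarrow> v \<in> T q \<Longrightarrow> v = (\<Sum>b\<in>Basis. v (x b) *\<^sub>R E b q)"
  using assms unfolding coordinate_frame_def by blast+

text \<open>Partial derivatives and coordinates of a chart are multiplied by a bump and extended by
  0; N is where the bump is known to be 1.\<close>

lemma local_frame: obtains N E x where "coordinate_frame p N E x"
proof -
  obtain U \<phi> where U: "(U, \<phi>) \<in> A" "p \<in> U" by (rule chart_at)
  obtain r where r: "r > 0" "cball (\<phi> p) r \<subseteq> \<phi> ` U"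
    using chart_open(2)[OF U(1)] U(2) open_contains_cball by blast
  define \<kappa> where "\<kappa> = bump (\<phi> p) r"
  have \<kappa>0: "\<kappa> y = 0" if "y \<notin> cball (\<phi> p) r" for y
    unfolding \<kappa>_def by (rule bump_0[OF r(1)]) (use that in auto)
  define N where "N = {q \<in> U. \<phi> q \<in> ball (\<phi> p) (r / 2)}"
  have \<kappa>1: "\<kappa> (\<phi> q) = 1" if "q \<in> N" for q
    unfolding \<kappa>_def by (rule bump_1[OF r(1)]) (use that N_def in auto)
  have oN: "open N" unfolding N_def by (rule chart_preimage_open[OF U(1)]) simp
  have opU: "open (\<phi> ` U)" by (rule chart_open(2)[OF U(1)])
  have C\<kappa>: "Cinf_on (\<phi> ` U) \<kappa>" unfolding \<kappa>_def by (rule Cinf_on_bump[OF opU])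
  define loc where "loc h = (\<lambda>y. h (inv_into U \<phi> y))" for h :: "'m \<Rightarrow> real"
  have Cloc: "Cinf_on (\<phi> ` U) (loc h)" if "h \<in> SF" for h
    unfolding loc_def by (rule smooth_functionsD[OF that U(1)])
  have dloc: "(loc h has_derivative fd (loc h) (\<phi> q)) (at (\<phi> q))"
    if "h \<in> SF" "q \<in> U" for h q
    by (rule Cinf_on_has_derivative[OF Cloc[OF that(1)]]) (use that in auto)
  have loc_q: "loc h (\<phi> q) = h q" if "q \<in> U" for h q
    by (simp add: loc_def chart_inv(1)[OF U(1) that])
  define E where "E b q h = (if q \<in> U then if h \<in> SF then \<kappa> (\<phi> q) * fd (loc h) (\<phi> q) b else 0 else 0)"
    for b q h
  define x where "x b = (\<lambda>q. if q \<in> U then \<kappa> (\<phi> q) * (\<phi> q \<bullet> b) else 0)" for b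
  have E_VF: "E b \<in> VF" for b
  proof (rule VF_I)
    fix q
    show "E b q \<in> T q"
    proof (cases "q \<in> U")
      case False
      then show ?thesis by (auto simp: tangent_space_def E_def)
    next
      case True
      show ?thesis
      proof (rule tangentI)
        fix h c assume h: "h \<in> SF"
        have "((\<lambda>y. c * loc h y) has_derivative (\<lambda>v. c * fd (loc h) (\<phi> q) v)) (at (\<phi> q))"
          by (rule has_derivative_mult_right[OF dloc[OF h True]])
        from fun_cong[OF frechet_derivative_at[OF this], of b, symmetric]
        show "E b q (\<lambda>q. c * h q) = c * E b q h"
          using True h SF_mult[OF SF_const h, of c] by (simp add: E_def loc_def)
      next
        fix h k assume h: "h \<in> SF" and k: "k \<in> SF"
        show "E b q (\<lambda>q. h q + k q) = E b q h + E b q k"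
          using fun_cong[OF frechet_derivative_at[OF has_derivative_add[OF dloc[OF h True] dloc[OF k True]]], of b, symmetric]
            True h k by (simp add: E_def loc_def algebra_simps)
        show "E b q (\<lambda>q. h q * k q) = E b q h * k q + h q * E b q k"
          using fun_cong[OF frechet_derivative_at[OF has_derivative_mult[OF dloc[OF h True] dloc[OF k True]]], of b, symmetric]
            True h k chart_inv(1)[OF U(1) True] by (simp add: E_def loc_def algebra_simps)
      qed (simp add: E_def)
    qed
    show "(\<lambda>q. E b q h) \<in> SF" if h: "h \<in> SF" for h
    proof -
      have "Ck_on k (\<phi> ` U) (\<lambda>y. \<kappa> y *\<^sub>R fd (loc h) y b)" for k
        by (rule Ck_on_scaleR[OF opU CinfD[OF C\<kappa>]
              CinfD[OF Cinf_on_deriv[OF Cloc[OF h]]]])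
      then have "Cinf_on (\<phi> ` U) (\<lambda>y. \<kappa> y *\<^sub>R fd (loc h) y b)"
        by (simp add: Cinf_on_def)
      from smooth_extend_by_zero[OF U(1) r(2) this]
      show ?thesis using h \<kappa>0 by (simp add: E_def cong: if_cong)
    qed
  qed
  have x_SF: "x b \<in> SF" for b
  proof -
    have "Ck_on k (\<phi> ` U) (\<lambda>y. \<kappa> y *\<^sub>R (y \<bullet> b))" for k
      by (rule Ck_on_scaleR[OF opU CinfD[OF C\<kappa>]
            Ck_on_bounded_linear[OF opU bounded_linear_inner_left Ck_on_id[OF opU]]])
    then have "Cinf_on (\<phi> ` U) (\<lambda>y. \<kappa> y *\<^sub>R (y \<bullet> b))" by (simp add: Cinf_on_def)
    from smooth_extend_by_zero[OF U(1) r(2) this]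
    show ?thesis using \<kappa>0 by (simp add: x_def cong: if_cong)
  qed
  have delta: "E b q (x c) = (if b = c then 1 else 0)"
    if q: "q \<in> N" and b: "b \<in> Basis" and c: "c \<in> Basis" for q b c
  proof -
    have qU: "q \<in> U" and qb: "\<phi> q \<in> ball (\<phi> p) (r / 2)" using q by (auto simp: N_def)
    have "((\<lambda>y. y \<bullet> c) has_derivative (\<lambda>v. v \<bullet> c)) (at (\<phi> q))"
      by (rule bounded_linear_imp_has_derivative[OF bounded_linear_inner_left])
    then have "(loc (x c) has_derivative (\<lambda>v. v \<bullet> c)) (at (\<phi> q))"
    proof (rule has_derivative_transform_within_open[of _ _ _ _ "ball (\<phi> p) (r / 2)"])
      fix y assume y: "y \<in> ball (\<phi> p) (r / 2)"
      then have "y \<in> \<phi> ` U" using r by auto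
      then show "y \<bullet> c = loc (x c) y"
        using chart_inv(2,3)[OF U(1)] bump_1[OF r(1) y] by (simp add: loc_def x_def \<kappa>_def)
    qed (use qb in auto)
    from fun_cong[OF frechet_derivative_at[OF this], of b, symmetric]
    show ?thesis using qU \<kappa>1[OF q] x_SF b c by (simp add: E_def inner_Basis)
  qed
  \<comment> \<open>By Hadamard's lemma, near q the function h is h(q) plus a sum of products of
    \<open>x b - x b q\<close> with smooth functions \<open>w b\<close>. A derivation at q sees only
    \<open>w b q\<close>, the partial derivative of h.\<close>
  have span: "v = (\<Sum>b\<in>Basis. v (x b) *\<^sub>R E b q)" if q: "q \<in> N" and v: "v \<in> T q" for q v
  proof
    fix h
    have qU: "q \<in> U" and qb: "\<phi> q \<in> ball (\<phi> p) (r / 2)" using q by (auto simp: N_def)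
    have rhs: "(\<Sum>b\<in>Basis. v (x b) *\<^sub>R E b q) h = (\<Sum>b\<in>Basis. v (x b) * E b q h)"
      by (simp add: sum_apply scaleR_fun_def)
    show "v h = (\<Sum>b\<in>Basis. v (x b) *\<^sub>R E b q) h"
    proof (cases "h \<in> SF")
      case False
      then have "E b q h = 0" for b by (simp add: E_def)
      then show ?thesis using tangentD(4)[OF v False] by (simp add: rhs)
    next
      case True
      obtain \<epsilon> where \<epsilon>: "\<epsilon> > 0" "cball (\<phi> q) \<epsilon> \<subseteq> ball (\<phi> p) (r / 2)"
        using qb open_contains_cball open_ball by metis
      define B where "B = ball (\<phi> p) (r / 2)"
      have BU: "B \<subseteq> \<phi> ` U" using r unfolding B_def by auto
      have CB: "Cinf_on B (loc h)"
        using Cloc[OF True] BU unfolding Cinf_on_def by (auto intro: Ck_on_subset)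
      obtain G where G: "\<And>b. Cinf_on B (G b)" "\<And>b. G b (\<phi> q) = fd (loc h) (\<phi> q) b"
          "\<And>y. y \<in> B \<Longrightarrow> loc h y = loc h (\<phi> q) + (\<Sum>b\<in>Basis. ((y - \<phi> q) \<bullet> b) * G b y)"
        using hadamard[OF _ _ _ CB, of "\<phi> q"] qb unfolding B_def by auto
      \<comment> \<open>The Hadamard factors live on B only. A second bump makes them global without
        changing them near q.\<close>
      define \<theta> where "\<theta> = bump (\<phi> q) \<epsilon>"
      define w where "w b = (\<lambda>q'. if q' \<in> U then \<theta> (\<phi> q') * G b (\<phi> q') else 0)" for b
      have \<theta>0: "\<theta> y = 0" if "y \<notin> cball (\<phi> q) \<epsilon>" for y
        unfolding \<theta>_def by (rule bump_0[OF \<epsilon>(1)]) (use that in auto)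
      have w_SF: "w b \<in> SF" for b
      proof -
        have "Ck_on k (\<phi> ` U) (\<lambda>y. \<theta> y *\<^sub>R G b y)" for k
        proof (rule Ck_on_local)
          fix y assume y: "y \<in> \<phi> ` U"
          show "\<exists>S. open S \<and> y \<in> S \<and> Ck_on k S (\<lambda>y. \<theta> y *\<^sub>R G b y)"
          proof (cases "y \<in> B")
            case True
            have oB: "open B" by (simp add: B_def)
            have "Ck_on k B (\<lambda>y. \<theta> y *\<^sub>R G b y)"
              unfolding \<theta>_def
              by (rule Ck_on_scaleR[OF oB CinfD[OF Cinf_on_bump[OF oB]]
                    CinfD[OF G(1)]])
            then show ?thesis using True oB by blast
          next
            case False
            have o: "open (- cball (\<phi> q) \<epsilon>)" by (simp add: open_Compl)
            have "Ck_on k (- cball (\<phi> q) \<epsilon>) (\<lambda>y. \<theta> y *\<^sub>R G b y)"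
              by (rule Ck_on_cong[OF o _ Ck_on_const[OF o, of k 0]]) (use \<theta>0 in auto)
            then show ?thesis using False \<epsilon>(2) o unfolding B_def by blast
          qed
        qed
        then have C: "Cinf_on (\<phi> ` U) (\<lambda>y. \<theta> y *\<^sub>R G b y)" by (simp add: Cinf_on_def)
        have cb: "cball (\<phi> q) \<epsilon> \<subseteq> \<phi> ` U" using \<epsilon>(2) BU unfolding B_def by blast
        from smooth_extend_by_zero[OF U(1) cb C]
        show ?thesis using \<theta>0 by (simp add: w_def cong: if_cong)
      qed
      define N2 where "N2 = {q' \<in> U. \<phi> q' \<in> ball (\<phi> q) (\<epsilon> / 2)}"
      have oN2: "open N2" unfolding N2_def by (rule chart_preimage_open[OF U(1)]) simp
      have qN2: "q \<in> N2" using qU \<epsilon>(1) by (simp add: N2_def)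
      have h_eq: "h q' = h q + (\<Sum>b\<in>Basis. (x b q' - x b q) * w b q')" if q': "q' \<in> N2" for q'
      proof -
        have q'U: "q' \<in> U" and q'b: "\<phi> q' \<in> ball (\<phi> q) (\<epsilon> / 2)" using q' by (auto simp: N2_def)
        have "\<phi> q' \<in> cball (\<phi> q) \<epsilon>" using q'b \<epsilon>(1) by auto
        then have B: "\<phi> q' \<in> B" using \<epsilon>(2) unfolding B_def by blast
        then have "q' \<in> N" using q'U by (simp add: N_def B_def)
        moreover have "\<theta> (\<phi> q') = 1" unfolding \<theta>_def by (rule bump_1[OF \<epsilon>(1) q'b])
        ultimately show ?thesis
          using G(3)[OF B] q'U qU \<kappa>1 q loc_q by (simp add: x_def w_def inner_diff_left)
      qed
      have "v h = v (\<lambda>q'. h q + (\<Sum>b\<in>Basis. (x b q' - x b q) * w b q'))"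
        by (rule tangent_local[OF v True _ oN2 qN2 h_eq])
          (intro SF_add SF_const SF_sum SF_mult SF_diff x_SF w_SF)
      also have "\<dots> = (\<Sum>b\<in>Basis. v (\<lambda>q'. (x b q' - x b q) * w b q'))"
        by (subst tangentD(1)[OF v SF_const], intro SF_sum SF_mult SF_diff SF_const x_SF w_SF,
            subst tangent_sum[OF v]) (auto simp: tangent_const[OF v] x_SF w_SF)
      also have "\<dots> = (\<Sum>b\<in>Basis. v (x b) * w b q)"
        by (rule sum.cong[OF refl], subst tangentD(2)[OF v SF_diff[OF x_SF SF_const] w_SF],
            subst tangent_diff[OF v x_SF SF_const]) (simp add: tangent_const[OF v])
      also have "\<dots> = (\<Sum>b\<in>Basis. v (x b) * E b q h)"
      proof -
        have "\<theta> (\<phi> q) = 1" unfolding \<theta>_def by (rule bump_1[OF \<epsilon>(1)]) (use \<epsilon>(1) in simp)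
        then show ?thesis using qU True \<kappa>1[OF q] by (simp add: w_def E_def G(2))
      qed
      finally show ?thesis using rhs by simp
    qed
  qed
  show ?thesis
  proof (rule that[of N E x])
    have "p \<in> N" using U(2) r(1) by (simp add: N_def)
    then show "coordinate_frame p N E x"
      unfolding coordinate_frame_def using oN E_VF x_SF delta span by blast
  qed
qed

end

subsection \<open>Traces\<close>

lemma linear_on_set_sum:
  assumes "subspace S" "linear_on_set S L" "\<And>i. i \<in> I \<Longrightarrow> u i \<in> S"
  shows "L (\<Sum>i\<in>I. c i *\<^sub>R u i) = (\<Sum>i\<in>I. c i *\<^sub>R L (u i))"
  using assms(3)
proof (induction I rule: infinite_finite_induct)
  case (insert i I)
  then have "(\<Sum>i\<in>I. c i *\<^sub>R u i) \<in> S" "c i *\<^sub>R u i \<in> S" "u i \<in> S"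
    using assms(1) by (auto intro: subspace_sum subspace_scale)
  then show ?case using insert assms(2) by (simp add: linear_on_set_def)
next
  case empty
  show ?case
    using assms(2) subspace_0[OF assms(1)] unfolding linear_on_set_def
    by (metis scaleR_zero_left sum.empty)
next
  case (infinite I)
  then show ?case
    using assms(2) subspace_0[OF assms(1)] unfolding linear_on_set_def
    by (metis scaleR_zero_left sum.infinite)
qed

text \<open>Insert both expansions and swap the sums. The family e only needs coefficient
  functionals, so coordinate frames and orthonormal bases are covered alike, and the trace is
  independent of the chosen basis.\<close>

lemma trace_on_frame:
  fixes e :: "'i \<Rightarrow> 'a::real_vector"
  assumes S: "subspace S" and I: "finite I" "\<And>i. i \<in> I \<Longrightarrow> e i \<in> S"
    and \<phi>: "\<And>i. i \<in> I \<Longrightarrow> linear_on_set S (\<phi> i)"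
    and expand: "\<And>v. v \<in> S \<Longrightarrow> v = (\<Sum>i\<in>I. \<phi> i v *\<^sub>R e i)"
    and L: "linear_on_set S L" "L ` S \<subseteq> S"
  shows "trace_on S L = (\<Sum>i\<in>I. \<phi> i (L (e i)))"
proof -
  define B where "B = (SOME B. independent B \<and> span B = S)"
  obtain B0 where "B0 \<subseteq> S" "independent B0" "S \<subseteq> span B0" by (rule basis_exists)
  then have "independent B0 \<and> span B0 = S" using span_minimal[OF _ S] by blast
  then have "independent B \<and> span B = S" unfolding B_def by (rule someI)
  then have B: "independent B" "span B = S" by auto
  have BS: "b \<in> S" if "b \<in> B" for b using that B(2) span_base by blast
  have "S \<subseteq> span (e ` I)"
  proof
    fix v assume "v \<in> S"
    have "(\<Sum>i\<in>I. \<phi> i v *\<^sub>R e i) \<in> span (e ` I)"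
      by (intro span_sum span_scale span_base) auto
    then show "v \<in> span (e ` I)" using expand[OF \<open>v \<in> S\<close>] by simp
  qed
  then have "finite B"
    using independent_span_bound[of "e ` I" B] I(1) B span_superset by blast
  have Le: "L (e i) \<in> S" if "i \<in> I" for i using that L(2) I(2) by auto
  have "trace_on S L = (\<Sum>b\<in>B. representation B (L b) b)"
    by (simp add: trace_on_def B_def Let_def)
  also have "\<dots> = (\<Sum>b\<in>B. \<Sum>i\<in>I. \<phi> i b * representation B (L (e i)) b)"
  proof (rule sum.cong[OF refl])
    fix b assume b: "b \<in> B"
    have "L b = L (\<Sum>i\<in>I. \<phi> i b *\<^sub>R e i)" using expand[OF BS[OF b]] by simp
    also have "\<dots> = (\<Sum>i\<in>I. \<phi> i b *\<^sub>R L (e i))" by (rule linear_on_set_sum[OF S L(1) I(2)])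
    finally have "representation B (L b) b = representation B (\<Sum>i\<in>I. \<phi> i b *\<^sub>R L (e i)) b"
      by simp
    also have "\<dots> = (\<Sum>i\<in>I. \<phi> i b * representation B (L (e i)) b)"
      using Le by (simp add: representation_sum[OF B(1)] representation_scale[OF B(1)] span_scale B(2)[symmetric])
    finally show "representation B (L b) b = (\<Sum>i\<in>I. \<phi> i b * representation B (L (e i)) b)" .
  qed
  also have "\<dots> = (\<Sum>i\<in>I. \<Sum>b\<in>B. representation B (L (e i)) b *\<^sub>R \<phi> i b)"
    by (subst sum.swap) (simp add: mult.commute)
  also have "\<dots> = (\<Sum>i\<in>I. \<phi> i (L (e i)))"
  proof (rule sum.cong[OF refl])
    fix i assume i: "i \<in> I"
    have "(\<Sum>b\<in>B. representation B (L (e i)) b *\<^sub>R \<phi> i b)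
        = \<phi> i (\<Sum>b\<in>B. representation B (L (e i)) b *\<^sub>R b)"
      by (rule linear_on_set_sum[OF S \<phi>[OF i] BS, symmetric])
    also have "\<dots> = \<phi> i (L (e i))"
      using sum_representation_eq[OF B(1), of "L (e i)" B] Le[OF i] B(2) \<open>finite B\<close> by simp
    finally show "(\<Sum>b\<in>B. representation B (L (e i)) b *\<^sub>R \<phi> i b) = \<phi> i (L (e i))" .
  qed
  finally show ?thesis .
qed

section \<open>Orthonormal bases of a subspace\<close>

locale inner_product_on =
  fixes S :: "'a::real_vector set" and ip :: "'a \<Rightarrow> 'a \<Rightarrow> real"
  assumes S: "subspace S"
    and lin: "\<And>u. u \<in> S \<Longrightarrow> linear_on_set S (ip u)"
    and comm: "\<And>u v. u \<in> S \<Longrightarrow> v \<in> S \<Longrightarrow> ip u v = ip v u"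
    and pos: "\<And>u. u \<in> S \<Longrightarrow> u \<noteq> 0 \<Longrightarrow> ip u u > 0"
begin

lemma lin_left: "u \<in> S \<Longrightarrow> linear_on_set S (\<lambda>v. ip v u)"
  using lin[of u] comm S unfolding linear_on_set_def
  by (simp add: subspace_add subspace_scale)

lemma ip_sum_left:
  "\<lbrakk>\<And>i. i \<in> I \<Longrightarrow> e i \<in> S; u \<in> S\<rbrakk> \<Longrightarrow> ip (\<Sum>i\<in>I. c i *\<^sub>R e i) u = (\<Sum>i\<in>I. c i * ip (e i) u)"
  using linear_on_set_sum[OF S lin_left, of u I e c] by simp

definition orthonormal :: "'a set \<Rightarrow> bool"
  where "orthonormal B \<longleftrightarrow> (\<forall>u\<in>B. \<forall>v\<in>B. ip u v = (if u = v then 1 else 0))"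

lemma orthonormal_coeff:
  assumes "finite B" "B \<subseteq> S" "orthonormal B" "e \<in> B"
  shows "ip (\<Sum>b\<in>B. c b *\<^sub>R b) e = c e"
proof -
  have "ip (\<Sum>b\<in>B. c b *\<^sub>R b) e = (\<Sum>b\<in>B. c b * ip b e)"
    by (rule ip_sum_left) (use assms in auto)
  also have "\<dots> = (\<Sum>b\<in>B. if b = e then c e else 0)"
    by (rule sum.cong) (use assms(3,4) in \<open>auto simp: orthonormal_def\<close>)
  finally show ?thesis using assms(1,4) by simp
qed

lemma orthonormal_independent:
  assumes "finite B" "B \<subseteq> S" "orthonormal B"
  shows "independent B"
  unfolding independent_explicit_finite_subsets
proof (intro allI impI ballI)
  fix C c b assume C: "C \<subseteq> B" "finite C" "(\<Sum>v\<in>C. c v *\<^sub>R v) = 0" "b \<in> C"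
  have "orthonormal C" using assms(3) C(1) unfolding orthonormal_def by (meson subsetD)
  moreover have "C \<subseteq> S" using C(1) assms(2) by auto
  ultimately have "ip 0 b = c b" using orthonormal_coeff[of C b c] C by simp
  moreover have "ip 0 b = 0"
    using lin_left[of b] \<open>C \<subseteq> S\<close> C(4) subspace_0[OF S] unfolding linear_on_set_def
    by (metis scaleR_zero_left subsetD)
  ultimately show "c b = 0" by simp
qed

lemma orthonormal_expand:
  assumes "finite B" "B \<subseteq> S" "orthonormal B" "v \<in> span B"
  shows "v = (\<Sum>e\<in>B. ip v e *\<^sub>R e)"
proof -
  obtain c where c: "v = (\<Sum>e\<in>B. c e *\<^sub>R e)" using assms(4) span_finite[OF assms(1)] by auto
  then have "ip v e = c e" if "e \<in> B" for e using orthonormal_coeff[OF assms(1-3) that] by simp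
  then show ?thesis using c by simp
qed

text \<open>Gram-Schmidt, one vector at a time; a vector in the span of the earlier ones is
  dropped.\<close>

lemma orthonormal_basis_exists:
  assumes "finite F" "F \<subseteq> S"
  shows "\<exists>B. finite B \<and> B \<subseteq> S \<and> orthonormal B \<and> span B = span F"
  using assms
proof (induction F rule: finite_induct)
  case empty
  show ?case by (rule exI[of _ "{}"]) (auto simp: orthonormal_def)
next
  case (insert v F)
  then obtain B where B: "finite B" "B \<subseteq> S" "orthonormal B" "span B = span F" by auto
  define y where "y = (\<Sum>e\<in>B. ip v e *\<^sub>R e)"
  define w where "w = v - y"
  have y: "y \<in> span B" unfolding y_def by (intro span_sum span_scale span_base)
  then have "y \<in> S" using span_minimal[OF B(2) S] by auto
  note y = y this
  have vS: "v \<in> S" using insert by auto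
  have w: "w \<in> S" using y vS S by (simp add: w_def subspace_diff)
  have span_vF: "span (insert v F) = span (insert v B)"
    using B(4) by (metis span_insert)
  show ?case
  proof (cases "w = 0")
    case True
    then have "v \<in> span B" using y by (simp add: w_def)
    then show ?thesis using B span_vF by (metis span_redundant)
  next
    case False
    define n where "n = sqrt (ip w w)"
    have n: "n > 0" "n * n = ip w w" using pos[OF w False] by (auto simp: n_def)
    define e where "e = (1 / n) *\<^sub>R w"
    have eS: "e \<in> S" using w S by (simp add: e_def subspace_scale)
    have orth: "ip w b = 0" if "b \<in> B" for b
    proof -
      have bS: "b \<in> S" using that B(2) by auto
      have "ip v b = ip (w + y) b" by (simp add: w_def)
      also have "\<dots> = ip w b + ip y b"
        using lin_left[OF bS] w y(2) unfolding linear_on_set_def by blast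
      also have "ip y b = ip v b" unfolding y_def by (rule orthonormal_coeff[OF B(1-3) that])
      finally show ?thesis by simp
    qed
    have eb: "ip e b = 0" "ip b e = 0" if "b \<in> B" for b
    proof -
      have bS: "b \<in> S" using that B(2) by auto
      show "ip e b = 0"
        using lin_left[OF bS] w orth[OF that] unfolding linear_on_set_def e_def by simp
      then show "ip b e = 0" using comm[OF bS eS] by simp
    qed
    have ee: "ip e e = 1"
    proof -
      have "ip e e = (1 / n) * ip w e"
        using lin_left[OF eS] w unfolding linear_on_set_def e_def by simp
      also have "ip w e = (1 / n) * ip w w"
        using lin[OF w] w unfolding linear_on_set_def e_def by simp
      finally show ?thesis using n pos[OF w False] by (simp add: field_simps)
    qed
    have "orthonormal (insert e B)"
      using B(3) eb ee unfolding orthonormal_def by auto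
    moreover have "span (insert e B) = span (insert v B)"
    proof -
      have y': "y \<in> span (insert e B)" "y \<in> span (insert v B)"
        using y(1) span_mono[of B "insert e B"] span_mono[of B "insert v B"] by auto
      have "e \<in> span (insert v B)" unfolding e_def w_def
        by (intro span_scale span_diff y' span_base) simp
      moreover have "v \<in> span (insert e B)"
      proof -
        have "v = n *\<^sub>R e + y" using n(1) by (simp add: e_def w_def)
        then show ?thesis by (simp add: span_add span_scale span_base y')
      qed
      moreover have "B \<subseteq> span (insert v B)" "B \<subseteq> span (insert e B)"
        by (auto intro: span_base)
      ultimately show ?thesis by (simp add: span_eq)
    qed
    ultimately show ?thesis using B eS span_vF by (intro exI[of _ "insert e B"]) auto
  qed
qed

end

context smooth_manifold
begin

lemma SF_local:
  assumes "\<And>p. \<exists>h N. h \<in> SF \<and> open N \<and> p \<in> N \<and> (\<forall>q\<in>N. h q = u q)"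
  shows "u \<in> SF"
proof (rule smooth_functionsI, rule Ck_on_local)
  fix U \<phi> k y assume U: "(U, \<phi>) \<in> A" and y: "y \<in> \<phi> ` U"
  then obtain p where p: "p \<in> U" "y = \<phi> p" by auto
  obtain h N where h: "h \<in> SF" "open N" "p \<in> N" "\<And>q. q \<in> N \<Longrightarrow> h q = u q"
    using assms[of p] by auto
  have o: "open (\<phi> ` (U \<inter> N))" by (rule chart_image_open[OF U h(2)])
  have "Ck_on k (\<phi> ` (U \<inter> N)) (\<lambda>x. h (inv_into U \<phi> x))"
    by (rule Ck_on_subset[OF CinfD[OF smooth_functionsD[OF h(1) U]]]) auto
  then have "Ck_on k (\<phi> ` (U \<inter> N)) (\<lambda>x. u (inv_into U \<phi> x))"
    by (rule Ck_on_cong[OF o, rotated]) (use h(4) chart_inv(1)[OF U] in auto)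
  then show "\<exists>S. open S \<and> y \<in> S \<and> Ck_on k S (\<lambda>x. u (inv_into U \<phi> x))"
    using o p h(3) by blast
qed

subsection \<open>Tensorial operators\<close>

definition tensorial :: "('m vfield \<Rightarrow> 'm \<Rightarrow> real) \<Rightarrow> bool"
  where "tensorial \<omega> \<longleftrightarrow>
    (\<forall>X\<in>VF. \<forall>Y\<in>VF. \<forall>p. \<omega> (X + Y) p = \<omega> X p + \<omega> Y p) \<and>
    (\<forall>h\<in>SF. \<forall>X\<in>VF. \<forall>p. \<omega> (fscale h X) p = h p * \<omega> X p)"

definition tensorial_op :: "('m vfield \<Rightarrow> 'm vfield) \<Rightarrow> bool"
  where "tensorial_op L \<longleftrightarrow> (\<forall>X\<in>VF. L X \<in> VF) \<and>
    (\<forall>X\<in>VF. \<forall>Y\<in>VF. L (X + Y) = L X + L Y) \<and>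
    (\<forall>h\<in>SF. \<forall>X\<in>VF. L (fscale h X) = fscale h (L X))"

lemma tensorial_opD:
  assumes "tensorial_op L"
  shows "X \<in> VF \<Longrightarrow> L X \<in> VF"
    and "X \<in> VF \<Longrightarrow> Y \<in> VF \<Longrightarrow> L (X + Y) = L X + L Y"
    and "h \<in> SF \<Longrightarrow> X \<in> VF \<Longrightarrow> L (fscale h X) = fscale h (L X)"
  using assms unfolding tensorial_op_def by auto

lemma fscale_apply: "fscale h X p = h p *\<^sub>R X p"
  by (simp add: fscale_def)

lemma tensorial_op_apply: "tensorial_op L \<Longrightarrow> tensorial (\<lambda>X p. L X p k)"
  unfolding tensorial_def by (simp add: tensorial_opD fscale_apply) (simp add: scaleR_fun_def)

lemma tensorial_sum:
  assumes \<omega>: "tensorial \<omega>" and "\<And>i. i \<in> I \<Longrightarrow> h i \<in> SF" "\<And>i. i \<in> I \<Longrightarrow> Y i \<in> VF"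
  shows "\<omega> (\<Sum>i\<in>I. fscale (h i) (Y i)) p = (\<Sum>i\<in>I. h i p * \<omega> (Y i) p)"
proof -
  have z: "\<omega> 0 p = 0"
    using \<omega> VF_zero unfolding tensorial_def by (metis add_cancel_right_right add.right_neutral)
  show ?thesis using assms(2,3)
  proof (induction I rule: infinite_finite_induct)
    case (insert i I)
    have "\<omega> (fscale (h i) (Y i) + (\<Sum>i\<in>I. fscale (h i) (Y i))) p =
        \<omega> (fscale (h i) (Y i)) p + \<omega> (\<Sum>i\<in>I. fscale (h i) (Y i)) p"
      using \<omega> insert.prems unfolding tensorial_def by simp
    moreover have "\<omega> (fscale (h i) (Y i)) p = h i p * \<omega> (Y i) p"
      using \<omega> insert.prems unfolding tensorial_def by simp
    ultimately show ?case using insert by (simp add: sum.insert[OF insert.hyps] del: plus_fun_apply)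
  qed (use z in auto)
qed

text \<open>After multiplication by a bump, X is globally a combination of frame fields with smooth
  coefficients that vanish at p.\<close>

lemma tensorial_zero:
  assumes \<omega>: "tensorial \<omega>" and X: "X \<in> VF" "X p = 0"
  shows "\<omega> X p = 0"
proof -
  obtain N and E :: "'e \<Rightarrow> 'm vfield" and x where "coordinate_frame p N E x" by (rule local_frame)
  note fr = coordinate_frameD[OF this]
  obtain \<rho> where \<rho>: "\<rho> \<in> SF" "\<rho> p = 1" "\<And>q. q \<notin> N \<Longrightarrow> \<rho> q = 0"
    using exists_bump[OF fr(1,2)] by metis
  have eq: "fscale \<rho> X = (\<Sum>b\<in>Basis. fscale (\<lambda>q. \<rho> q * X q (x b)) (E b))"
  proof
    fix q
    show "fscale \<rho> X q = (\<Sum>b\<in>Basis. fscale (\<lambda>q. \<rho> q * X q (x b)) (E b)) q"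
    proof (cases "q \<in> N")
      case True
      have "X q = (\<Sum>b\<in>Basis. X q (x b) *\<^sub>R E b q)" by (rule fr(6)[OF True VF_tangent[OF X(1)]])
      then have "\<rho> q *\<^sub>R X q = \<rho> q *\<^sub>R (\<Sum>b\<in>Basis. X q (x b) *\<^sub>R E b q)" by simp
      then show ?thesis by (simp add: sum_apply fscale_apply scaleR_sum_right)
    next
      case False
      then show ?thesis by (simp add: sum_apply fscale_apply \<rho>(3))
    qed
  qed
  have "\<omega> X p = \<omega> (fscale \<rho> X) p" using \<omega> \<rho> X unfolding tensorial_def by simp
  also have "\<dots> = (\<Sum>b\<in>Basis. \<rho> p * X p (x b) * \<omega> (E b) p)"
    unfolding eq by (rule tensorial_sum[OF \<omega>]) (use \<rho> fr X VF_smooth in auto)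
  also have "\<dots> = 0" using X by simp
  finally show ?thesis .
qed

text \<open>X minus the combination of the \<open>Y i\<close> with constant coefficients is a field
  that vanishes at p.\<close>

lemma tensorial_expand:
  assumes \<omega>: "tensorial \<omega>" and X: "X \<in> VF" and Y: "\<And>i. i \<in> I \<Longrightarrow> Y i \<in> VF"
    and eq: "X p = (\<Sum>i\<in>I. c i *\<^sub>R Y i p)"
  shows "\<omega> X p = (\<Sum>i\<in>I. c i * \<omega> (Y i) p)"
proof -
  define Z where "Z = (\<Sum>i\<in>I. fscale (\<lambda>_. c i) (Y i))"
  have Z: "Z \<in> VF" unfolding Z_def by (intro VF_sum VF_fscale SF_const Y)
  have "(X + fscale (\<lambda>_. -1) Z) p = 0" by (simp add: Z_def eq sum_apply fscale_apply)
  then have "\<omega> (X + fscale (\<lambda>_. -1) Z) p = 0"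
    by (intro tensorial_zero[OF \<omega>] VF_add VF_fscale X Z SF_const)
  moreover have "\<omega> (X + fscale (\<lambda>_. -1) Z) p = \<omega> X p + (-1) * \<omega> Z p"
    using \<omega> X Z VF_fscale[OF SF_const Z, of "-1"] unfolding tensorial_def by (simp del: VF_fscale)
  moreover have "\<omega> Z p = (\<Sum>i\<in>I. c i * \<omega> (Y i) p)"
    unfolding Z_def by (rule tensorial_sum[OF \<omega> SF_const Y])
  ultimately show ?thesis by simp
qed

lemma tensorial_op_expand:
  assumes L: "tensorial_op L" and X: "X \<in> VF" and Y: "\<And>i. i \<in> I \<Longrightarrow> Y i \<in> VF"
    and eq: "X p = (\<Sum>i\<in>I. c i *\<^sub>R Y i p)"
  shows "L X p = (\<Sum>i\<in>I. c i *\<^sub>R L (Y i) p)"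
proof
  fix k
  show "L X p k = (\<Sum>i\<in>I. c i *\<^sub>R L (Y i) p) k"
    using tensorial_expand[OF tensorial_op_apply[OF L] X Y eq, of k]
    by (simp add: sum_apply scaleR_fun_def)
qed

lemma tensorial_op_cong:
  assumes "tensorial_op L" "X \<in> VF" "Y \<in> VF" "X p = Y p"
  shows "L X p = L Y p"
proof -
  have "L X p = (\<Sum>i\<in>{()}. 1 *\<^sub>R L Y p)"
    by (rule tensorial_op_expand[OF assms(1-3)]) (simp add: assms(4))
  then show ?thesis by simp
qed

lemma extend:
  assumes "v \<in> T p"
  shows "extend A p v \<in> VF" "extend A p v p = v"
proof -
  obtain N and E :: "'e \<Rightarrow> 'm vfield" and x where "coordinate_frame p N E x" by (rule local_frame)
  note fr = coordinate_frameD[OF this]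
  have "(\<Sum>b\<in>Basis. fscale (\<lambda>_. v (x b)) (E b)) \<in> VF \<and>
      (\<Sum>b\<in>Basis. fscale (\<lambda>_. v (x b)) (E b)) p = v"
    using fr(6)[OF fr(2) assms] fr(3) by (simp add: sum_apply fscale_apply)
  then have "extend A p v \<in> VF \<and> extend A p v p = v"
    unfolding extend_def by (rule someI[where P = "\<lambda>X. X \<in> VF \<and> X p = v"])
  then show "extend A p v \<in> VF" "extend A p v p = v" by auto
qed

lemma tensorial_op_linear:
  assumes L: "tensorial_op L"
  shows "linear_on_set (T p) (\<lambda>v. L (extend A p v) p)" "(\<lambda>v. L (extend A p v) p) ` T p \<subseteq> T p"
proof -
  show "(\<lambda>v. L (extend A p v) p) ` T p \<subseteq> T p"
    using extend(1) tensorial_opD(1)[OF L] by auto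
  show "linear_on_set (T p) (\<lambda>v. L (extend A p v) p)"
    unfolding linear_on_set_def
  proof (intro conjI ballI allI)
    fix u c assume u: "u \<in> T p"
    have cu: "c *\<^sub>R u \<in> T p" by (rule subspace_scale[OF tangent_subspace u])
    show "L (extend A p (c *\<^sub>R u)) p = c *\<^sub>R L (extend A p u) p"
      using tensorial_op_expand[OF L extend(1)[OF cu], of "{()}" "\<lambda>_. extend A p u" p "\<lambda>_. c"]
        extend[OF u] extend[OF cu] by simp
    fix v assume v: "v \<in> T p"
    have uv: "u + v \<in> T p" by (rule subspace_add[OF tangent_subspace u v])
    show "L (extend A p (u + v)) p = L (extend A p u) p + L (extend A p v) p"
      using tensorial_op_expand[OF L extend(1)[OF uv], of UNIV
          "\<lambda>i. if i then extend A p u else extend A p v" p "\<lambda>_. 1"]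
        extend[OF u] extend[OF v] extend[OF uv] by (simp add: UNIV_bool add.commute)
  qed
qed

lemma trace_at_frame:
  assumes L: "tensorial_op L"
    and fr: "\<And>b. b \<in> Basis \<Longrightarrow> E b \<in> VF"
    "\<And>v. v \<in> T q \<Longrightarrow> v = (\<Sum>b\<in>Basis. v (x b) *\<^sub>R E b q)"
  shows "trace_at A L q = (\<Sum>b\<in>(Basis::'e set). L (E b) q (x b))"
proof -
  have "trace_at A L q = (\<Sum>b\<in>(Basis::'e set). L (extend A q (E b q)) q (x b))"
    unfolding trace_at_def
    by (rule trace_on_frame[OF tangent_subspace finite_Basis _ _ fr(2) tensorial_op_linear[OF L]])
      (auto simp: fr linear_on_set_def scaleR_fun_def)
  also have "\<dots> = (\<Sum>b\<in>(Basis::'e set). L (E b) q (x b))"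
  proof (rule sum.cong[OF refl])
    fix b :: 'e assume b: "b \<in> Basis"
    have "L (extend A q (E b q)) q = L (E b) q"
      by (rule tensorial_op_cong[OF L extend(1) fr(1)[OF b] extend(2)]) (simp_all add: fr(1)[OF b])
    then show "L (extend A q (E b q)) q (x b) = L (E b) q (x b)" by simp
  qed
  finally show ?thesis .
qed

lemma trace_at_smooth:
  assumes L: "tensorial_op L"
  shows "trace_at A L \<in> SF"
proof (rule SF_local)
  fix p
  obtain N and E :: "'e \<Rightarrow> 'm vfield" and x where "coordinate_frame p N E x" by (rule local_frame)
  note fr = coordinate_frameD[OF this]
  have "(\<lambda>q. \<Sum>b\<in>Basis. L (E b) q (x b)) \<in> SF"
    by (rule SF_sum) (rule VF_smooth[OF tensorial_opD(1)[OF L fr(3)] fr(4)])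
  moreover have "\<forall>q\<in>N. (\<Sum>b\<in>Basis. L (E b) q (x b)) = trace_at A L q"
    using trace_at_frame[OF L fr(3) fr(6)] by simp
  ultimately show "\<exists>h N. h \<in> SF \<and> open N \<and> p \<in> N \<and> (\<forall>q\<in>N. h q = trace_at A L q)"
    using fr(1,2) by blast
qed

text \<open>Common to the covariant derivative \<open>D X\<close> and the Lie derivative
  \<open>br X\<close>, so that both may be exchanged with traces by the same result.\<close>

definition derivation_over :: "'m vfield \<Rightarrow> ('m vfield \<Rightarrow> 'm vfield) \<Rightarrow> bool"
  where "derivation_over X \<D> \<longleftrightarrow> (\<forall>Z\<in>VF. \<D> Z \<in> VF) \<and>
    (\<forall>Y\<in>VF. \<forall>Z\<in>VF. \<D> (Y + Z) = \<D> Y + \<D> Z) \<and>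
    (\<forall>h\<in>SF. \<forall>Z\<in>VF. \<D> (fscale h Z) = fscale (\<lambda>p. X p h) Z + fscale h (\<D> Z))"

lemma derivation_overD:
  assumes "derivation_over X \<D>"
  shows "Z \<in> VF \<Longrightarrow> \<D> Z \<in> VF"
    and "Y \<in> VF \<Longrightarrow> Z \<in> VF \<Longrightarrow> \<D> (Y + Z) = \<D> Y + \<D> Z"
    and "h \<in> SF \<Longrightarrow> Z \<in> VF \<Longrightarrow> \<D> (fscale h Z) = fscale (\<lambda>p. X p h) Z + fscale h (\<D> Z)"
  using assms unfolding derivation_over_def by auto

lemma derivation_over_zero: "derivation_over X \<D> \<Longrightarrow> \<D> 0 = 0"
  using derivation_overD(2)[OF _ VF_zero VF_zero, of X \<D>]
  by (simp only: add_0 add_cancel_right_right)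

lemma derivation_over_sum:
  assumes \<D>: "derivation_over X \<D>" and "\<And>i. i \<in> I \<Longrightarrow> Z i \<in> VF"
  shows "\<D> (\<Sum>i\<in>I. Z i) = (\<Sum>i\<in>I. \<D> (Z i))"
  using assms(2) by (induction I rule: infinite_finite_induct)
    (auto simp: derivation_over_zero[OF \<D>] derivation_overD(2)[OF \<D>])

lemma derivation_over_local:
  assumes \<D>: "derivation_over X \<D>" and ZZ: "Z \<in> VF" "Z' \<in> VF"
    and N: "open N" "p \<in> N" "\<And>q. q \<in> N \<Longrightarrow> Z q = Z' q"
  shows "\<D> Z p = \<D> Z' p"
proof -
  obtain \<rho> where \<rho>: "\<rho> \<in> SF" "\<rho> p = 1" "\<And>q. q \<notin> N \<Longrightarrow> \<rho> q = 0"
    using exists_bump[OF N(1,2)] by metis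
  define W where "W = Z - Z'"
  have W: "W \<in> VF" "W p = 0" using ZZ N by (auto simp: W_def)
  have "fscale \<rho> W = 0"
  proof
    show "fscale \<rho> W q = 0 q" for q
      by (cases "q \<in> N") (simp_all add: fscale_apply W_def \<rho>(3) N(3))
  qed
  then have "0 = (fscale (\<lambda>p. X p \<rho>) W + fscale \<rho> (\<D> W)) p"
    using derivation_overD(3)[OF \<D> \<rho>(1) W(1)] derivation_over_zero[OF \<D>] by simp
  then have "0 = \<D> W p" by (simp add: fscale_apply \<rho>(2) W(2))
  moreover have "\<D> Z p = \<D> W p + \<D> Z' p"
    using derivation_overD(2)[OF \<D> W(1) ZZ(2)] by (simp add: W_def)
  ultimately show ?thesis by simp
qed

lemma derivation_over_commutator:
  assumes \<D>: "derivation_over X \<D>" and L: "tensorial_op L" and X: "X \<in> VF"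
  shows "tensorial_op (\<lambda>Z. \<D> (L Z) - L (\<D> Z))"
  unfolding tensorial_op_def
proof (intro conjI ballI)
  fix Z assume Z: "Z \<in> VF"
  note simps = tensorial_opD[OF L] derivation_overD[OF \<D>]
  show "\<D> (L Z) - L (\<D> Z) \<in> VF" by (intro VF_diff simps Z)
  fix h assume h: "h \<in> SF"
  have "\<D> (L (fscale h Z)) = fscale (\<lambda>p. X p h) (L Z) + fscale h (\<D> (L Z))"
    using Z h by (simp add: simps(3,6) tensorial_opD(1)[OF L])
  moreover have "L (\<D> (fscale h Z)) = fscale (\<lambda>p. X p h) (L Z) + fscale h (L (\<D> Z))"
    using Z h VF_smooth[OF X h]
    by (simp add: simps(2,3,6) derivation_overD(1)[OF \<D>] del: plus_fun_apply)
  ultimately show "\<D> (L (fscale h Z)) - L (\<D> (fscale h Z)) = fscale h (\<D> (L Z) - L (\<D> Z))"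
    by (simp add: fun_eq_iff fscale_apply scaleR_diff_right)
next
  fix Y Z assume "Y \<in> VF" "Z \<in> VF"
  then show "\<D> (L (Y + Z)) - L (\<D> (Y + Z)) = \<D> (L Y) - L (\<D> Y) + (\<D> (L Z) - L (\<D> Z))"
    by (simp add: tensorial_opD[OF L] derivation_overD[OF \<D>])
qed

text \<open>In a frame, the coefficients d of the derivation contribute the trace of a commutator of
  two matrices, which is 0; what remains is the derivative of the diagonal entries of L.\<close>

lemma trace_at_derivative:
  assumes \<D>: "derivation_over X \<D>" and L: "tensorial_op L" and X: "X \<in> VF"
  shows "X p (trace_at A L) = trace_at A (\<lambda>Z. \<D> (L Z) - L (\<D> Z)) p"
proof -
  obtain N and E :: "'e \<Rightarrow> 'm vfield" and x where "coordinate_frame p N E x" by (rule local_frame)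
  note fr = coordinate_frameD[OF this]
  define lc where "lc c b = (\<lambda>q. L (E b) q (x c))" for c b
  define d where "d c b = \<D> (E b) p (x c)" for c b
  have LE: "L (E b) \<in> VF" if "b \<in> Basis" for b by (rule tensorial_opD(1)[OF L fr(3)[OF that]])
  have DE: "\<D> (E b) \<in> VF" if "b \<in> Basis" for b by (rule derivation_overD(1)[OF \<D> fr(3)[OF that]])
  have lc: "lc c b \<in> SF" if "b \<in> Basis" "c \<in> Basis" for b c
    unfolding lc_def by (rule VF_smooth[OF LE fr(4)]) (use that in auto)
  have "X p (trace_at A L) = X p (\<lambda>q. \<Sum>b\<in>Basis. lc b b q)"
    by (rule tangent_local[OF VF_tangent[OF X] trace_at_smooth[OF L] SF_sum fr(1,2)])
      (use lc trace_at_frame[OF L fr(3) fr(6)] in \<open>auto simp: lc_def\<close>)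
  also have "\<dots> = (\<Sum>b\<in>Basis. X p (lc b b))"
    by (rule tangent_sum[OF VF_tangent[OF X] lc])
  finally have lhs: "X p (trace_at A L) = (\<Sum>b\<in>Basis. X p (lc b b))" .
  have 1: "\<D> (L (E b)) p (x b) = X p (lc b b) + (\<Sum>c\<in>Basis. lc c b p * d b c)" if b: "b \<in> Basis" for b
  proof -
    have "\<D> (L (E b)) p = \<D> (\<Sum>c\<in>Basis. fscale (lc c b) (E c)) p"
    proof (rule derivation_over_local[OF \<D> LE[OF b] _ fr(1,2)])
      show "(\<Sum>c\<in>Basis. fscale (lc c b) (E c)) \<in> VF" by (intro VF_sum VF_fscale lc b fr(3))
      fix q assume "q \<in> N"
      have "(\<Sum>c\<in>Basis. fscale (lc c b) (E c)) q = (\<Sum>c\<in>Basis. L (E b) q (x c) *\<^sub>R E c q)"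
        by (simp add: sum_apply fscale_apply lc_def)
      also have "\<dots> = L (E b) q"
        by (rule fr(6)[OF \<open>q \<in> N\<close> VF_tangent[OF LE[OF b]], symmetric])
      finally show "L (E b) q = (\<Sum>c\<in>Basis. fscale (lc c b) (E c)) q" by simp
    qed
    also have "\<D> (\<Sum>c\<in>Basis. fscale (lc c b) (E c)) = (\<Sum>c\<in>Basis. \<D> (fscale (lc c b) (E c)))"
      by (rule derivation_over_sum[OF \<D>]) (intro VF_fscale lc b fr(3))
    also have "\<dots> p = (\<Sum>c\<in>Basis. X p (lc c b) *\<^sub>R E c p + lc c b p *\<^sub>R \<D> (E c) p)"
      using lc b fr(3) by (simp add: sum_apply derivation_overD(3)[OF \<D>] fscale_apply)
    finally have "\<D> (L (E b)) p (x b) = (\<Sum>c\<in>Basis. X p (lc c b) * E c p (x b) + lc c b p * d b c)"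
      by (simp add: sum_apply scaleR_fun_def d_def)
    also have "\<dots> = (\<Sum>c\<in>Basis. if c = b then X p (lc c b) else 0) + (\<Sum>c\<in>Basis. lc c b p * d b c)"
      unfolding sum.distrib
      by (rule arg_cong2[where f = "(+)"], rule sum.cong) (use fr(5)[OF fr(2) _ b] in auto)
    finally show ?thesis using b by simp
  qed
  have 2: "L (\<D> (E b)) p (x b) = (\<Sum>c\<in>Basis. d c b * lc b c p)" if b: "b \<in> Basis" for b
    unfolding lc_def
    by (rule tensorial_expand[OF tensorial_op_apply[OF L] DE[OF b] fr(3)])
      (use fr(6)[OF fr(2) VF_tangent[OF DE[OF b]]] in \<open>simp_all only: d_def\<close>)
  have "trace_at A (\<lambda>Z. \<D> (L Z) - L (\<D> Z)) p
      = (\<Sum>b\<in>(Basis::'e set). (\<D> (L (E b)) - L (\<D> (E b))) p (x b))"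
    by (rule trace_at_frame[OF derivation_over_commutator[OF \<D> L X] fr(3) fr(6)[OF fr(2)]])
  also have "\<dots> = (\<Sum>b\<in>Basis. X p (lc b b)) + (\<Sum>b\<in>Basis. \<Sum>c\<in>Basis. lc c b p * d b c)
      - (\<Sum>b\<in>Basis. \<Sum>c\<in>Basis. d c b * lc b c p)"
    using 1 2 by (simp add: sum.distrib sum_subtractf)
  also have "(\<Sum>b\<in>Basis. \<Sum>c\<in>Basis. d c b * lc b c p) = (\<Sum>b\<in>Basis. \<Sum>c\<in>Basis. lc c b p * d b c)"
    by (subst sum.swap) (simp add: mult.commute)
  finally show ?thesis by (simp only: lhs add_diff_cancel)
qed

section \<open>Algebra of the Lie bracket\<close>

lemma bracket_fscale:
  assumes "X \<in> VF" "Y \<in> VF" "h \<in> SF"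
  shows "br X (fscale h Y) = fscale (\<lambda>p. X p h) Y + fscale h (br X Y)"
proof (rule VF_eqI)
  fix p k assume k: "k \<in> SF"
  show "br X (fscale h Y) p k = (fscale (\<lambda>p. X p h) Y + fscale h (br X Y)) p k"
    using tangentD(2)[OF VF_tangent[OF assms(1)] assms(3) VF_smooth[OF assms(2) k]]
    by (simp add: lie_bracket_def scaleR_fun_def fscale_def algebra_simps)
qed (use assms VF_smooth in auto)

lemma bracket_skew: "br Y X = - br X Y"
  by (simp add: lie_bracket_def fun_eq_iff)

lemma bracket_add:
  assumes "X \<in> VF" "Y \<in> VF" "Z \<in> VF"
  shows "br X (Y + Z) = br X Y + br X Z"
proof (rule VF_eqI)
  fix p k assume k: "k \<in> SF"
  have "X p (\<lambda>q. Y q k + Z q k) = X p (\<lambda>q. Y q k) + X p (\<lambda>q. Z q k)"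
    by (rule tangentD(1)[OF VF_tangent[OF assms(1)]]) (use assms k VF_smooth in auto)
  then show "br X (Y + Z) p k = (br X Y + br X Z) p k"
    by (simp add: lie_bracket_def)
qed (use assms in auto)

lemma bracket_derivation: "X \<in> VF \<Longrightarrow> derivation_over X (br X)"
  unfolding derivation_over_def using bracket_fscale bracket_add by auto

lemma jacobi:
  assumes "X \<in> VF" "Y \<in> VF" "Z \<in> VF"
  shows "br X (br Y Z) = br (br X Y) Z + br Y (br X Z)"
proof (rule VF_eqI)
  fix p k assume k: "k \<in> SF"
  have d: "U p (\<lambda>q. V q (\<lambda>q. W q k) - V' q (\<lambda>q. W' q k)) =
      U p (\<lambda>q. V q (\<lambda>q. W q k)) - U p (\<lambda>q. V' q (\<lambda>q. W' q k))"
    if "U \<in> VF" "V \<in> VF" "W \<in> VF" "V' \<in> VF" "W' \<in> VF" for U V W V' W'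
    by (rule tangent_diff[OF VF_tangent[OF that(1)]]) (use that k VF_smooth in auto)
  show "br X (br Y Z) p k = (br (br X Y) Z + br Y (br X Z)) p k"
    using assms by (simp add: lie_bracket_def d)
qed (use assms in auto)

end

subsection \<open>Riemannian manifolds\<close>

locale riemannian = smooth_manifold A
  for A :: "('m::{t2_space,second_countable_topology}, 'e::euclidean_space) chart set" +
  fixes g :: "'m bilinfield" and D :: "'m connection"
  assumes metric: "riemannian_metric A g" and levi_civita: "levi_civita A g D"
begin

text \<open>With \<open>dv\<close>, this lifts pointwise data to global fields and functions, so
  that the tensor calculus becomes rewriting followed by ring arithmetic.\<close>

definition G :: "'m vfield \<Rightarrow> 'm vfield \<Rightarrow> 'm \<Rightarrow> real"
  where "G X Y p = g p (X p) (Y p)"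

definition dv :: "'m vfield \<Rightarrow> ('m \<Rightarrow> real) \<Rightarrow> 'm \<Rightarrow> real"
  where "dv X h p = X p h"

abbreviation "R \<equiv> curvature D"

lemma ip: "inner_product_on (T p) (g p)"
  using metric tangent_subspace unfolding riemannian_metric_def by unfold_locales auto

lemma G_SF [simp]: "X \<in> VF \<Longrightarrow> Y \<in> VF \<Longrightarrow> G X Y \<in> SF"
  using metric unfolding riemannian_metric_def G_def[abs_def] by auto

lemma G_commute: "X \<in> VF \<Longrightarrow> Y \<in> VF \<Longrightarrow> G X Y p = G Y X p"
  using metric unfolding riemannian_metric_def G_def by auto

lemma g_linear:
  assumes "u \<in> T p"
  shows "v \<in> T p \<Longrightarrow> w \<in> T p \<Longrightarrow> g p u (v + w) = g p u v + g p u w"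
    and "v \<in> T p \<Longrightarrow> g p u (c *\<^sub>R v) = c * g p u v"
    and "v \<in> T p \<Longrightarrow> w \<in> T p \<Longrightarrow> g p (v + w) u = g p v u + g p w u"
    and "v \<in> T p \<Longrightarrow> g p (c *\<^sub>R v) u = c * g p v u"
  using inner_product_on.lin[OF ip assms] inner_product_on.lin_left[OF ip assms]
  unfolding linear_on_set_def by auto

lemma G_simps [simp]:
  assumes "X \<in> VF" "Y \<in> VF"
  shows "Z \<in> VF \<Longrightarrow> G (X + Y) Z p = G X Z p + G Y Z p"
    "Z \<in> VF \<Longrightarrow> G Z (X + Y) p = G Z X p + G Z Y p"
    "G (fscale h X) Y p = h p * G X Y p"
    "G X (fscale h Y) p = h p * G X Y p"
  using assms by (simp_all add: G_def g_linear fscale_apply)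

lemma G_minus [simp]:
  assumes "X \<in> VF" "Y \<in> VF"
  shows "G (- X) Y p = - G X Y p" "G X (- Y) p = - G X Y p"
  using g_linear(4)[of "Y p" p "X p" "-1"] g_linear(2)[of "X p" p "Y p" "-1"] assms
  by (simp_all add: G_def)

lemma G_diff [simp]:
  assumes "X \<in> VF" "Y \<in> VF" "Z \<in> VF"
  shows "G (X - Y) Z p = G X Z p - G Y Z p" "G Z (X - Y) p = G Z X p - G Z Y p"
proof -
  show "G (X - Y) Z p = G X Z p - G Y Z p"
    using G_simps(1)[of X "- Y" Z p] assms by simp
  show "G Z (X - Y) p = G Z X p - G Z Y p"
    using G_simps(2)[of X "- Y" Z p] assms by simp
qed

lemma G_zero [simp]: "X \<in> VF \<Longrightarrow> G 0 X p = 0" "X \<in> VF \<Longrightarrow> G X 0 p = 0"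
  using G_diff[of 0 0 X p] by simp_all

lemma G_sum:
  assumes "\<And>i. i \<in> I \<Longrightarrow> X i \<in> VF" "Y \<in> VF"
  shows "G (\<Sum>i\<in>I. X i) Y p = (\<Sum>i\<in>I. G (X i) Y p)"
  using assms(1) by (induction I rule: infinite_finite_induct) (simp_all add: assms(2))

lemma G_pos: "X \<in> VF \<Longrightarrow> X p \<noteq> 0 \<Longrightarrow> G X X p > 0"
  using metric unfolding riemannian_metric_def G_def by auto

lemma field_eq_at:
  assumes "X \<in> VF" "Y \<in> VF" "\<And>Z. Z \<in> VF \<Longrightarrow> G X Z p = G Y Z p"
  shows "X p = Y p"
proof (rule ccontr)
  assume "X p \<noteq> Y p"
  then have "G (X - Y) (X - Y) p > 0" using assms by (intro G_pos) auto
  moreover have "G (X - Y) (X - Y) p = 0" using assms(3)[of "X - Y"] assms(1,2) by simp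
  ultimately show False by simp
qed

lemma field_eqI:
  assumes "X \<in> VF" "Y \<in> VF" "\<And>Z p. Z \<in> VF \<Longrightarrow> G X Z p = G Y Z p"
  shows "X = Y"
  by (rule ext) (rule field_eq_at[OF assms])

lemma dv_SF [simp]: "X \<in> VF \<Longrightarrow> h \<in> SF \<Longrightarrow> dv X h \<in> SF"
  using VF_smooth unfolding dv_def[abs_def] .

lemma dv_simps [simp]:
  assumes "X \<in> VF"
  shows "dv X (\<lambda>_. c) p = 0"
    "h \<in> SF \<Longrightarrow> k \<in> SF \<Longrightarrow> dv X (\<lambda>q. h q + k q) p = dv X h p + dv X k p"
    "h \<in> SF \<Longrightarrow> k \<in> SF \<Longrightarrow> dv X (\<lambda>q. h q - k q) p = dv X h p - dv X k p"
    "h \<in> SF \<Longrightarrow> dv X (\<lambda>q. - h q) p = - dv X h p"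
    "h \<in> SF \<Longrightarrow> k \<in> SF \<Longrightarrow> dv X (\<lambda>q. h q * k q) p = dv X h p * k p + h p * dv X k p"
  using VF_tangent[OF assms, of p]
  by (simp_all add: dv_def tangent_const tangentD tangent_diff tangent_minus del: VF_tangent)

lemma dv_field [simp]:
  "dv (X + Y) h p = dv X h p + dv Y h p" "dv (X - Y) h p = dv X h p - dv Y h p"
  "dv (- X) h p = - dv X h p" "dv (fscale k X) h p = k p * dv X h p"
  by (simp_all add: dv_def fscale_def scaleR_fun_def)

lemma dv_bracket: "dv (br X Y) h p = dv X (dv Y h) p - dv Y (dv X h) p"
  by (simp add: dv_def[abs_def] lie_bracket_def)

lemma affine: "affine_connection A D"
  using levi_civita unfolding levi_civita_def by blast

lemma D_VF [simp]: "X \<in> VF \<Longrightarrow> Y \<in> VF \<Longrightarrow> D X Y \<in> VF"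
  using affine unfolding affine_connection_def by blast

lemma D_add [simp]:
  assumes "X \<in> VF" "Y \<in> VF" "Z \<in> VF"
  shows "D (X + Y) Z = D X Z + D Y Z" "D X (Y + Z) = D X Y + D X Z"
  using affine assms unfolding affine_connection_def by auto

lemma D_fscale [simp]:
  assumes "X \<in> VF" "Y \<in> VF" "h \<in> SF"
  shows "D (fscale h X) Y = fscale h (D X Y)"
    "D X (fscale h Y) = fscale (dv X h) Y + fscale h (D X Y)"
  using affine assms unfolding affine_connection_def dv_def[abs_def] by auto

lemma minus_fscale: "- X = fscale (\<lambda>_. -1) X"
  by (simp add: fscale_def fun_eq_iff scaleR_fun_def)

lemma dv_const: "X \<in> VF \<Longrightarrow> dv X (\<lambda>_. c) = (\<lambda>_. 0)"
  by (rule ext) simp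

lemma fscale_zero [simp]: "fscale (\<lambda>_. 0) X = 0"
  by (simp add: fscale_def fun_eq_iff)

lemma D_minus [simp]:
  assumes "X \<in> VF" "Y \<in> VF"
  shows "D (- X) Y = - D X Y" "D X (- Y) = - D X Y"
  using D_fscale[OF assms SF_const[of "-1"]] dv_const[OF assms(1), of "-1"]
  by (simp_all add: minus_fscale[symmetric])

lemma D_diff [simp]:
  assumes "X \<in> VF" "Y \<in> VF" "Z \<in> VF"
  shows "D (X - Y) Z = D X Z - D Y Z" "D X (Y - Z) = D X Y - D X Z"
proof -
  show "D (X - Y) Z = D X Z - D Y Z"
    using D_add(1)[of X "- Y" Z] assms by (simp only: VF_minus D_minus add_uminus_conv_diff)
  show "D X (Y - Z) = D X Y - D X Z"
    using D_add(2)[of X Y "- Z"] assms by (simp only: VF_minus D_minus add_uminus_conv_diff)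
qed

lemma D_const [simp]:
  "X \<in> VF \<Longrightarrow> Y \<in> VF \<Longrightarrow> D X (fscale (\<lambda>_. c) Y) = fscale (\<lambda>_. c) (D X Y)"
  by (simp add: dv_const)

lemma D_sum:
  assumes "\<And>i. i \<in> I \<Longrightarrow> Y i \<in> VF" "X \<in> VF"
  shows "D X (\<Sum>i\<in>I. Y i) = (\<Sum>i\<in>I. D X (Y i))"
proof -
  have z: "D X 0 = 0" using D_diff(2)[OF assms(2) VF_zero VF_zero] by (simp only: diff_self)
  show ?thesis using assms(1)
    by (induction I rule: infinite_finite_induct) (simp_all add: z assms(2))
qed

lemma torsion_free: "X \<in> VF \<Longrightarrow> Y \<in> VF \<Longrightarrow> br X Y = D X Y - D Y X"
  using levi_civita unfolding levi_civita_def by metis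

lemma D_metric:
  "X \<in> VF \<Longrightarrow> Y \<in> VF \<Longrightarrow> Z \<in> VF \<Longrightarrow> dv X (G Y Z) = (\<lambda>p. G (D X Y) Z p + G Y (D X Z) p)"
  using levi_civita unfolding levi_civita_def G_def[abs_def] dv_def[abs_def] by blast

lemma D_derivation: "X \<in> VF \<Longrightarrow> derivation_over X (D X)"
  unfolding derivation_over_def using D_fscale(2)[unfolded dv_def[abs_def]] by simp

section \<open>Symmetries of the curvature tensor\<close>

lemma curvature_VF [simp]: "X \<in> VF \<Longrightarrow> Y \<in> VF \<Longrightarrow> Z \<in> VF \<Longrightarrow> R X Y Z \<in> VF"
  by (simp add: curvature_def)

lemma curvature_skew: "X \<in> VF \<Longrightarrow> Y \<in> VF \<Longrightarrow> Z \<in> VF \<Longrightarrow> R Y X Z = - R X Y Z"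
  unfolding curvature_def bracket_skew[of Y X] by simp

lemma curvature_add:
  assumes "X \<in> VF" "Y \<in> VF" "Z \<in> VF" "W \<in> VF"
  shows "R (X + W) Y Z = R X Y Z + R W Y Z" "R X (Y + W) Z = R X Y Z + R X W Z"
    "R X Y (Z + W) = R X Y Z + R X Y W"
proof -
  have 2: "R X (Y + W) Z = R X Y Z + R X W Z" if "X \<in> VF" "Y \<in> VF" "W \<in> VF" for X Y W
    using that assms(3) by (simp add: curvature_def bracket_add algebra_simps)
  show "R X (Y + W) Z = R X Y Z + R X W Z" by (rule 2[OF assms(1,2,4)])
  show "R (X + W) Y Z = R X Y Z + R W Y Z"
    using 2[OF assms(2,1,4)] assms
    by (simp add: curvature_skew[of Y X Z] curvature_skew[of Y W Z] curvature_skew[of Y "X + W" Z]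
        del: plus_fun_apply)
  show "R X Y (Z + W) = R X Y Z + R X Y W"
    using assms by (simp add: curvature_def algebra_simps)
qed

lemma curvature_fscale:
  assumes "X \<in> VF" "Y \<in> VF" "Z \<in> VF" "h \<in> SF"
  shows "R (fscale h X) Y Z = fscale h (R X Y Z)" "R X (fscale h Y) Z = fscale h (R X Y Z)"
    "R X Y (fscale h Z) = fscale h (R X Y Z)"
proof -
  have 2: "R X (fscale h Y) Z = fscale h (R X Y Z)" if "X \<in> VF" "Y \<in> VF" for X Y
  proof -
    have b: "br X (fscale h Y) = fscale (dv X h) Y + fscale h (br X Y)"
      using bracket_fscale[OF that assms(4)] by (simp add: dv_def[abs_def])
    show ?thesis
      by (rule field_eqI) (use that assms(3,4) in \<open>simp_all add: curvature_def b algebra_simps\<close>)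
  qed
  show "R X (fscale h Y) Z = fscale h (R X Y Z)" by (rule 2[OF assms(1,2)])
  show "R (fscale h X) Y Z = fscale h (R X Y Z)"
    by (rule field_eqI) (use 2[OF assms(2,1)] assms in
        \<open>simp_all add: curvature_skew[of Y X Z] curvature_skew[of Y "fscale h X" Z]\<close>)
  show "R X Y (fscale h Z) = fscale h (R X Y Z)"
    by (rule field_eqI)
      (use assms in \<open>simp_all add: curvature_def dv_bracket algebra_simps\<close>)
qed

lemma curvature_tensorial:
  "Y \<in> VF \<Longrightarrow> Z \<in> VF \<Longrightarrow> tensorial_op (\<lambda>X. R X Y Z)"
  "X \<in> VF \<Longrightarrow> Y \<in> VF \<Longrightarrow> tensorial_op (\<lambda>Z. R X Y Z)"
  unfolding tensorial_op_def by (simp_all add: curvature_add curvature_fscale)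

text \<open>The commutator of X and Y acts on the function \<open>G Z W\<close> as
  \<open>br X Y\<close>; expanding this by metric compatibility gives the claim.\<close>

lemma curvature_metric_skew:
  assumes "X \<in> VF" "Y \<in> VF" "Z \<in> VF" "W \<in> VF"
  shows "G (R X Y Z) W p = - G (R X Y W) Z p"
proof -
  have "dv X (dv Y (G Z W)) p - dv Y (dv X (G Z W)) p - dv (br X Y) (G Z W) p = 0"
    by (simp add: dv_bracket)
  then have "G (R X Y Z) W p + G Z (R X Y W) p = 0"
    using assms by (simp add: D_metric curvature_def algebra_simps)
  then show ?thesis using G_commute[of Z "R X Y W" p] assms by simp
qed

text \<open>Cyclic regrouping and vanishing torsion turn the sum into the three double brackets of
  the Jacobi identity.\<close>

lemma bianchi:
  assumes "X \<in> VF" "Y \<in> VF" "Z \<in> VF"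
  shows "R X Y Z + R Y Z X + R Z X Y = 0"
proof -
  have "R X Y Z + R Y Z X + R Z X Y =
      (D X (D Y Z - D Z Y) - D (br Y Z) X) + (D Y (D Z X - D X Z) - D (br Z X) Y)
      + (D Z (D X Y - D Y X) - D (br X Y) Z)"
    using assms by (simp add: curvature_def algebra_simps)
  also have "\<dots> = br X (br Y Z) + br Y (br Z X) + br Z (br X Y)"
    using assms by (simp only: torsion_free[symmetric] VF_bracket)
  also have "\<dots> = 0"
  proof -
    have "br Y (br Z X) = - br Y (br X Z)"
      using assms unfolding bracket_skew[of Z X] by (simp add: torsion_free[of Y])
    then show ?thesis
      using jacobi[OF assms] bracket_skew[of Z "br X Y"] by simp
  qed
  finally show ?thesis .
qed

lemma G_bianchi:
  assumes "X \<in> VF" "Y \<in> VF" "Z \<in> VF" "W \<in> VF"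
  shows "G (R X Y Z) W p + G (R Y Z X) W p + G (R Z X Y) W p = 0"
proof -
  have "G (R X Y Z + R Y Z X + R Z X Y) W p = 0" using bianchi[OF assms(1-3)] assms(4) by simp
  then show ?thesis using assms by simp
qed

text \<open>A linear combination of the four Bianchi identities in which each argument in turn takes
  the last place, together with the two skew symmetries.\<close>

lemma curvature_pair_symmetry:
  assumes "X \<in> VF" "Y \<in> VF" "Z \<in> VF" "W \<in> VF"
  shows "G (R X Y Z) W p = G (R Z W X) Y p"
proof -
  note s = curvature_metric_skew[where p = p]
  have k: "G (R U1 U2 U3) U4 p = - G (R U2 U1 U3) U4 p"
    if "U1 \<in> VF" "U2 \<in> VF" "U3 \<in> VF" "U4 \<in> VF" for U1 U2 U3 U4
    using curvature_skew[of U2 U1 U3] that by simp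
  note b = G_bianchi[where p = p]
  show ?thesis
    using b[OF assms] b[OF assms(2,3,4,1)] b[OF assms(3,4,1,2)] b[OF assms(4,1,2,3)]
      s[OF assms(2,3,4,1)] s[OF assms(1,2,4,3)] s[OF assms(3,4,2,1)] s[OF assms(4,1,2,3)]
      k[OF assms(1,3,4,2)] s[OF assms(3,1,4,2)] k[OF assms(2,4,1,3)] s[OF assms(4,2,1,3)]
    by linarith
qed

subsection \<open>Orthonormal bases and traces\<close>

text \<open>The very choice made inside \<open>scalar_curvature\<close>, so that the scalar
  curvature is literally a \<open>Tr\<close>.\<close>

definition onb :: "'m \<Rightarrow> 'm tangent set"
  where "onb p = (SOME B. orthonormal_basis_at A g p B)"

text \<open>Basis vectors are extended to fields, so that summands can be rewritten by identities
  between vector fields, as in \<open>Tr_cong\<close>.\<close>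

definition Tr :: "'m \<Rightarrow> ('m vfield \<Rightarrow> real) \<Rightarrow> real"
  where "Tr p F = (\<Sum>e\<in>onb p. F (extend A p e))"

lemma tangent_span:
  obtains B where "finite B" "B \<subseteq> T p" "span B = T p"
proof -
  obtain N and E :: "'e \<Rightarrow> 'm vfield" and x where "coordinate_frame p N E x" by (rule local_frame)
  note fr = coordinate_frameD[OF this]
  let ?B = "(\<lambda>b. E b p) ` Basis"
  have sub: "?B \<subseteq> T p" using fr(3) by auto
  have "v \<in> span ?B" if v: "v \<in> T p" for v
  proof -
    have "(\<Sum>b\<in>Basis. v (x b) *\<^sub>R E b p) \<in> span ?B"
      by (intro span_sum span_scale span_base) auto
    then show ?thesis by (simp only: fr(6)[OF fr(2) v, symmetric])
  qed
  then have "span ?B = T p" using span_minimal[OF sub tangent_subspace] by blast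
  then show ?thesis using that[of ?B] sub by simp
qed

lemma onb: "orthonormal_basis_at A g p (onb p)"
proof -
  obtain F where F: "finite F" "F \<subseteq> T p" "span F = T p" by (rule tangent_span)
  interpret I: inner_product_on "T p" "g p" by (rule ip)
  obtain B where "finite B" "B \<subseteq> T p" "I.orthonormal B" "span B = T p"
    using I.orthonormal_basis_exists[OF F(1,2)] F(3) by auto
  then have "orthonormal_basis_at A g p B"
    unfolding orthonormal_basis_at_def
    using I.orthonormal_independent[of B] by (auto simp: I.orthonormal_def)
  then show ?thesis unfolding onb_def by (rule someI[where P = "orthonormal_basis_at A g p"])
qed

lemma
  shows onb_finite: "finite (onb p)"
    and onb_tangent: "e \<in> onb p \<Longrightarrow> e \<in> T p"
    and onb_orth: "e \<in> onb p \<Longrightarrow> e' \<in> onb p \<Longrightarrow> g p e e' = (if e = e' then 1 else 0)"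
    and onb_expand: "v \<in> T p \<Longrightarrow> v = (\<Sum>e\<in>onb p. g p v e *\<^sub>R e)"
proof -
  obtain F where F: "finite F" "span F = T p" by (rule tangent_span)
  have o: "independent (onb p)" "span (onb p) = T p"
    "\<And>u v. u \<in> onb p \<Longrightarrow> v \<in> onb p \<Longrightarrow> g p u v = (if u = v then 1 else 0)"
    using onb[of p] unfolding orthonormal_basis_at_def by blast+
  have "onb p \<subseteq> span (onb p)" by (rule span_superset)
  then have "onb p \<subseteq> span F" by (simp only: o(2) F(2))
  then show fin: "finite (onb p)" using independent_span_bound[OF F(1) o(1)] by auto
  show tan: "e \<in> T p" if "e \<in> onb p" for e using o(2) that span_base by blast
  show "g p e e' = (if e = e' then 1 else 0)" if "e \<in> onb p" "e' \<in> onb p" for e e'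
    using o(3) that .
  interpret I: inner_product_on "T p" "g p" by (rule ip)
  show "v = (\<Sum>e\<in>onb p. g p v e *\<^sub>R e)" if "v \<in> T p" for v
    by (rule I.orthonormal_expand[OF fin]) (use tan o that in \<open>auto simp: I.orthonormal_def\<close>)
qed

lemma Tr_cong: "(\<And>X. X \<in> VF \<Longrightarrow> F X = H X) \<Longrightarrow> Tr p F = Tr p H"
  unfolding Tr_def by (rule sum.cong[OF refl]) (use extend(1)[OF onb_tangent] in auto)

lemma Tr_simps [simp]:
  "Tr p (\<lambda>X. F X + H X) = Tr p F + Tr p H" "Tr p (\<lambda>X. F X - H X) = Tr p F - Tr p H"
  "Tr p (\<lambda>X. - F X) = - Tr p F" "Tr p (\<lambda>X. c * F X) = c * Tr p F" "Tr p (\<lambda>X. F X * c) = Tr p F * c"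
  "Tr p (\<lambda>_. 0) = 0"
  unfolding Tr_def by (simp_all add: sum.distrib sum_subtractf sum_negf sum_distrib_left sum_distrib_right)

lemma Tr_swap: "Tr p (\<lambda>X. Tr p (\<lambda>Y. F X Y)) = Tr p (\<lambda>Y. Tr p (\<lambda>X. F X Y))"
  unfolding Tr_def by (rule sum.swap)

lemma Tr_sum: "Tr p (\<lambda>X. \<Sum>i\<in>I. H i X) = (\<Sum>i\<in>I. Tr p (H i))"
  unfolding Tr_def by (rule sum.swap)

text \<open>Expand W in the orthonormal basis. Traces below are brought to products of two factors
  linear in X so that this contraction applies.\<close>

lemma Tr_tensorial:
  assumes \<omega>: "tensorial \<omega>" and W: "W \<in> VF"
  shows "Tr p (\<lambda>X. \<omega> X p * G X W p) = \<omega> W p"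
proof -
  have "\<omega> W p = (\<Sum>e\<in>onb p. g p (W p) e * \<omega> (extend A p e) p)"
  proof (rule tensorial_expand[OF \<omega> W])
    show "extend A p e \<in> VF" if "e \<in> onb p" for e using extend(1)[OF onb_tangent[OF that]] .
    have "(\<Sum>e\<in>onb p. g p (W p) e *\<^sub>R extend A p e p) = (\<Sum>e\<in>onb p. g p (W p) e *\<^sub>R e)"
      by (rule sum.cong) (use extend(2)[OF onb_tangent] in auto)
    then show "W p = (\<Sum>e\<in>onb p. g p (W p) e *\<^sub>R extend A p e p)"
      using onb_expand[OF VF_tangent[OF W]] by (simp only:)
  qed
  also have "\<dots> = Tr p (\<lambda>X. \<omega> X p * G X W p)"
    unfolding Tr_def
  proof (rule sum.cong[OF refl])
    fix e assume e: "e \<in> onb p"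
    have "G (extend A p e) W p = G W (extend A p e) p"
      using extend(1)[OF onb_tangent[OF e]] W by (rule G_commute)
    then show "g p (W p) e * \<omega> (extend A p e) p = \<omega> (extend A p e) p * G (extend A p e) W p"
      by (simp add: G_def extend(2)[OF onb_tangent[OF e]])
  qed
  finally show ?thesis by simp
qed

lemma dv_tensorial: "h \<in> SF \<Longrightarrow> tensorial (\<lambda>X. dv X h)"
  unfolding tensorial_def by simp

lemma G_tensorial: "Y \<in> VF \<Longrightarrow> tensorial (\<lambda>X. G X Y)"
  unfolding tensorial_def by simp

lemma Tr_GG: "Y \<in> VF \<Longrightarrow> W \<in> VF \<Longrightarrow> Tr p (\<lambda>X. G X Y p * G X W p) = G Y W p"
  using Tr_tensorial[OF G_tensorial, of Y W p] by (simp add: G_commute)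

lemma trace_at_Tr:
  assumes L: "tensorial_op L"
  shows "trace_at A L p = Tr p (\<lambda>X. G (L X) X p)"
proof -
  have "trace_at A L p = (\<Sum>e\<in>onb p. g p (L (extend A p e) p) e)"
    unfolding trace_at_def
    by (rule trace_on_frame[OF tangent_subspace onb_finite _ _ onb_expand tensorial_op_linear[OF L]])
      (use onb_tangent inner_product_on.lin_left[OF ip] in auto)
  also have "\<dots> = Tr p (\<lambda>X. G (L X) X p)"
    unfolding Tr_def G_def by (rule sum.cong) (use extend(2)[OF onb_tangent] in auto)
  finally show ?thesis .
qed

lemma Tr_id: "Tr p (\<lambda>X. G X X p) = DIM('e)"
proof -
  obtain N and E :: "'e \<Rightarrow> 'm vfield" and x where "coordinate_frame p N E x" by (rule local_frame)
  note fr = coordinate_frameD[OF this]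
  have id: "tensorial_op (\<lambda>X. X)" by (simp add: tensorial_op_def)
  have "Tr p (\<lambda>X. G X X p) = (\<Sum>b\<in>Basis. E b p (x b))"
    using trace_at_Tr[OF id] trace_at_frame[OF id fr(3) fr(6)[OF fr(2)]] by simp
  then show ?thesis by (simp add: fr(5)[OF fr(2)])
qed

text \<open>Writing the trace as a double sum over the basis and swapping the sums moves the skew
  operator to the other argument; no adjoint of L is formed.\<close>

lemma Tr_skew:
  assumes L: "tensorial_op L" and f: "tensorial_op f"
    and skew: "\<And>X Y. X \<in> VF \<Longrightarrow> Y \<in> VF \<Longrightarrow> G (f X) Y p = - G X (f Y) p"
  shows "Tr p (\<lambda>X. G (L (f X)) X p) = - Tr p (\<lambda>X. G (L X) (f X) p)"
proof -
  have \<omega>: "tensorial (\<lambda>Y. G (L Y) X)" if "X \<in> VF" for X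
    unfolding tensorial_def using that tensorial_opD[OF L] by simp
  have "Tr p (\<lambda>X. G (L (f X)) X p) = Tr p (\<lambda>X. Tr p (\<lambda>Y. G (L Y) X p * G Y (f X) p))"
    by (rule Tr_cong) (simp add: Tr_tensorial[OF \<omega>] tensorial_opD[OF f])
  also have "\<dots> = Tr p (\<lambda>Y. Tr p (\<lambda>X. G (L Y) X p * G Y (f X) p))" by (rule Tr_swap)
  also have "\<dots> = Tr p (\<lambda>Y. - G (L Y) (f Y) p)"
  proof (rule Tr_cong)
    fix Y assume Y: "Y \<in> VF"
    have "Tr p (\<lambda>X. G (L Y) X p * G Y (f X) p) = Tr p (\<lambda>X. - (G X (L Y) p * G X (f Y) p))"
    proof (rule Tr_cong)
      fix X assume X: "X \<in> VF"
      have "G Y (f X) p = - G X (f Y) p"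
        using skew[OF X Y] G_commute[of "f X" Y p] tensorial_opD(1)[OF f] X Y by simp
      then show "G (L Y) X p * G Y (f X) p = - (G X (L Y) p * G X (f Y) p)"
        using G_commute[of "L Y" X p] tensorial_opD(1)[OF L] X Y by simp
    qed
    also have "\<dots> = - G (L Y) (f Y) p"
      using tensorial_opD(1)[OF L Y] tensorial_opD(1)[OF f Y] by (simp add: Tr_GG)
    finally show "Tr p (\<lambda>X. G (L Y) X p * G Y (f X) p) = - G (L Y) (f Y) p" .
  qed
  finally show ?thesis by simp
qed

abbreviation "Ric \<equiv> ricci A D"

lemma ricci_Tr: "X \<in> VF \<Longrightarrow> Y \<in> VF \<Longrightarrow> Ric X Y p = Tr p (\<lambda>Z. G (R Z X Y) Z p)"
  unfolding ricci_def by (rule trace_at_Tr) (rule curvature_tensorial)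

lemma ricci_tensorial: "X \<in> VF \<Longrightarrow> tensorial (Ric X)"
  unfolding tensorial_def by (simp add: ricci_Tr curvature_add curvature_fscale cong: Tr_cong)

lemma scalar_curvature_Tr: "scalar_curvature A g D p = Tr p (\<lambda>X. Ric X X p)"
  unfolding scalar_curvature_def Tr_def onb_def Let_def ..

subsection \<open>Lie derivatives\<close>

text \<open>The Lie derivative of the connection, a tensor, unlike the connection itself.\<close>

definition lie_conn :: "'m vfield \<Rightarrow> 'm vfield \<Rightarrow> 'm vfield \<Rightarrow> 'm vfield"
  where "lie_conn W X Y = br W (D X Y) - D (br W X) Y - D X (br W Y)"

text \<open>With S = \<open>lie_conn W\<close>, this is (\<nabla>_Z S)(X, Y) - (\<nabla>_X S)(Z, Y)
  written out using vanishing torsion: the Lie derivative of the curvature.\<close>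

definition lie_curv :: "'m vfield \<Rightarrow> 'm vfield \<Rightarrow> 'm vfield \<Rightarrow> 'm vfield \<Rightarrow> 'm vfield"
  where "lie_curv W Z X Y = lie_conn W Z (D X Y) + D Z (lie_conn W X Y) - lie_conn W X (D Z Y)
    - D X (lie_conn W Z Y) - lie_conn W (br Z X) Y"

lemma lie_conn_VF [simp]: "W \<in> VF \<Longrightarrow> X \<in> VF \<Longrightarrow> Y \<in> VF \<Longrightarrow> lie_conn W X Y \<in> VF"
  by (simp add: lie_conn_def)

lemma bracket_diff: "X \<in> VF \<Longrightarrow> Y \<in> VF \<Longrightarrow> Z \<in> VF \<Longrightarrow> br X (Y - Z) = br X Y - br X Z"
  using bracket_add[of X "Y - Z" Z] by simp

lemma lie_curvature:
  assumes "W \<in> VF" "X \<in> VF" "Y \<in> VF" "Z \<in> VF"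
  shows "br W (R Z X Y) - R (br W Z) X Y - R Z (br W X) Y - R Z X (br W Y) =
    lie_curv W Z X Y"
proof -
  have "D (br W (br Z X)) Y = D (br (br W Z) X) Y + D (br Z (br W X)) Y"
    using assms jacobi[of W Z X] by simp
  then show ?thesis
    using assms unfolding curvature_def lie_conn_def lie_curv_def
    by (simp add: bracket_diff bracket_add algebra_simps)
qed

text \<open>The Lie derivative commutes with the contraction, by \<open>trace_at_derivative\<close>
  for the derivation \<open>br W\<close>.\<close>

lemma lie_ricci:
  assumes "W \<in> VF" "X \<in> VF" "Y \<in> VF"
  shows "dv W (Ric X Y) p = Ric (br W X) Y p + Ric X (br W Y) p +
    Tr p (\<lambda>Z. G (lie_curv W Z X Y) Z p)"
proof -
  have t: "tensorial_op (\<lambda>Z. R Z X Y)" by (rule curvature_tensorial(1)[OF assms(2,3)])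
  have "dv W (Ric X Y) p = trace_at A (\<lambda>Z. br W (R Z X Y) - R (br W Z) X Y) p"
    unfolding dv_def ricci_def[abs_def]
    by (rule trace_at_derivative[OF bracket_derivation[OF assms(1)] t assms(1)])
  also have "\<dots> = Tr p (\<lambda>Z. G (br W (R Z X Y) - R (br W Z) X Y) Z p)"
    by (rule trace_at_Tr[OF derivation_over_commutator[OF bracket_derivation[OF assms(1)] t assms(1)]])
  also have "\<dots> = Tr p (\<lambda>Z. G (R Z (br W X) Y) Z p + G (R Z X (br W Y)) Z p +
      G (lie_curv W Z X Y) Z p)"
    by (rule Tr_cong, subst lie_curvature[OF assms, symmetric]) (use assms in simp_all)
  finally show ?thesis using assms by (simp add: ricci_Tr)
qed

lemma lie_conn_sym:
  assumes "W \<in> VF" "X \<in> VF" "Y \<in> VF"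
  shows "lie_conn W X Y = lie_conn W Y X"
proof -
  have "br W (D X Y) - br W (D Y X) = br W (br X Y)"
    using assms by (simp add: torsion_free[of X Y] bracket_diff)
  also have "\<dots> = br (br W X) Y + br X (br W Y)" by (rule jacobi[OF assms])
  also have "\<dots> = (D (br W X) Y - D Y (br W X)) + (D X (br W Y) - D (br W Y) X)"
    using assms torsion_free[of "br W X" Y] torsion_free[of X "br W Y"] by simp
  finally show ?thesis unfolding lie_conn_def by (simp add: algebra_simps)
qed

lemma lie_conn_curvature:
  assumes "W \<in> VF" "X \<in> VF" "Y \<in> VF"
  shows "lie_conn W X Y = R W X Y + D X (D Y W) - D (D X Y) W"
proof -
  have "br W (D X Y) = D W (D X Y) - D (D X Y) W" "D X (br W Y) = D X (D W Y) - D X (D Y W)"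
    using assms by (simp_all add: torsion_free)
  then show ?thesis using assms unfolding lie_conn_def curvature_def by (simp add: algebra_simps)
qed

text \<open>The covariant derivative of h in direction X is G(S(X, Y), Z) + G(Y, S(X, Z)) with S =
  \<open>lie_conn W\<close>. As S is symmetric, three permutations isolate it as in the Koszul
  formula. The abstract h lets an explicit Lie derivative of g be inserted.\<close>

lemma lie_conn_koszul:
  assumes W: "W \<in> VF" and h: "\<And>X Y. X \<in> VF \<Longrightarrow> Y \<in> VF \<Longrightarrow> lie_deriv W g X Y = h X Y"
    and XYZ: "X \<in> VF" "Y \<in> VF" "Z \<in> VF"
  shows "2 * G (lie_conn W X Y) Z p =
    (dv X (h Y Z) p - h (D X Y) Z p - h Y (D X Z) p) +
    (dv Y (h X Z) p - h (D Y X) Z p - h X (D Y Z) p) -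
    (dv Z (h X Y) p - h (D Z X) Y p - h X (D Z Y) p)"
proof -
  have h': "h X Y = (\<lambda>p. dv W (G X Y) p - G (br W X) Y p - G X (br W Y) p)"
    if "X \<in> VF" "Y \<in> VF" for X Y
    using h[OF that] by (simp add: fun_eq_iff lie_deriv_def G_def[abs_def] dv_def)
  have c: "dv X (h Y Z) p - h (D X Y) Z p - h Y (D X Z) p =
      G (lie_conn W X Y) Z p + G Y (lie_conn W X Z) p"
    if XYZ: "X \<in> VF" "Y \<in> VF" "Z \<in> VF" for X Y Z
  proof -
    have "dv (br W X) (G Y Z) p = dv W (dv X (G Y Z)) p - dv X (dv W (G Y Z)) p"
      by (rule dv_bracket)
    then show ?thesis
      using XYZ W by (simp add: h' D_metric lie_conn_def algebra_simps)
  qed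
  show ?thesis
    unfolding c[OF XYZ] c[OF XYZ(2,1,3)] c[OF XYZ(3,1,2)]
    using lie_conn_sym[OF W XYZ(1,2)] lie_conn_sym[OF W XYZ(1,3)] lie_conn_sym[OF W XYZ(2,3)]
      XYZ W by (simp add: G_commute)
qed

end

subsection \<open>Weak \<open>\<beta>f\<close>-Kenmotsu manifolds\<close>

locale kenmotsu = riemannian A g D
  for A :: "('m::{t2_space,second_countable_topology}, 'e::euclidean_space) chart set" and g D +
  fixes n s :: nat and f Q :: "'m endofield" and \<xi> :: "nat \<Rightarrow> 'm vfield" and \<eta> :: "nat \<Rightarrow> 'm oneform"
    and \<beta> :: real
  assumes wk: "weak_beta_f_kenmotsu A n s f Q \<xi> \<eta> g D (\<lambda>_. \<beta>)"
    and n: "n \<ge> 1" and s: "s \<ge> 1" and \<beta>: "\<beta> \<noteq> 0"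
begin

definition "F \<equiv> act f"
definition "QQ \<equiv> act Q"
definition "xb \<equiv> \<Sum>i=1..s. \<xi> i"
definition Pr :: "'m vfield \<Rightarrow> 'm vfield"
  where "Pr X = X - (\<Sum>i=1..s. fscale (G X (\<xi> i)) (\<xi> i))"

lemma struct: "weak_metric_f_structure A n s f Q \<xi> \<eta> g"
  using wk unfolding weak_beta_f_kenmotsu_def by blast

lemma dim: "DIM('e) = 2 * n + s"
  using struct unfolding weak_metric_f_structure_def by blast

lemma endo: "f \<in> endo_fields A" "Q \<in> endo_fields A"
  using struct unfolding weak_metric_f_structure_def by blast+

lemma xi_VF [simp]: "i \<in> {1..s} \<Longrightarrow> \<xi> i \<in> VF"
  using struct unfolding weak_metric_f_structure_def by blast

lemma endo_tensorial:
  assumes "H \<in> endo_fields A"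
  shows "tensorial_op (act H)"
proof -
  have l: "linear_on_set (T p) (H p)" for p using assms unfolding endo_fields_def by blast
  have "act H (X + Y) = act H X + act H Y" if "X \<in> VF" "Y \<in> VF" for X Y
    using l that by (simp add: act_def fun_eq_iff linear_on_set_def)
  moreover have "act H (fscale h X) = fscale h (act H X)" if "X \<in> VF" for h X
    using l that by (simp add: act_def fscale_def linear_on_set_def)
  moreover have "act H X \<in> VF" if "X \<in> VF" for X
    using assms that unfolding endo_fields_def by blast
  ultimately show ?thesis unfolding tensorial_op_def by blast
qed

lemma F_tensorial: "tensorial_op F" and Q_tensorial: "tensorial_op QQ"
  unfolding F_def QQ_def using endo_tensorial endo by auto

lemmas F_simps [simp] = tensorial_opD[OF F_tensorial]
lemmas Q_simps [simp] = tensorial_opD[OF Q_tensorial]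

lemma op_minus: "tensorial_op L \<Longrightarrow> X \<in> VF \<Longrightarrow> L (- X) = - L X"
  using tensorial_opD(3)[of L "\<lambda>_. -1" X] by (simp add: minus_fscale[symmetric])

lemma op_diff: "tensorial_op L \<Longrightarrow> X \<in> VF \<Longrightarrow> Y \<in> VF \<Longrightarrow> L (X - Y) = L X - L Y"
  using tensorial_opD(2)[of L X "- Y"] op_minus[of L Y]
  by (simp only: VF_minus add_uminus_conv_diff)

lemma op_zero: "tensorial_op L \<Longrightarrow> L 0 = 0"
  using op_diff[of L 0 0] by (simp only: VF_zero diff_self)

lemma op_sum:
  assumes "tensorial_op L" "\<And>i. i \<in> I \<Longrightarrow> X i \<in> VF"
  shows "L (\<Sum>i\<in>I. X i) = (\<Sum>i\<in>I. L (X i))"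
  using assms(2) by (induction I rule: infinite_finite_induct)
    (simp_all add: op_zero[OF assms(1)] tensorial_opD[OF assms(1)] del: plus_fun_apply)

lemmas F_minus [simp] = op_minus[OF F_tensorial]
lemmas F_diff [simp] = op_diff[OF F_tensorial]
lemmas F_zero [simp] = op_zero[OF F_tensorial]

lemma F_skew: "X \<in> VF \<Longrightarrow> Y \<in> VF \<Longrightarrow> G (F X) Y p = - G X (F Y) p"
  using struct unfolding weak_metric_f_structure_def G_def F_def act_def by simp

lemma xi_orth [simp]:
  "i \<in> {1..s} \<Longrightarrow> j \<in> {1..s} \<Longrightarrow> G (\<xi> i) (\<xi> j) p = (if i = j then 1 else 0)"
  using struct unfolding weak_metric_f_structure_def G_def by blast

lemma Q_xi: "i \<in> {1..s} \<Longrightarrow> QQ (\<xi> i) = \<xi> i"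
  using struct unfolding weak_metric_f_structure_def QQ_def act_def by (simp add: fun_eq_iff)

lemma FF_eta: "X \<in> VF \<Longrightarrow> F (F X) = - QQ X + (\<Sum>i=1..s. fscale (\<lambda>p. \<eta> i p (X p)) (\<xi> i))"
  using struct unfolding weak_metric_f_structure_def F_def QQ_def act_def
  by (intro ext) (simp add: sum_apply fscale_apply)

lemma FF_metric_eta:
  "X \<in> VF \<Longrightarrow> Y \<in> VF \<Longrightarrow>
    G (F X) (F Y) p = G X (QQ Y) p - (\<Sum>i=1..s. \<eta> i p (X p) * \<eta> i p (Y p))"
  using struct unfolding weak_metric_f_structure_def G_def F_def QQ_def act_def by simp

lemma eta_xi: "i \<in> {1..s} \<Longrightarrow> j \<in> {1..s} \<Longrightarrow> \<eta> i p (\<xi> j p) = (if i = j then 1 else 0)"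
  using struct unfolding weak_metric_f_structure_def by blast

lemma sum_delta_xi: "i \<in> {1..s} \<Longrightarrow> (\<Sum>j=1..s. c j * (if j = i then 1 else 0)) = (c i :: real)"
  "i \<in> {1..s} \<Longrightarrow> (\<Sum>j=1..s. c j * (if i = j then 1 else 0)) = (c i :: real)"
  by (simp_all add: if_distrib cong: if_cong)

text \<open>F(F \<xi>) = -\<xi> + \<xi> = 0, and by skewness the squared length of F \<xi> is -G
  \<xi> (F (F \<xi>)).\<close>

lemma F_xi [simp]:
  assumes "i \<in> {1..s}"
  shows "F (\<xi> i) = 0"
proof -
  have v: "\<xi> i \<in> VF" using assms by simp
  have "F (F (\<xi> i)) = 0"
  proof
    fix p
    have "(\<Sum>j=1..s. \<eta> j p (\<xi> i p) *\<^sub>R \<xi> j p) = (\<Sum>j=1..s. if j = i then \<xi> j p else 0)"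
      by (rule sum.cong) (use assms eta_xi in auto)
    then show "F (F (\<xi> i)) p = 0 p"
      using FF_eta[OF v] Q_xi[OF assms] assms by (simp add: sum_apply fscale_apply)
  qed
  then have "G (F (\<xi> i)) (F (\<xi> i)) p = 0" for p
    using F_skew[OF v F_simps(1)[OF v], of p] v by simp
  then have "F (\<xi> i) p = 0" for p using G_pos[of "F (\<xi> i)" p] v by force
  then show ?thesis by (simp add: fun_eq_iff)
qed

text \<open>Compatibility of g with f for the second argument \<open>\<xi> i\<close>: the left side
  vanishes by \<open>F_xi\<close>, and Q fixes \<open>\<xi> i\<close>. From here on the one-forms
  are replaced by inner products with the structure fields.\<close>

lemma eta_G:
  assumes "i \<in> {1..s}" "X \<in> VF"
  shows "\<eta> i p (X p) = G X (\<xi> i) p"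
proof -
  have "0 = G X (\<xi> i) p - (\<Sum>j=1..s. \<eta> j p (X p) * \<eta> j p (\<xi> i p))"
    using FF_metric_eta[OF assms(2) xi_VF[OF assms(1)], of p] assms by (simp add: Q_xi)
  also have "(\<Sum>j=1..s. \<eta> j p (X p) * \<eta> j p (\<xi> i p)) = (\<Sum>j=1..s. \<eta> j p (X p) * (if j = i then 1 else 0))"
    by (rule sum.cong) (use eta_xi assms in auto)
  also have "\<dots> = \<eta> i p (X p)" using assms(1) by (rule sum_delta_xi)
  finally show ?thesis by simp
qed

lemma FF: "X \<in> VF \<Longrightarrow> F (F X) = - QQ X + (\<Sum>i=1..s. fscale (G X (\<xi> i)) (\<xi> i))"
  unfolding FF_eta
  by (rule arg_cong2[where f = "(+)", OF refl], rule sum.cong[OF refl]) (simp add: fscale_def eta_G)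

lemma FF_metric:
  "X \<in> VF \<Longrightarrow> Y \<in> VF \<Longrightarrow> G (F X) (F Y) p = G X (QQ Y) p - (\<Sum>i=1..s. G X (\<xi> i) p * G Y (\<xi> i) p)"
  by (simp add: FF_metric_eta eta_G)

lemma F_orth [simp]:
  "i \<in> {1..s} \<Longrightarrow> X \<in> VF \<Longrightarrow> G (F X) (\<xi> i) p = 0" "i \<in> {1..s} \<Longrightarrow> X \<in> VF \<Longrightarrow> G (\<xi> i) (F X) p = 0"
  using F_skew[of X "\<xi> i" p] F_skew[of "\<xi> i" X p] by simp_all

lemma xb_VF [simp]: "xb \<in> VF"
  unfolding xb_def by (rule VF_sum) simp

lemma xb_eq: "xi_bar s \<xi> = xb"
  by (simp add: xi_bar_def xb_def fun_eq_iff sum_apply)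

lemma G_xb: "X \<in> VF \<Longrightarrow> G X xb p = (\<Sum>i=1..s. G X (\<xi> i) p)"
proof -
  assume X: "X \<in> VF"
  have "G xb X p = (\<Sum>i=1..s. G (\<xi> i) X p)" unfolding xb_def by (rule G_sum) (use X in auto)
  also have "\<dots> = (\<Sum>i=1..s. G X (\<xi> i) p)"
    by (rule sum.cong[OF refl], rule G_commute) (use X in auto)
  finally show ?thesis using G_commute[OF X xb_VF] by simp
qed

lemma eta_bar_G: "X \<in> VF \<Longrightarrow> eta_bar s \<eta> p (X p) = G X xb p"
  by (simp add: eta_bar_def G_xb eta_G)

lemma G_xi_xb [simp]: "i \<in> {1..s} \<Longrightarrow> G (\<xi> i) xb p = 1"
  by (simp add: G_xb)

lemma G_xb_xi [simp]: "i \<in> {1..s} \<Longrightarrow> G xb (\<xi> i) p = 1"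
  using G_commute[of xb "\<xi> i" p] by simp

lemma G_xb_xb [simp]: "G xb xb p = real s"
  by (simp add: G_xb)

lemma F_xb [simp]: "F xb = 0"
  unfolding xb_def by (subst op_sum[OF F_tensorial]) auto

lemma G_F_xb [simp]: "X \<in> VF \<Longrightarrow> G (F X) xb p = 0" "X \<in> VF \<Longrightarrow> G xb (F X) p = 0"
  using F_skew[of X xb p] F_skew[of xb X p] by simp_all

section \<open>The horizontal projection and the two horizontal bilinear forms\<close>

lemma Pr_VF [simp]: "X \<in> VF \<Longrightarrow> Pr X \<in> VF"
  unfolding Pr_def by (intro VF_diff VF_sum VF_fscale) auto

text \<open>The horizontal part of g; with \<open>gF\<close> and products of \<open>G _ xb\<close>
  it expresses all the Ricci-type tensors below.\<close>

definition gP :: "'m vfield \<Rightarrow> 'm vfield \<Rightarrow> 'm \<Rightarrow> real"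
  where "gP X Y p = G X Y p - (\<Sum>i=1..s. G X (\<xi> i) p * G Y (\<xi> i) p)"

definition gF :: "'m vfield \<Rightarrow> 'm vfield \<Rightarrow> 'm \<Rightarrow> real"
  where "gF X Y = G (F X) (F Y)"

lemma gP_commute: "X \<in> VF \<Longrightarrow> Y \<in> VF \<Longrightarrow> gP X Y p = gP Y X p"
  by (simp add: gP_def G_commute mult.commute)

lemma gF_commute: "X \<in> VF \<Longrightarrow> Y \<in> VF \<Longrightarrow> gF X Y p = gF Y X p"
  unfolding gF_def by (rule G_commute) simp_all

lemma gF_SF [simp]: "X \<in> VF \<Longrightarrow> Y \<in> VF \<Longrightarrow> gF X Y \<in> SF"
  unfolding gF_def by simp

lemma G_Pr [simp]:
  assumes "X \<in> VF" "Y \<in> VF"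
  shows "G (Pr X) Y p = gP X Y p" "G Y (Pr X) p = gP X Y p"
proof -
  have "G (\<Sum>i=1..s. fscale (G X (\<xi> i)) (\<xi> i)) Y p = (\<Sum>i=1..s. G X (\<xi> i) p * G (\<xi> i) Y p)"
    by (subst G_sum) (use assms in simp_all)
  also have "\<dots> = (\<Sum>i=1..s. G X (\<xi> i) p * G Y (\<xi> i) p)"
    by (rule sum.cong) (use assms G_commute[of _ Y p] in auto)
  finally show 1: "G (Pr X) Y p = gP X Y p"
    unfolding Pr_def gP_def using assms by (subst G_diff) (auto intro!: VF_sum VF_fscale)
  show "G Y (Pr X) p = gP X Y p" using 1 G_commute[of Y "Pr X" p] assms by simp
qed

lemma gP_SF [simp]: "X \<in> VF \<Longrightarrow> Y \<in> VF \<Longrightarrow> gP X Y \<in> SF"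
proof -
  assume X: "X \<in> VF" and Y: "Y \<in> VF"
  have "gP X Y = G (Pr X) Y" using X Y by (simp add: fun_eq_iff)
  then show ?thesis using X Y by simp
qed

lemma gP_fun: "X \<in> VF \<Longrightarrow> Y \<in> VF \<Longrightarrow> gP X Y = G (Pr X) Y"
  by (simp add: fun_eq_iff)

lemma gP_left: "X \<in> VF \<Longrightarrow> Y \<in> VF \<Longrightarrow> gP X Y p = G (Pr X) Y p"
  and gP_right: "X \<in> VF \<Longrightarrow> Y \<in> VF \<Longrightarrow> gP X Y p = G X (Pr Y) p"
  using gP_commute[of X Y p] by simp_all

lemma gP_simps [simp]:
  assumes "X \<in> VF" "Y \<in> VF" "Z \<in> VF"
  shows "gP (X + Y) Z p = gP X Z p + gP Y Z p" "gP Z (X + Y) p = gP Z X p + gP Z Y p"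
    "gP (X - Y) Z p = gP X Z p - gP Y Z p" "gP Z (X - Y) p = gP Z X p - gP Z Y p"
proof -
  show "gP (X + Y) Z p = gP X Z p + gP Y Z p" "gP (X - Y) Z p = gP X Z p - gP Y Z p"
    using assms by (simp_all add: gP_right del: G_Pr)
  show "gP Z (X + Y) p = gP Z X p + gP Z Y p" "gP Z (X - Y) p = gP Z X p - gP Z Y p"
    using assms by (simp_all add: gP_left del: G_Pr)
qed

lemma gP_scale [simp]:
  assumes "X \<in> VF" "Y \<in> VF"
  shows "h \<in> SF \<Longrightarrow> gP (fscale h X) Y p = h p * gP X Y p" "h \<in> SF \<Longrightarrow> gP X (fscale h Y) p = h p * gP X Y p"
    "gP (- X) Y p = - gP X Y p" "gP X (- Y) p = - gP X Y p"
proof -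
  show "h \<in> SF \<Longrightarrow> gP (fscale h X) Y p = h p * gP X Y p" "gP (- X) Y p = - gP X Y p"
    using assms by (simp_all add: gP_right del: G_Pr)
  show "h \<in> SF \<Longrightarrow> gP X (fscale h Y) p = h p * gP X Y p" "gP X (- Y) p = - gP X Y p"
    using assms by (simp_all add: gP_left del: G_Pr)
qed

lemma gP_xi [simp]:
  assumes "X \<in> VF"
  shows "i \<in> {1..s} \<Longrightarrow> gP (\<xi> i) X p = 0" "i \<in> {1..s} \<Longrightarrow> gP X (\<xi> i) p = 0"
    "gP xb X p = 0" "gP X xb p = 0"
proof -
  show 1: "gP X (\<xi> i) p = 0" if i: "i \<in> {1..s}" for i
  proof -
    have "(\<Sum>j=1..s. G X (\<xi> j) p * G (\<xi> i) (\<xi> j) p) = (\<Sum>j=1..s. G X (\<xi> j) p * (if i = j then 1 else 0))"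
      by (rule sum.cong) (use i in auto)
    also have "\<dots> = G X (\<xi> i) p" using i by (rule sum_delta_xi)
    finally show ?thesis by (simp add: gP_def)
  qed
  then show "gP (\<xi> i) X p = 0" if "i \<in> {1..s}" for i using that gP_commute[of X "\<xi> i" p] assms by simp
  have "gP X xb p = G (Pr X) xb p" using assms by simp
  also have "\<dots> = (\<Sum>i=1..s. G (Pr X) (\<xi> i) p)" using assms by (simp add: G_xb del: G_Pr)
  also have "\<dots> = 0" by (rule sum.neutral) (use assms 1 in auto)
  finally show "gP X xb p = 0" .
  then show "gP xb X p = 0" using gP_commute[of X xb p] assms by simp
qed

lemma gP_Pr [simp]:
  assumes "X \<in> VF" "Y \<in> VF"
  shows "gP (Pr X) Y p = gP X Y p" "gP Y (Pr X) p = gP X Y p"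
proof -
  show "gP (Pr X) Y p = gP X Y p" unfolding gP_def[of "Pr X"] using assms by simp
  then show "gP Y (Pr X) p = gP X Y p" using assms gP_commute[of Y "Pr X" p] by simp
qed

lemma gP_F [simp]:
  assumes "X \<in> VF" "Y \<in> VF"
  shows "gP (F X) Y p = G (F X) Y p" "gP Y (F X) p = G Y (F X) p"
  using assms by (simp_all add: gP_def)

lemma Pr_simps [simp]:
  assumes "X \<in> VF"
  shows "i \<in> {1..s} \<Longrightarrow> Pr (\<xi> i) = 0" "Pr xb = 0" "Pr (Pr X) = Pr X" "Pr (F X) = F X" "F (Pr X) = F X"
    "h \<in> SF \<Longrightarrow> Pr (fscale h X) = fscale h (Pr X)"
    "Y \<in> VF \<Longrightarrow> Pr (X + Y) = Pr X + Pr Y" "Y \<in> VF \<Longrightarrow> Pr (X - Y) = Pr X - Pr Y" "Pr (- X) = - Pr X"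
  by (rule field_eqI; use assms in \<open>simp add: F_skew\<close>)+

lemma gF_simps [simp]:
  assumes "X \<in> VF" "Y \<in> VF"
  shows "Z \<in> VF \<Longrightarrow> gF (X + Y) Z p = gF X Z p + gF Y Z p" "Z \<in> VF \<Longrightarrow> gF Z (X + Y) p = gF Z X p + gF Z Y p"
    "Z \<in> VF \<Longrightarrow> gF (X - Y) Z p = gF X Z p - gF Y Z p" "Z \<in> VF \<Longrightarrow> gF Z (X - Y) p = gF Z X p - gF Z Y p"
    "h \<in> SF \<Longrightarrow> gF (fscale h X) Y p = h p * gF X Y p" "h \<in> SF \<Longrightarrow> gF X (fscale h Y) p = h p * gF X Y p"
    "gF (- X) Y p = - gF X Y p" "gF X (- Y) p = - gF X Y p"
    "gF (Pr X) Y p = gF X Y p" "gF X (Pr Y) p = gF X Y p"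
  using assms by (simp_all add: gF_def)

lemma gF_xi [simp]:
  assumes "X \<in> VF"
  shows "i \<in> {1..s} \<Longrightarrow> gF X (\<xi> i) p = 0" "i \<in> {1..s} \<Longrightarrow> gF (\<xi> i) X p = 0"
    "gF X xb p = 0" "gF xb X p = 0"
  using assms by (simp_all add: gF_def)

text \<open>If F X = 0 at p, then F(F X) = 0 gives Q X = Y = Q Y for the vertical part Y of X, and Q
  is injective.\<close>

lemma ker_F:
  assumes X: "X \<in> VF" and F: "F X p = 0"
  shows "Pr X p = 0"
proof -
  define Y where "Y = (\<Sum>i=1..s. fscale (G X (\<xi> i)) (\<xi> i))"
  have Y: "Y \<in> VF" unfolding Y_def using X by (intro VF_sum VF_fscale) auto
  have "QQ Y = (\<Sum>i=1..s. QQ (fscale (G X (\<xi> i)) (\<xi> i)))"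
    unfolding Y_def by (rule op_sum[OF Q_tensorial]) (use X in auto)
  also have "\<dots> = Y" unfolding Y_def by (rule sum.cong) (use X Q_xi in auto)
  finally have "QQ Y = Y" .
  have "F (F X) p = F 0 p"
    by (rule tensorial_op_cong[OF F_tensorial]) (use X F in simp_all)
  then have "F (F X) p = 0" by simp
  then have "- QQ X p + Y p = 0" unfolding FF[OF X] Y_def by (simp add: sum_apply)
  then have "Q p (X p) = Q p (Y p)"
    using \<open>QQ Y = Y\<close> unfolding QQ_def act_def by (metis add_eq_0_iff minus_minus)
  moreover have "inj_on (Q p) (T p)"
    using struct unfolding weak_metric_f_structure_def bij_betw_def by blast
  ultimately have "X p = Y p" using X Y by (metis VF_tangent inj_on_eq_iff)
  then show ?thesis by (simp add: Pr_def Y_def)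
qed

subsection \<open>The covariant derivative of the structure\<close>

lemma normal:
  assumes "X \<in> VF" "Y \<in> VF"
  shows "F (F (br X Y)) + br (F X) (F Y) - F (br (F X) Y) - F (br X (F Y))
    + (\<Sum>i=1..s. fscale (\<lambda>p. dv X (G Y (\<xi> i)) p - dv Y (G X (\<xi> i)) p - G (br X Y) (\<xi> i) p) (\<xi> i)) = 0"
proof
  fix p
  have fn: "(\<lambda>q. \<eta> i q (X q)) = G X (\<xi> i)" if "i \<in> {1..s}" "X \<in> VF" for i X
    using eta_G that by (simp add: fun_eq_iff)
  have "nijenhuis f X Y p + 2 *\<^sub>R (\<Sum>i=1..s. ext_deriv (\<eta> i) X Y p *\<^sub>R \<xi> i p) = 0"
    using wk assms unfolding weak_beta_f_kenmotsu_def normal_structure_def by blast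
  moreover have "2 *\<^sub>R (\<Sum>i=1..s. ext_deriv (\<eta> i) X Y p *\<^sub>R \<xi> i p) =
     (\<Sum>i=1..s. (dv X (G Y (\<xi> i)) p - dv Y (G X (\<xi> i)) p - G (br X Y) (\<xi> i) p) *\<^sub>R \<xi> i p)"
    unfolding scaleR_sum_right ext_deriv_def
    by (rule sum.cong) (use assms fn eta_G[OF _ VF_bracket[OF assms], of _ p] in \<open>auto simp: dv_def\<close>)
  ultimately show "(F (F (br X Y)) + br (F X) (F Y) - F (br (F X) Y) - F (br X (F Y))
    + (\<Sum>i=1..s. fscale (\<lambda>p. dv X (G Y (\<xi> i)) p - dv Y (G X (\<xi> i)) p - G (br X Y) (\<xi> i) p) (\<xi> i))) p = 0 p"
    by (simp add: nijenhuis_def F_def sum_apply fscale_apply)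
qed

text \<open>The \<open>\<xi> k\<close> component of normality: three of the four Nijenhuis terms lie
  in the image of F, which is orthogonal to \<open>\<xi> k\<close>.\<close>

lemma normal_xi:
  assumes X: "X \<in> VF" and Y: "Y \<in> VF" and k: "k \<in> {1..s}"
  shows "dv X (G Y (\<xi> k)) p - dv Y (G X (\<xi> k)) p - G (br X Y) (\<xi> k) p + G (br (F X) (F Y)) (\<xi> k) p = 0"
proof -
  define c where "c i = (\<lambda>p. dv X (G Y (\<xi> i)) p - dv Y (G X (\<xi> i)) p - G (br X Y) (\<xi> i) p)" for i
  have c: "c i \<in> SF" if "i \<in> {1..s}" for i
    unfolding c_def by (intro SF_diff dv_SF G_SF VF_bracket X Y xi_VF that)
  have S: "(\<Sum>i=1..s. fscale (c i) (\<xi> i)) \<in> VF" by (intro VF_sum VF_fscale c xi_VF)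
  have "G (\<Sum>i=1..s. fscale (c i) (\<xi> i)) (\<xi> k) p = (\<Sum>i=1..s. c i p * G (\<xi> i) (\<xi> k) p)"
    by (subst G_sum) (use c k in simp_all)
  also have "\<dots> = (\<Sum>i=1..s. c i p * (if i = k then 1 else 0))"
    by (rule sum.cong) (use k in auto)
  also have "\<dots> = c k p" using k by (rule sum_delta_xi)
  finally have "G (\<Sum>i=1..s. fscale (c i) (\<xi> i)) (\<xi> k) p = c k p" .
  moreover have "G (F (F (br X Y)) + br (F X) (F Y) - F (br (F X) Y) - F (br X (F Y))
    + (\<Sum>i=1..s. fscale (c i) (\<xi> i))) (\<xi> k) p = 0"
    using normal[OF X Y] k unfolding c_def by simp
  ultimately show ?thesis using X Y k S by (simp add: c_def)
qed

lemma bracket_zero [simp]: "X \<in> VF \<Longrightarrow> br X 0 = 0" "X \<in> VF \<Longrightarrow> br 0 X = 0"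
  using bracket_diff[of X 0 0] bracket_skew[of 0 X] by simp_all

text \<open>Normality turns \<open>G (D X (\<xi> j)) (\<xi> k)\<close>, skew in \<open>j, k\<close>, into \<open>- G X (D (\<xi> j) (\<xi> k))\<close>,
  which is symmetric since the \<open>\<xi> i\<close> commute.\<close>

lemma D_xi_xi:
  assumes X: "X \<in> VF" and j: "j \<in> {1..s}" and k: "k \<in> {1..s}"
  shows "G (D X (\<xi> j)) (\<xi> k) p = 0"
proof -
  have const: "G (\<xi> i) (\<xi> j) = (\<lambda>_. if i = j then 1 else 0)" if "i \<in> {1..s}" "j \<in> {1..s}" for i j
    using that by (simp add: fun_eq_iff)
  \<comment> \<open>\<open>normal_xi\<close> removes the vertical components of the bracket. The
    full normality condition then reduces to F(F [\<xi>, \<xi>]) = 0, so the horizontal part lies in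
    the kernel of F and vanishes too.\<close>
  have comm: "br (\<xi> i) (\<xi> j) = 0" if i: "i \<in> {1..s}" and j: "j \<in> {1..s}" for i j
  proof -
    have e: "G (br (\<xi> i) (\<xi> j)) (\<xi> k) p = 0" if "k \<in> {1..s}" for k p
      using normal_xi[OF xi_VF[OF i] xi_VF[OF j] that, of p] i j that by (simp add: const)
    have "(\<Sum>k=1..s. fscale (\<lambda>p. dv (\<xi> i) (G (\<xi> j) (\<xi> k)) p - dv (\<xi> j) (G (\<xi> i) (\<xi> k)) p
        - G (br (\<xi> i) (\<xi> j)) (\<xi> k) p) (\<xi> k)) = 0"
      by (rule sum.neutral) (use i j e in \<open>auto simp: const\<close>)
    then have "F (F (br (\<xi> i) (\<xi> j))) = 0"
      using normal[OF xi_VF[OF i] xi_VF[OF j]] i j by simp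
    then have "G (F (br (\<xi> i) (\<xi> j))) (F (br (\<xi> i) (\<xi> j))) p = 0" for p
      using F_skew[of "br (\<xi> i) (\<xi> j)" "F (br (\<xi> i) (\<xi> j))" p] i j by simp
    then have "F (br (\<xi> i) (\<xi> j)) p = 0" for p using G_pos[of "F (br (\<xi> i) (\<xi> j))" p] i j by force
    then have "Pr (br (\<xi> i) (\<xi> j)) p = 0" for p using ker_F i j by simp
    then have "Pr (br (\<xi> i) (\<xi> j)) = 0" by (simp add: fun_eq_iff)
    then have "gP (br (\<xi> i) (\<xi> j)) Z p = 0" if "Z \<in> VF" for Z p
      using G_Pr(1)[of "br (\<xi> i) (\<xi> j)" Z p] that i j by simp
    moreover have "gP (br (\<xi> i) (\<xi> j)) Z p = G (br (\<xi> i) (\<xi> j)) Z p" for Z p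
      unfolding gP_def using e by simp
    ultimately show ?thesis using i j by (intro field_eqI) auto
  qed
  have skew: "G (D X (\<xi> j)) (\<xi> k) p = - G (D X (\<xi> k)) (\<xi> j) p"
  proof -
    have "dv X (G (\<xi> j) (\<xi> k)) p = 0" using X j k by (simp add: const)
    then show ?thesis using X j k G_commute[of "D X (\<xi> k)" "\<xi> j" p] by (simp add: D_metric)
  qed
  have rhs: "G (D X (\<xi> i)) (\<xi> l) p = - G X (D (\<xi> i) (\<xi> l)) p" if il: "i \<in> {1..s}" "l \<in> {1..s}" for i l
  proof -
    have "dv X (G (\<xi> i) (\<xi> l)) p = 0" using X il by (simp add: const)
    then have "dv (\<xi> i) (G X (\<xi> l)) p + G (br X (\<xi> i)) (\<xi> l) p = 0"
      using normal_xi[OF X xi_VF[OF il(1)] il(2), of p] il X by simp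
    then show ?thesis using il X by (simp add: D_metric torsion_free)
  qed
  have "D (\<xi> j) (\<xi> k) = D (\<xi> k) (\<xi> j)"
    using comm[OF j k] torsion_free[of "\<xi> j" "\<xi> k"] j k by simp
  then show ?thesis using skew rhs[OF j k] rhs[OF k j] by simp
qed

lemma D_F:
  assumes "X \<in> VF" "Y \<in> VF"
  shows "D X (F Y) = F (D X Y) + fscale (\<lambda>p. \<beta> * G (F X) Y p) xb - fscale (\<lambda>p. \<beta> * G Y xb p) (F X)"
proof
  fix p
  have "D X (act f Y) p - f p (D X Y p) =
       \<beta> *\<^sub>R (g p (f p (X p)) (Y p) *\<^sub>R xi_bar s \<xi> p - eta_bar s \<eta> p (Y p) *\<^sub>R f p (X p))"
    using wk assms unfolding weak_beta_f_kenmotsu_def by blast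
  then show "D X (F Y) p = (F (D X Y) + fscale (\<lambda>p. \<beta> * G (F X) Y p) xb - fscale (\<lambda>p. \<beta> * G Y xb p) (F X)) p"
    using assms by (simp add: F_def act_def G_def[of "\<lambda>p. f p (X p)"] xb_eq eta_bar_G fscale_apply
        scaleR_diff_right algebra_simps)
qed

text \<open>For Y = \<open>\<xi> i\<close> the defining relation reads 0 = F(D X \<xi>) - \<beta> F
  X, so the difference W of the two sides is in the kernel of F. \<open>D_xi_xi\<close> makes W
  horizontal, hence 0.\<close>

lemma D_xi [simp]:
  assumes X: "X \<in> VF" and i: "i \<in> {1..s}"
  shows "D X (\<xi> i) = fscale (\<lambda>_. \<beta>) (Pr X)"
proof
  fix p
  define W where "W = D X (\<xi> i) - fscale (\<lambda>_. \<beta>) (Pr X)"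
  have W: "W \<in> VF" unfolding W_def using X i by simp
  have "F W = 0"
  proof -
    have "G (\<xi> i) xb = (\<lambda>_. 1)" using i by (simp add: fun_eq_iff)
    moreover have "D X (F (\<xi> i)) = 0" using D_const[OF X VF_zero, of 0] i by simp
    moreover have "G (F X) (\<xi> i) = (\<lambda>_. 0)" using X i by (simp add: fun_eq_iff)
    ultimately have "F (D X (\<xi> i)) = fscale (\<lambda>_. \<beta>) (F X)"
      using D_F[OF X xi_VF[OF i]] by simp
    then show ?thesis unfolding W_def using X i by simp
  qed
  then have "Pr W p = 0" using ker_F[OF W] by simp
  moreover have "Pr W = W"
  proof (rule field_eqI)
    fix Z q assume "Z \<in> VF"
    have "G W (\<xi> j) q = 0" if "j \<in> {1..s}" for j
      unfolding W_def using D_xi_xi[OF X i that] X i that by simp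
    then have "gP W Z q = G W Z q" by (simp add: gP_def)
    then show "G (Pr W) Z q = G W Z q" using W \<open>Z \<in> VF\<close> by simp
  qed (use W in auto)
  ultimately show "D X (\<xi> i) p = fscale (\<lambda>_. \<beta>) (Pr X) p" by (simp add: W_def)
qed

lemma D_xb [simp]: "X \<in> VF \<Longrightarrow> D X xb = fscale (\<lambda>_. real s * \<beta>) (Pr X)"
  unfolding xb_def
  by (subst D_sum) (auto simp: fun_eq_iff sum_apply fscale_def scaleR_fun_def)

lemma D_gP:
  assumes "X \<in> VF" "Y \<in> VF" "Z \<in> VF"
  shows "dv X (gP Y Z) p = gP (D X Y) Z p + gP Y (D X Z) p - \<beta> * gP X Y p * G Z xb p - \<beta> * G Y xb p * gP X Z p"
proof -
  have "dv X (gP Y Z) p = dv X (\<lambda>p. G Y Z p - (\<Sum>i=1..s. G Y (\<xi> i) p * G Z (\<xi> i) p)) p"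
    by (simp add: gP_def[abs_def])
  also have "\<dots> = dv X (G Y Z) p - dv X (\<lambda>p. \<Sum>i=1..s. G Y (\<xi> i) p * G Z (\<xi> i) p) p"
    using assms by (intro dv_simps(3)) (auto intro!: SF_sum SF_mult)
  also have "dv X (\<lambda>p. \<Sum>i=1..s. G Y (\<xi> i) p * G Z (\<xi> i) p) p =
      (\<Sum>i=1..s. dv X (\<lambda>p. G Y (\<xi> i) p * G Z (\<xi> i) p) p)"
    unfolding dv_def using assms by (intro tangent_sum[OF VF_tangent]) auto
  also have "\<dots> = (\<Sum>i=1..s. (G (D X Y) (\<xi> i) p * G Z (\<xi> i) p + G Y (\<xi> i) p * G (D X Z) (\<xi> i) p)
      + (\<beta> * gP X Y p * G Z (\<xi> i) p + \<beta> * G Y (\<xi> i) p * gP X Z p))"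
    by (rule sum.cong) (use assms in \<open>auto simp: D_metric algebra_simps\<close>)
  finally show ?thesis
    using assms unfolding gP_def[of "D X Y"] gP_def[of Y "D X Z"]
    by (simp add: D_metric G_xb sum.distrib sum_distrib_left sum_distrib_right mult.assoc algebra_simps)
qed

lemma D_Pr:
  assumes X: "X \<in> VF" and Y: "Y \<in> VF"
  shows "D X (Pr Y) = Pr (D X Y) - fscale (\<lambda>p. \<beta> * gP X Y p) xb - fscale (\<lambda>p. \<beta> * G Y xb p) (Pr X)"
proof (rule field_eqI)
  fix Z p assume Z: "Z \<in> VF"
  have "dv X (G (Pr Y) Z) p = dv X (gP Y Z) p" using Y Z gP_fun by metis
  then show "G (D X (Pr Y)) Z p =
      G (Pr (D X Y) - fscale (\<lambda>p. \<beta> * gP X Y p) xb - fscale (\<lambda>p. \<beta> * G Y xb p) (Pr X)) Z p"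
    using X Y Z G_commute[of xb Z p] by (simp add: D_metric D_gP)
qed (use assms in auto)

lemma D_gF:
  assumes "X \<in> VF" "Y \<in> VF" "Z \<in> VF"
  shows "dv X (gF Y Z) p = gF (D X Y) Z p + gF Y (D X Z) p - \<beta> * gF X Y p * G Z xb p - \<beta> * G Y xb p * gF X Z p"
  using assms gF_commute[of X Y p] unfolding gF_def by (simp add: D_metric D_F)

end

context kenmotsu
begin

subsection \<open>Curvature\<close>

lemma Tr_G: "Tr p (\<lambda>Z. G Z Z p) = 2 * real n + real s"
  by (simp add: Tr_id dim)

lemma Tr_gP: "Tr p (\<lambda>Z. gP Z Z p) = 2 * real n"
proof -
  have "Tr p (\<lambda>Z. G Z (\<xi> i) p * G Z (\<xi> i) p) = 1" if "i \<in> {1..s}" for i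
    using Tr_GG[of "\<xi> i" "\<xi> i" p] that by simp
  then show ?thesis by (simp add: gP_def Tr_G Tr_sum)
qed

lemma Tr_gPG: "X \<in> VF \<Longrightarrow> Y \<in> VF \<Longrightarrow> Tr p (\<lambda>Z. gP Z X p * G Z Y p) = gP X Y p"
  using Tr_GG[of "Pr X" Y p] Tr_cong[of "\<lambda>Z. gP Z X p * G Z Y p" "\<lambda>Z. G Z (Pr X) p * G Z Y p" p]
  by (simp add: gP_commute)

lemma Tr_F: "Tr p (\<lambda>Z. G (F Z) Z p) = 0"
proof -
  have "G (F Z) Z p = 0" if "Z \<in> VF" for Z
    using F_skew[OF that that, of p] G_commute[of "F Z" Z p] that by simp
  then have "Tr p (\<lambda>Z. G (F Z) Z p) = Tr p (\<lambda>_. 0)" by (rule Tr_cong)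
  then show ?thesis by simp
qed

lemma curvature_xi:
  assumes X: "X \<in> VF" and Y: "Y \<in> VF" and i: "i \<in> {1..s}"
  shows "R X Y (\<xi> i) = fscale (\<lambda>p. \<beta>\<^sup>2 * G X xb p) (Pr Y) - fscale (\<lambda>p. \<beta>\<^sup>2 * G Y xb p) (Pr X)"
proof (rule field_eqI)
  fix Z p assume Z: "Z \<in> VF"
  show "G (R X Y (\<xi> i)) Z p =
      G (fscale (\<lambda>p. \<beta>\<^sup>2 * G X xb p) (Pr Y) - fscale (\<lambda>p. \<beta>\<^sup>2 * G Y xb p) (Pr X)) Z p"
    using X Y Z i gP_commute[OF Y X, of p]
    by (simp add: curvature_def D_Pr torsion_free power2_eq_square algebra_simps)
qed (use X Y i in auto)

lemma G_curvature_xi: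
  assumes "X \<in> VF" "Y \<in> VF" "W \<in> VF" "i \<in> {1..s}"
  shows "G (R X Y (\<xi> i)) W p = \<beta>\<^sup>2 * (G X xb p * gP Y W p - G Y xb p * gP X W p)"
  using assms by (simp add: curvature_xi algebra_simps)

lemma ricci_xi:
  assumes X: "X \<in> VF" and i: "i \<in> {1..s}"
  shows "Ric X (\<xi> i) p = - 2 * real n * \<beta>\<^sup>2 * G X xb p"
proof -
  have "Ric X (\<xi> i) p = Tr p (\<lambda>Z. \<beta>\<^sup>2 * (gP Z X p * G Z xb p) - \<beta>\<^sup>2 * G X xb p * gP Z Z p)"
    unfolding ricci_Tr[OF X xi_VF[OF i]]
    by (rule Tr_cong) (use X i gP_commute[of X] in \<open>simp add: G_curvature_xi algebra_simps\<close>)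
  also have "\<dots> = - 2 * real n * \<beta>\<^sup>2 * G X xb p"
    using X by (simp add: Tr_gP Tr_gPG)
  finally show ?thesis .
qed

text \<open>Commutes two covariant derivatives past F with the defining relation; the corrections
  come from the derivatives of \<open>xb\<close>.\<close>

lemma curvature_F:
  assumes X: "X \<in> VF" and Y: "Y \<in> VF" and Z: "Z \<in> VF" and W: "W \<in> VF"
  shows "G (R X Y (F Z)) W p = G (F (R X Y Z)) W p + \<beta>\<^sup>2 *
    (- G Y xb p * G (F X) Z p * G W xb p + G X xb p * G (F Y) Z p * G W xb p
     + s * G (F Y) Z p * gP X W p - s * G (F X) Z p * gP Y W p
     - s * gP X Z p * G (F Y) W p + s * gP Y Z p * G (F X) W p
     + G Z xb p * G Y xb p * G (F X) W p - G Z xb p * G X xb p * G (F Y) W p)"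
proof -
  have sk: "G (F Y) X p = - G (F X) Y p"
    using F_skew[OF Y X, of p] G_commute[of Y "F X" p] X Y by simp
  show ?thesis
    using X Y Z W sk G_commute[OF xb_VF W, of p] G_commute[OF xb_VF Z, of p] gP_commute[of Z X p] gP_commute[of Z Y p]
    by (simp add: curvature_def D_F D_metric torsion_free power2_eq_square algebra_simps)
qed

subsection \<open>The star-Ricci tensor\<close>

text \<open>Bianchi splits R(X, W) F Z into two terms, and pair symmetry and skewness of F give both
  the same trace.\<close>

lemma Tr_curvature_F:
  assumes X: "X \<in> VF" and W: "W \<in> VF"
  shows "Tr p (\<lambda>Z. G (R X W (F Z)) Z p) = - 2 * Tr p (\<lambda>Z. G (F (R Z X W)) Z p)"
proof -
  have "Tr p (\<lambda>Z. G (R X W (F Z)) Z p)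
      = Tr p (\<lambda>Z. - G (F (R Z X W)) Z p - G (R (F Z) X W) Z p)"
  proof (rule Tr_cong)
    fix Z assume Z: "Z \<in> VF"
    have FZ: "F Z \<in> VF" using Z by simp
    have "G (R W (F Z) X) Z p = G (R X Z W) (F Z) p"
      using curvature_pair_symmetry[OF W FZ X Z] .
    also have "\<dots> = - G (R Z X W) (F Z) p"
      using curvature_skew[OF Z X W] X Z W by simp
    also have "\<dots> = G (F (R Z X W)) Z p"
      using F_skew[of "R Z X W" Z p] X Z W by simp
    finally show "G (R X W (F Z)) Z p = - G (F (R Z X W)) Z p - G (R (F Z) X W) Z p"
      using G_bianchi[OF X W FZ Z, of p] by simp
  qed
  also have "\<dots> = - Tr p (\<lambda>Z. G (F (R Z X W)) Z p) - Tr p (\<lambda>Z. G (R (F Z) X W) Z p)" by simp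
  also have "Tr p (\<lambda>Z. G (R (F Z) X W) Z p) = - Tr p (\<lambda>Z. G (R Z X W) (F Z) p)"
    by (rule Tr_skew[OF curvature_tensorial(1)[OF X W] F_tensorial F_skew])
  also have "Tr p (\<lambda>Z. G (R Z X W) (F Z) p) = Tr p (\<lambda>Z. - G (F (R Z X W)) Z p)"
    by (rule Tr_cong) (use F_skew X W in simp)
  finally show ?thesis by simp
qed

text \<open>With W = F Y, \<open>Tr_curvature_F\<close> brings F outside the curvature and
  \<open>curvature_F\<close> moves it onto W. The main term is then -Ric(X, F(F Y)), which F(F Y) =
  -Q Y plus vertical terms turns into Ric(X, Q Y).\<close>

lemma star_ricci_eq:
  assumes X: "X \<in> VF" and Y: "Y \<in> VF"
  shows "star_ricci A D f X Y p =
    Ric X (QQ Y) p + s * (2 * real n - 1) * \<beta>\<^sup>2 * gF X Y p + 2 * real n * \<beta>\<^sup>2 * G X xb p * G Y xb p"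
proof -
  define W where "W = F Y"
  have W: "W \<in> VF" "G W xb p = 0" unfolding W_def using Y by auto
  have t: "tensorial_op (\<lambda>Z. R X W (F Z))"
    unfolding tensorial_op_def using X W by (simp add: curvature_add curvature_fscale)
  have "star_ricci A D f X Y p = Tr p (\<lambda>Z. G (R X W (F Z)) Z p) / 2"
    unfolding star_ricci_def using trace_at_Tr[OF t] by (simp add: W_def F_def)
  also have "\<dots> = - Tr p (\<lambda>Z. G (F (R Z X W)) Z p)"
    by (simp add: Tr_curvature_F[OF X W(1)])
  \<comment> \<open>Each correction is shaped as a constant times a product of two factors linear in
    Z, ready for contraction.\<close>
  also have "\<dots> = - Tr p (\<lambda>Z. G (R Z X (F W)) Z p - \<beta>\<^sup>2 *
    ((- G X xb p) * (G Z (- F W) p * G Z xb p) + (G Z xb p * G Z xb p) * gF X Y p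
     + s * gF X Y p * gP Z Z p - s * (G Z (- F W) p * G Z (Pr X) p)
     - s * (G Z W p * G Z (F X) p) + s * gP X W p * G (F Z) Z p))" (is "_ = - Tr p ?H")
  proof (rule arg_cong[where f = uminus], rule Tr_cong)
    fix Z assume Z: "Z \<in> VF"
    have "G (F Z) W p = G Z (- F W) p" "gP Z W p = G Z W p"
      "G Z (F X) p = G (F X) Z p" "gF X Y p = G (F X) W p" "gP X Z p = G Z (Pr X) p"
      using F_skew[OF Z W(1), of p] Z X Y G_commute[of Z "F X" p] by (simp_all add: W_def gF_def)
    then show "G (F (R Z X W)) Z p = ?H Z"
      unfolding curvature_F[OF Z X W(1) Z] W(2) by (simp add: algebra_simps del: G_Pr)
  qed
  also have "\<dots> = - Ric X (F W) p + \<beta>\<^sup>2 * (s * gF X Y p + s * gF X Y p * (2 * real n)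
      - s * gF X Y p - s * gF X Y p)"
  proof -
    have "G (F X) W p = gF X Y p" by (simp add: gF_def W_def)
    then have 1: "Tr p (\<lambda>Z. G Z (- F W) p * G Z (Pr X) p) = gF X Y p"
        "Tr p (\<lambda>Z. G Z W p * G Z (F X) p) = gF X Y p"
      using W(1) X F_skew[OF X W(1), of p] G_commute[of W "F X" p] by (simp_all add: Tr_GG)
    have 2: "Tr p (\<lambda>Z. G Z (- F W) p * G Z xb p) = 0" "Tr p (\<lambda>Z. G Z xb p * G Z xb p) = real s"
      using W(1) by (simp_all add: Tr_GG)
    show ?thesis
      using X W by (simp add: 1 2 Tr_gP Tr_F ricci_Tr)
  qed
  also have "Ric X (F W) p = - Ric X (QQ Y) p - 2 * real n * \<beta>\<^sup>2 * G X xb p * G Y xb p"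
  proof -
    define S where "S = (\<Sum>i=1..s. fscale (G Y (\<xi> i)) (\<xi> i))"
    have S: "S \<in> VF" unfolding S_def using Y by (intro VF_sum VF_fscale) auto
    note t = ricci_tensorial[OF X]
    have "Ric X (F W) p = Ric X (fscale (\<lambda>_. -1) (QQ Y)) p + Ric X S p"
      unfolding W_def FF[OF Y] S_def[symmetric] minus_fscale
      using t S VF_fscale[OF SF_const Q_simps(1)[OF Y]] unfolding tensorial_def by blast
    also have "Ric X (fscale (\<lambda>_. -1) (QQ Y)) p = - Ric X (QQ Y) p"
      using t Y unfolding tensorial_def by simp
    also have "Ric X S p = (\<Sum>i=1..s. G Y (\<xi> i) p * Ric X (\<xi> i) p)"
      unfolding S_def by (rule tensorial_sum[OF t]) (use Y in auto)
    also have "(\<Sum>i=1..s. G Y (\<xi> i) p * Ric X (\<xi> i) p) = (\<Sum>i=1..s. G Y (\<xi> i) p * (- 2 * real n * \<beta>\<^sup>2 * G X xb p))"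
      by (rule sum.cong) (use X ricci_xi in auto)
    also have "\<dots> = - 2 * real n * \<beta>\<^sup>2 * G X xb p * G Y xb p"
      unfolding G_xb[OF Y] sum_distrib_right[symmetric] by simp
    finally show ?thesis by simp
  qed
  finally show ?thesis by (simp add: algebra_simps)
qed

subsection \<open>Lie derivatives along the structure fields\<close>

lemma lie_conn_xi:
  assumes X: "X \<in> VF" and Y: "Y \<in> VF" and i: "i \<in> {1..s}"
  shows "lie_conn (\<xi> i) X Y = fscale (\<lambda>p. - 2 * \<beta>\<^sup>2 * gP X Y p) xb"
proof (rule field_eqI)
  fix Z p assume Z: "Z \<in> VF"
  have "G (R (\<xi> i) X Y) Z p = G (R Y Z (\<xi> i)) X p"
    by (rule curvature_pair_symmetry) (use X Y Z i in auto)
  also have "\<dots> = \<beta>\<^sup>2 * (G Y xb p * gP X Z p - G Z xb p * gP X Y p)"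
    using G_curvature_xi[OF Y Z X i] gP_commute[OF Z X] gP_commute[OF Y X] by simp
  finally show "G (lie_conn (\<xi> i) X Y) Z p = G (fscale (\<lambda>p. - 2 * \<beta>\<^sup>2 * gP X Y p) xb) Z p"
    using X Y Z i G_commute[OF xb_VF Z, of p]
    by (simp add: lie_conn_curvature D_Pr power2_eq_square algebra_simps)
qed (use X Y i in auto)

lemma lie_ricci_xi:
  assumes X: "X \<in> VF" and Y: "Y \<in> VF" and i: "i \<in> {1..s}"
  shows "dv (\<xi> i) (Ric X Y) p = Ric (br (\<xi> i) X) Y p + Ric X (br (\<xi> i) Y) p
    - 4 * real n * real s * \<beta> ^ 3 * gP X Y p"
proof -
  have "Tr p (\<lambda>Z. G (lie_curv (\<xi> i) Z X Y) Z p) =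
    Tr p (\<lambda>Z. - 2 * \<beta> ^ 3 * ((- G X xb p) * (gP Z Y p * G Z xb p) + gP X Y p * (G Z xb p * G Z xb p)
      + s * gP X Y p * gP Z Z p - s * (gP Z Y p * G Z (Pr X) p)))" (is "Tr p ?L = Tr p ?H")
  proof (rule Tr_cong)
    fix Z assume Z: "Z \<in> VF"
    show "?L Z = ?H Z"
      using X Y Z i gP_commute[OF X, of Z p] G_commute[OF xb_VF, of Z p]
      by (simp add: lie_curv_def lie_conn_xi D_gP torsion_free power2_eq_square power3_eq_cube algebra_simps)
  qed
  also have "\<dots> = - 4 * real n * real s * \<beta> ^ 3 * gP X Y p"
    using X Y gP_commute[of Y X p] by (simp add: Tr_gPG Tr_GG Tr_gP del: G_Pr)
  finally show ?thesis using lie_ricci[OF xi_VF[OF i] X Y, of p] by simp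
qed

text \<open>The trace of \<open>gP\<close> is 2n > 0. The positivity of \<open>gF\<close> comes from
  \<open>ker_F\<close>. Used to cancel the tensors in scalar identities.\<close>

lemma exists_horizontal:
  obtains X where "X \<in> VF" "gP X X p \<noteq> 0" "gF X X p > 0"
proof -
  have "\<exists>X\<in>VF. gP X X p \<noteq> 0"
  proof (rule ccontr)
    assume "\<not> ?thesis"
    then have "Tr p (\<lambda>Z. gP Z Z p) = Tr p (\<lambda>_. 0)" by (intro Tr_cong) auto
    then show False using Tr_gP[of p] n by simp
  qed
  then obtain X where X: "X \<in> VF" "gP X X p \<noteq> 0" by blast
  have "F X p \<noteq> 0"
  proof
    assume "F X p = 0"
    then have "Pr X p = 0" by (rule ker_F[OF X(1)])
    then have "G (Pr X) X p = G 0 X p" by (simp add: G_def)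
    then show False using X by simp
  qed
  then have "gF X X p > 0" unfolding gF_def using G_pos X(1) by simp
  then show ?thesis using that X by blast
qed

lemma lie_gP_xi:
  assumes "X \<in> VF" "Y \<in> VF" "i \<in> {1..s}"
  shows "dv (\<xi> i) (gP X Y) p = gP (br (\<xi> i) X) Y p + gP X (br (\<xi> i) Y) p + 2 * \<beta> * gP X Y p"
  using assms gP_commute[OF assms(2,1), of p] by (simp add: D_gP torsion_free algebra_simps)

lemma lie_eta_xi:
  assumes "X \<in> VF" "i \<in> {1..s}"
  shows "dv (\<xi> i) (G X xb) p = G (br (\<xi> i) X) xb p"
  using assms by (simp add: D_metric torsion_free)

end

section \<open>Eta-Einstein manifolds\<close>

locale eta_einstein_kenmotsu = kenmotsu +
  fixes a b
  assumes ee: "eta_einstein A s \<eta> g D a b"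
begin

lemma ab_SF [simp]: "a \<in> SF" "b \<in> SF"
  using ee unfolding eta_einstein_def by auto

lemma ricci_ab:
  assumes "X \<in> VF" "Y \<in> VF"
  shows "Ric X Y p = a p * gP X Y p + (a p + b p) * (G X xb p * G Y xb p)"
proof -
  have "(\<Sum>i=1..s. \<eta> i p (X p) * \<eta> i p (Y p)) = (\<Sum>i=1..s. G X (\<xi> i) p * G Y (\<xi> i) p)"
    by (rule sum.cong) (use assms eta_G in auto)
  then show ?thesis
    using ee assms unfolding eta_einstein_def
    by (simp add: eta_bar_G gP_def G_def[of X Y] right_diff_distrib)
qed

lemma ab: "a p + b p = - 2 * real n * \<beta>\<^sup>2"
proof -
  have 1: "1 \<in> {1..s}" using s by simp
  have "Ric (\<xi> 1) (\<xi> 1) p = - 2 * real n * \<beta>\<^sup>2"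
    using ricci_xi[OF xi_VF[OF 1] 1, of p] 1 by simp
  then show ?thesis using ricci_ab[OF xi_VF[OF 1] xi_VF[OF 1], of p] 1 by simp
qed

lemma ricci_a:
  assumes "X \<in> VF" "Y \<in> VF"
  shows "Ric X Y = (\<lambda>p. a p * gP X Y p - 2 * real n * \<beta>\<^sup>2 * (G X xb p * G Y xb p))"
  using ricci_ab[OF assms] by (simp add: ab fun_eq_iff)

text \<open>Along \<open>\<xi> i\<close> the Lie derivative of \<open>gP\<close> is 2\<beta>
  \<open>gP\<close> and that of \<open>G _ xb\<close> is 0, so comparison with
  \<open>lie_ricci_xi\<close> leaves an identity of multiples of \<open>gP\<close>.\<close>

lemma a_derivative_xi:
  assumes i: "i \<in> {1..s}"
  shows "dv (\<xi> i) a p = - 2 * \<beta> * (a p + 2 * real s * real n * \<beta>\<^sup>2)"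
proof -
  obtain X where X: "X \<in> VF" "gP X X p \<noteq> 0" using exists_horizontal by blast
  have "dv (\<xi> i) (Ric X X) p = dv (\<xi> i) a p * gP X X p + a p * dv (\<xi> i) (gP X X) p
      - 2 * real n * \<beta>\<^sup>2 * (dv (\<xi> i) (G X xb) p * G X xb p + G X xb p * dv (\<xi> i) (G X xb) p)"
    using X i by (simp add: ricci_a del: D_metric)
  then have "dv (\<xi> i) a p * gP X X p = - 2 * \<beta> * (a p + 2 * real s * real n * \<beta>\<^sup>2) * gP X X p"
    using X i lie_ricci_xi[OF X(1) X(1) i, of p]
    by (simp add: ricci_a lie_gP_xi lie_eta_xi power2_eq_square power3_eq_cube algebra_simps)
  then show ?thesis using mult_right_cancel[OF X(2)] by blast
qed

text \<open>Q preserves the components along the structure fields, so \<open>gP X (QQ Y)\<close> is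
  \<open>gF X Y\<close>; the vertical parts of \<open>star_ricci_eq\<close> and of Ric
  cancel.\<close>

lemma star_ricci_a:
  assumes X: "X \<in> VF" and Y: "Y \<in> VF"
  shows "star_ricci A D f X Y p = (a p + s * (2 * real n - 1) * \<beta>\<^sup>2) * gF X Y p"
proof -
  have "G (QQ Y) (\<xi> i) p = G Y (\<xi> i) p" if "i \<in> {1..s}" for i p
  proof -
    have "0 = G (\<xi> i) (QQ Y) p - (\<Sum>j=1..s. G (\<xi> i) (\<xi> j) p * G Y (\<xi> j) p)"
      using FF_metric[OF xi_VF[OF that] Y, of p] that Y by simp
    also have "(\<Sum>j=1..s. G (\<xi> i) (\<xi> j) p * G Y (\<xi> j) p) = (\<Sum>j=1..s. G Y (\<xi> j) p * (if i = j then 1 else 0))"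
      by (rule sum.cong) (use that in auto)
    also have "\<dots> = G Y (\<xi> i) p" using that by (rule sum_delta_xi)
    finally show ?thesis using that Y G_commute[of "QQ Y" "\<xi> i" p] by simp
  qed
  then have "gP X (QQ Y) p = gF X Y p" "G (QQ Y) xb p = G Y xb p"
    using FF_metric[OF X Y, of p] X Y by (simp_all add: gP_def gF_def G_xb)
  then show ?thesis
    using X Y by (simp add: star_ricci_eq ricci_a algebra_simps)
qed

lemma scalar_curvature_a:
  "scalar_curvature A g D p = 2 * real n * a p - 2 * real n * real s * \<beta>\<^sup>2"
proof -
  have "scalar_curvature A g D p = Tr p (\<lambda>X. a p * gP X X p - 2 * real n * \<beta>\<^sup>2 * (G X xb p * G X xb p))"
    unfolding scalar_curvature_Tr by (rule Tr_cong) (simp add: ricci_a)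
  then show ?thesis by (simp add: Tr_gP Tr_GG)
qed

lemma einstein_if:
  assumes "\<And>p. a p = - 2 * real s * real n * \<beta>\<^sup>2" "s = 1"
  shows "einstein A g D"
proof -
  have "Ric X Y p = (- 2 * real n * \<beta>\<^sup>2) * g p (X p) (Y p)" if "X \<in> VF" "Y \<in> VF" for X Y p
  proof -
    have "(\<Sum>i=1..s. h i) = h 1" for h :: "nat \<Rightarrow> real" using assms(2) by simp
    then have G: "G X Y p = gP X Y p + G X xb p * G Y xb p"
      by (simp add: gP_def G_xb[OF that(1)] G_xb[OF that(2)])
    have "a p = - 2 * real n * \<beta>\<^sup>2" using assms by simp
    then show ?thesis
      using that G by (simp add: ricci_a G_def[of X Y, symmetric] algebra_simps)
  qed
  then show ?thesis unfolding einstein_def by blast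
qed

end

subsection \<open>Solitons\<close>

context riemannian
begin

lemma lie_deriv_G: "lie_deriv W g X Y = (\<lambda>p. dv W (G X Y) p - G (br W X) Y p - G X (br W Y) p)"
  by (simp add: fun_eq_iff lie_deriv_def G_def[abs_def] dv_def)

lemma lie_deriv_D:
  "W \<in> VF \<Longrightarrow> X \<in> VF \<Longrightarrow> Y \<in> VF \<Longrightarrow> lie_deriv W g X Y p = G (D X W) Y p + G X (D Y W) p"
  by (simp add: lie_deriv_G D_metric torsion_free)

text \<open>The Lie derivative along a bracket is the commutator of Lie derivatives; the Jacobi
  identity handles the arguments.\<close>

lemma lie_deriv_bracket:
  assumes "W \<in> VF" "V \<in> VF" "X \<in> VF" "Y \<in> VF"
  shows "lie_deriv (br W V) g X Y p =
    (dv W (lie_deriv V g X Y) p - lie_deriv V g (br W X) Y p - lie_deriv V g X (br W Y) p) -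
    (dv V (lie_deriv W g X Y) p - lie_deriv W g (br V X) Y p - lie_deriv W g X (br V Y) p)"
proof -
  have "br (br W V) Z = br W (br V Z) - br V (br W Z)" if "Z \<in> VF" for Z
    using jacobi[of W V Z] that assms by (simp del: plus_fun_apply)
  then show ?thesis using assms by (simp add: lie_deriv_G dv_bracket)
qed

lemma dv_cong_at: "X p = Y p \<Longrightarrow> dv X h p = dv Y h p"
  by (simp add: dv_def)

text \<open>Differentiates an identity that holds where \<open>h\<close> does not vanish, without a neighbourhood.\<close>

lemma dv_where_nonzero:
  assumes "X \<in> VF" "h \<in> SF" "E \<in> SF" and z: "\<And>q. h q \<noteq> 0 \<Longrightarrow> E q = 0" and "h p \<noteq> 0"
  shows "dv X E p = 0"
proof -
  have "(\<lambda>q. h q * E q) = (\<lambda>_. 0)" using z by (auto simp: fun_eq_iff)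
  then have "dv X (\<lambda>q. h q * E q) p = 0" using assms(1) by simp
  then show ?thesis using assms by simp
qed

end

context kenmotsu
begin

text \<open>The one-forms are closed, since D \<xi> = \<beta> P is symmetric. By Cartan's formula
  their Lie derivative along W is the differential of their value on W.\<close>

lemma lie_gP:
  assumes "W \<in> VF" "X \<in> VF" "Y \<in> VF"
  shows "dv W (gP X Y) p - gP (br W X) Y p - gP X (br W Y) p = lie_deriv W g X Y p -
    (\<Sum>j=1..s. dv X (G W (\<xi> j)) p * G Y (\<xi> j) p + G X (\<xi> j) p * dv Y (G W (\<xi> j)) p)"
proof -
  have "(\<Sum>j=1..s. dv X (G W (\<xi> j)) p * G Y (\<xi> j) p + G X (\<xi> j) p * dv Y (G W (\<xi> j)) p) =
    (\<Sum>j=1..s. (G (D X W) (\<xi> j) p * G Y (\<xi> j) p + G X (\<xi> j) p * G (D Y W) (\<xi> j) p) +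
      (\<beta> * gP X W p * G Y (\<xi> j) p + \<beta> * gP Y W p * G X (\<xi> j) p))"
    by (rule sum.cong) (use assms in \<open>auto simp: D_metric algebra_simps\<close>)
  then show ?thesis
    using assms gP_commute[of W X p] gP_commute[of W Y p]
    by (simp add: D_gP lie_deriv_D torsion_free)
      (simp add: gP_def[of "D X W" Y] gP_def[of X "D Y W"] G_xb sum.distrib sum_distrib_left
        sum_distrib_right algebra_simps)
qed

section \<open>The self-adjoint operator representing gF, and its trace\<close>

definition "K X = - F (F X)"
definition "\<tau> p = Tr p (\<lambda>Z. gF Z Z p)"

lemma K_VF [simp]: "X \<in> VF \<Longrightarrow> K X \<in> VF"
  unfolding K_def by simp

lemma G_K [simp]: "X \<in> VF \<Longrightarrow> Y \<in> VF \<Longrightarrow> G (K X) Y p = gF X Y p"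
  unfolding K_def gF_def using F_skew[of "F X" Y p] by simp

lemma K_tensorial: "tensorial_op K"
  unfolding tensorial_op_def
  by (intro conjI ballI; (rule field_eqI)?) (simp_all add: gF_def)

lemma D_K:
  assumes X: "X \<in> VF" and Y: "Y \<in> VF"
  shows "D X (K Y) = K (D X Y) - fscale (\<lambda>p. \<beta> * gF X Y p) xb - fscale (\<lambda>p. \<beta> * G Y xb p) (K X)"
proof (rule field_eqI)
  fix Z p assume Z: "Z \<in> VF"
  have "dv X (G (K Y) Z) p = dv X (gF Y Z) p"
    using Y Z by (intro arg_cong[where f = "\<lambda>h. dv X h p"]) (simp add: fun_eq_iff)
  then show "G (D X (K Y)) Z p =
      G (K (D X Y) - fscale (\<lambda>p. \<beta> * gF X Y p) xb - fscale (\<lambda>p. \<beta> * G Y xb p) (K X)) Z p"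
    using X Y Z G_commute[of xb Z p] by (simp add: D_metric D_gF)
qed (use X Y in auto)

lemma tau_trace: "\<tau> = trace_at A K"
proof
  fix p
  have "\<tau> p = Tr p (\<lambda>Z. G (K Z) Z p)" unfolding \<tau>_def by (rule Tr_cong) simp
  then show "\<tau> p = trace_at A K p" using trace_at_Tr[OF K_tensorial] by simp
qed

lemma tau_SF [simp]: "\<tau> \<in> SF"
  unfolding tau_trace by (rule trace_at_smooth[OF K_tensorial])

lemma Tr_G_K: "X \<in> VF \<Longrightarrow> Y \<in> VF \<Longrightarrow> Tr p (\<lambda>Z. gF Z X p * G Z Y p) = gF X Y p"
  using Tr_GG[of "K X" Y p] Tr_cong[of "\<lambda>Z. gF Z X p * G Z Y p" "\<lambda>Z. G Z (K X) p * G Z Y p" p]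
  by (simp add: G_commute[of _ "K X"] gF_commute)

text \<open>The covariant derivative of K has only terms mixing horizontal and vertical directions,
  so its trace is a multiple of \<open>gF X xb\<close>, which is 0.\<close>

lemma dv_tau: "X \<in> VF \<Longrightarrow> dv X \<tau> p = 0"
proof -
  assume X: "X \<in> VF"
  have "dv X \<tau> p = trace_at A (\<lambda>Z. D X (K Z) - K (D X Z)) p"
    unfolding tau_trace dv_def by (rule trace_at_derivative[OF D_derivation[OF X] K_tensorial X])
  also have "\<dots> = Tr p (\<lambda>Z. G (D X (K Z) - K (D X Z)) Z p)"
    by (rule trace_at_Tr[OF derivation_over_commutator[OF D_derivation[OF X] K_tensorial X]])
  also have "\<dots> = Tr p (\<lambda>Z. (- 2 * \<beta>) * (gF Z X p * G Z xb p))"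
    by (rule Tr_cong) (use X gF_commute[OF X] G_commute[OF xb_VF] in \<open>simp add: D_K algebra_simps\<close>)
  finally show ?thesis using X by (simp add: Tr_G_K)
qed

end

section \<open>The vertical components of the soliton field\<close>

locale soliton = eta_einstein_kenmotsu +
  fixes V and lam mu :: real
  assumes sol: "star_eta_ricci_soliton A s f \<eta> g D V lam mu"
begin

definition "\<kappa> \<equiv> lam + mu"
definition "c p = a p + s * (2 * real n - 1) * \<beta>\<^sup>2"
definition "u i = G V (\<xi> i)"
text \<open>The gradient of \<open>u i\<close>, by \<open>U_grad\<close>. On a pair (X,
  \<open>\<xi> i\<close>) only the \<kappa> term of the soliton equation survives, which gives the
  field \<open>2 * \<kappa>\<close> times \<open>xb\<close> and the bracket.\<close>

definition "U i = fscale (\<lambda>_. 2 * \<kappa>) xb - br (\<xi> i) V"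

lemma V_VF [simp]: "V \<in> VF"
  using sol unfolding star_eta_ricci_soliton_def by blast

lemma c_SF [simp]: "c \<in> SF"
  unfolding c_def[abs_def] by simp

lemma dv_c [simp]: "X \<in> VF \<Longrightarrow> dv X c p = dv X a p"
  unfolding c_def[abs_def] by simp

lemma u_SF [simp]: "i \<in> {1..s} \<Longrightarrow> u i \<in> SF"
  unfolding u_def by simp

lemma U_VF [simp]: "i \<in> {1..s} \<Longrightarrow> U i \<in> VF"
  unfolding U_def by (intro VF_diff VF_fscale VF_bracket SF_const) auto

lemma lie_V:
  assumes "X \<in> VF" "Y \<in> VF"
  shows "lie_deriv V g X Y = (\<lambda>p. 2 * (lam * gP X Y p + \<kappa> * (G X xb p * G Y xb p) - c p * gF X Y p))"
proof
  fix p
  have "(\<Sum>i=1..s. \<eta> i p (X p) * \<eta> i p (Y p)) = (\<Sum>i=1..s. G X (\<xi> i) p * G Y (\<xi> i) p)"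
    by (rule sum.cong) (use assms eta_G in auto)
  moreover have "lie_deriv V g X Y p / 2 + star_ricci A D f X Y p =
         lam * (g p (X p) (Y p) - (\<Sum>i=1..s. \<eta> i p (X p) * \<eta> i p (Y p)))
         + (lam + mu) * (eta_bar s \<eta> p (X p) * eta_bar s \<eta> p (Y p))"
    using sol assms unfolding star_eta_ricci_soliton_def by blast
  ultimately show "lie_deriv V g X Y p = 2 * (lam * gP X Y p + \<kappa> * (G X xb p * G Y xb p) - c p * gF X Y p)"
    using assms by (simp add: star_ricci_a eta_bar_G gP_def G_def[of X Y] \<kappa>_def c_def)
qed

lemma U_grad:
  assumes X: "X \<in> VF" and i: "i \<in> {1..s}"
  shows "G (U i) X = dv X (u i)"
proof
  fix p
  have "G (D X V) (\<xi> i) p + G X (D (\<xi> i) V) p = 2 * \<kappa> * G X xb p"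
    using fun_cong[OF lie_V[OF X xi_VF[OF i]], of p] X i by (simp add: lie_deriv_D)
  moreover have "dv X (u i) p = G (D X V) (\<xi> i) p + \<beta> * gP X V p"
    unfolding u_def using X i by (simp add: D_metric)
  ultimately show "G (U i) X p = dv X (u i) p"
    unfolding U_def using X i G_commute[OF xb_VF X, of p] G_commute[of "D (\<xi> i) V" X p] gP_commute[of X V p]
    by (simp add: torsion_free algebra_simps)
qed

lemma D_U_sym:
  assumes X: "X \<in> VF" and Y: "Y \<in> VF" and i: "i \<in> {1..s}"
  shows "G (D X (U i)) Y p = G (D Y (U i)) X p"
proof -
  have g: "G (D X (U i)) Y p = dv X (dv Y (u i)) p - dv (D X Y) (u i) p"
    if X: "X \<in> VF" and Y: "Y \<in> VF" for X Y
  proof -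
    have "dv X (dv Y (u i)) p = dv X (G (U i) Y) p" using U_grad[OF Y i] by simp
    then show ?thesis using X Y i U_grad[of "D X Y" i] by (simp add: D_metric)
  qed
  have "dv (D X Y) (u i) p - dv (D Y X) (u i) p = dv X (dv Y (u i)) p - dv Y (dv X (u i)) p"
    using X Y dv_bracket[of X Y "u i" p] by (simp add: torsion_free)
  then show ?thesis using g[OF X Y] g[OF Y X] by simp
qed

text \<open>The Lie derivative of g along a gradient is twice the Hessian, and \<open>U i\<close> is
  a multiple of \<open>xb\<close> minus \<open>[\<xi> i, V]\<close>. In the commutator of Lie
  derivatives, \<open>lie_gP\<close> applied to V produces the mixed terms in the differentials of
  the \<open>u j\<close>.\<close>

lemma Hess:
  assumes X: "X \<in> VF" and Y: "Y \<in> VF" and i: "i \<in> {1..s}"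
  shows "G (D X (U i)) Y p = 2 * s * \<beta> * \<kappa> * gP X Y p + dv (\<xi> i) a p * gF X Y p
    + 2 * \<beta> * \<kappa> * G X xb p * G Y xb p
    - \<beta> * (\<Sum>j=1..s. dv X (u j) p * G Y (\<xi> j) p + G X (\<xi> j) p * dv Y (u j) p)"
proof -
  have lx: "lie_deriv (\<xi> i) g X Y = (\<lambda>p. 2 * \<beta> * gP X Y p)" if "X \<in> VF" "Y \<in> VF" for X Y
    using that i gP_commute[of X Y] by (simp add: fun_eq_iff lie_deriv_D)
  have gF: "dv (\<xi> i) (gF X Y) p = gF (br (\<xi> i) X) Y p + gF X (br (\<xi> i) Y) p + 2 * \<beta> * gF X Y p"
    using X Y i by (simp add: D_gF torsion_free algebra_simps)
  have 1: "dv (\<xi> i) (lie_deriv V g X Y) p - lie_deriv V g (br (\<xi> i) X) Y p - lie_deriv V g X (br (\<xi> i) Y) p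
      = 2 * (2 * \<beta> * lam * gP X Y p - dv (\<xi> i) a p * gF X Y p - 2 * \<beta> * c p * gF X Y p)"
    using X Y i by (simp add: lie_V lie_gP_xi lie_eta_xi gF algebra_simps)
  have 2: "dv V (lie_deriv (\<xi> i) g X Y) p - lie_deriv (\<xi> i) g (br V X) Y p - lie_deriv (\<xi> i) g X (br V Y) p
      = 2 * \<beta> * (lie_deriv V g X Y p -
        (\<Sum>j=1..s. dv X (u j) p * G Y (\<xi> j) p + G X (\<xi> j) p * dv Y (u j) p))"
  proof -
    have "dv V (lie_deriv (\<xi> i) g X Y) p - lie_deriv (\<xi> i) g (br V X) Y p - lie_deriv (\<xi> i) g X (br V Y) p
      = 2 * \<beta> * (dv V (gP X Y) p - gP (br V X) Y p - gP X (br V Y) p)"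
      using X Y i by (simp add: lx algebra_simps)
    then show ?thesis by (simp only: lie_gP[OF V_VF X Y] u_def)
  qed
  have "2 * G (D X (U i)) Y p = lie_deriv (U i) g X Y p"
    using D_U_sym[OF X Y i, of p] X Y i G_commute[of X "D Y (U i)" p] by (simp add: lie_deriv_D)
  also have "\<dots> = 4 * s * \<beta> * \<kappa> * gP X Y p - lie_deriv (br (\<xi> i) V) g X Y p"
    using X Y i gP_commute[of X Y p] by (simp add: lie_deriv_D U_def algebra_simps)
  also have "lie_deriv (br (\<xi> i) V) g X Y p = 2 * (2 * \<beta> * lam * gP X Y p - dv (\<xi> i) a p * gF X Y p - 2 * \<beta> * c p * gF X Y p)
      - 2 * \<beta> * (lie_deriv V g X Y p -
        (\<Sum>j=1..s. dv X (u j) p * G Y (\<xi> j) p + G X (\<xi> j) p * dv Y (u j) p))"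
    using lie_deriv_bracket[OF xi_VF[OF i] V_VF X Y, of p] 1 2 by simp
  finally show ?thesis using X Y by (simp add: lie_V algebra_simps)
qed

lemma a_if_horizontal:
  assumes V: "\<And>i p. i \<in> {1..s} \<Longrightarrow> G V (\<xi> i) p = 0"
  shows "a p = - 2 * real s * real n * \<beta>\<^sup>2"
proof -
  have 1: "1 \<in> {1..s}" using s by simp
  have u0: "u i = (\<lambda>_. 0)" if "i \<in> {1..s}" for i using V[OF that] by (simp add: u_def fun_eq_iff)
  have "U 1 = 0"
    by (rule field_eqI) (use 1 U_grad[OF _ 1] u0[OF 1] in auto)
  then have H: "0 = 2 * s * \<beta> * \<kappa> * gP X Y p + dv (\<xi> 1) a p * gF X Y p + 2 * \<beta> * \<kappa> * G X xb p * G Y xb p"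
    if "X \<in> VF" "Y \<in> VF" for X Y
    using Hess[OF that 1, of p] u0 that D_const[OF that(1) VF_zero, of 0] by simp
  \<comment> \<open>On the pair (\<xi> 1, \<xi> 1) both horizontal forms vanish, which isolates the
    \<kappa> term.\<close>
  have "\<kappa> = 0"
    using H[OF xi_VF[OF 1] xi_VF[OF 1]] gF_xi(1)[OF xi_VF[OF 1] 1, of p] 1 \<beta> by simp
  moreover obtain X where "X \<in> VF" "gF X X p > 0" using exists_horizontal by blast
  ultimately have "dv (\<xi> 1) a p = 0" using H[of X X] by simp
  then show ?thesis using a_derivative_xi[OF 1, of p] \<beta> by simp
qed

end

context soliton
begin

subsection \<open>The case of one structure field\<close>

text \<open>For s = 1 the Ricci tensor is \<open>k gP\<close> minus 2n\<beta>^2 times g, so k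
  measures the deviation from the Einstein condition.\<close>

definition "k p = a p + 2 * real n * \<beta>\<^sup>2"

lemma k_SF [simp]: "k \<in> SF"
  unfolding k_def[abs_def] by simp

end

locale soliton1 = soliton +
  assumes s1: "s = 1"
begin

lemma one: "1 \<in> {1..s}" and rs: "real s = 1"
  using s1 by auto

lemma xi1: "\<xi> 1 = xb"
  unfolding xb_def by (simp add: s1)

lemma sum1: "(\<Sum>i=1..s. h i) = h 1" for h :: "nat \<Rightarrow> 'z::comm_monoid_add"
  by (simp add: s1)

lemma gP_eq: "gP X Y p = G X Y p - G X xb p * G Y xb p"
  unfolding gP_def sum1 xi1 ..

lemma c_k: "c p = k p - \<beta>\<^sup>2"
  by (simp add: c_def k_def rs algebra_simps)

lemma dv_k: "X \<in> VF \<Longrightarrow> dv X k p = dv X a p"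
  unfolding k_def[abs_def] by simp

lemma k_xi: "dv xb k p = - 2 * \<beta> * k p"
  using a_derivative_xi[OF one, of p] dv_k[OF xb_VF, of p] unfolding xi1
  by (simp add: k_def rs)

lemma ricci_k:
  assumes "X \<in> VF" "Y \<in> VF"
  shows "Ric X Y = (\<lambda>p. k p * gP X Y p - 2 * real n * \<beta>\<^sup>2 * G X Y p)"
  using assms by (simp add: fun_eq_iff ricci_a k_def gP_eq algebra_simps)

section \<open>The gradient of the vertical component and its integrability condition\<close>

definition "w = u 1"
definition "U1 = U 1"

lemma U1_VF [simp]: "U1 \<in> VF" and w_SF [simp]: "w \<in> SF"
  unfolding U1_def w_def using U_VF[OF one] u_SF[OF one] .

lemma w_eq: "w = G V xb"
  unfolding w_def u_def xi1 ..

lemma dv_w: "X \<in> VF \<Longrightarrow> dv X w p = G U1 X p"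
  unfolding U1_def w_def using U_grad[OF _ one] by simp

lemma U1_xb: "G U1 xb p = \<kappa>"
proof -
  have "2 * G (D xb V) xb p = 2 * \<kappa>"
    using lie_V[OF xb_VF xb_VF] lie_deriv_D[OF V_VF xb_VF xb_VF, of p] G_commute[of xb "D xb V" p]
    by (simp add: rs)
  moreover have "G U1 xb p = dv xb (G V xb) p" using dv_w[OF xb_VF] w_eq by simp
  ultimately show ?thesis by (simp add: D_metric)
qed

text \<open>\<open>Hess\<close> in operator form; for s = 1 the two \<kappa> terms combine to the
  full metric, and \<xi>(a) is -2\<beta>k.\<close>

lemma D_U1:
  assumes X: "X \<in> VF"
  shows "D X U1 = fscale (\<lambda>_. 2 * \<beta> * \<kappa>) X - fscale (\<lambda>p. 2 * \<beta> * k p) (K X)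
    - fscale (\<lambda>p. \<beta> * G U1 X p) xb - fscale (\<lambda>p. \<beta> * G X xb p) U1" (is "_ = ?S")
proof (rule field_eqI)
  fix Y p assume Y: "Y \<in> VF"
  have H: "G (D X U1) Y p = 2 * \<beta> * \<kappa> * gP X Y p + dv xb a p * gF X Y p
    + 2 * \<beta> * \<kappa> * G X xb p * G Y xb p - \<beta> * (G U1 X p * G Y xb p + G X xb p * G U1 Y p)"
    using Hess[OF X Y one, of p] dv_w[OF X] dv_w[OF Y]
    unfolding sum1 xi1 U1_def[symmetric] w_def[symmetric] by (simp add: rs)
  have "dv xb a p = - 2 * \<beta> * k p" using k_xi[of p] dv_k[OF xb_VF, of p] by simp
  then show "G (D X U1) Y p = G ?S Y p"
    using H X Y G_commute[OF xb_VF Y, of p] by (simp add: gP_eq algebra_simps)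
qed (use X in auto)

text \<open>The Ricci identity applied to the gradient. The terms are arranged as coefficients free
  of X times factors to be contracted in X.\<close>

lemma curvature_U1:
  assumes X: "X \<in> VF" and Y: "Y \<in> VF"
  shows "G (R X Y U1) X p = (- 2 * \<beta>) * (dv X k p * G X (K Y) p) + 2 * \<beta> * dv Y k p * gF X X p
      + 4 * \<beta>\<^sup>2 * k p * G Y xb p * gF X X p - 4 * \<beta>\<^sup>2 * k p * (gF X Y p * G X xb p)
      - \<beta>\<^sup>2 * G U1 Y p * gP X X p + \<beta>\<^sup>2 * (gP X Y p * G X U1 p)
      - 2 * \<beta>\<^sup>2 * \<kappa> * G Y xb p * G X X p + 2 * \<beta>\<^sup>2 * \<kappa> * (G X Y p * G X xb p)
      + \<beta>\<^sup>2 * G Y xb p * (G X U1 p * G X xb p) - \<beta>\<^sup>2 * G U1 Y p * (G X xb p * G X xb p)"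
proof -
  have "G X (K Y) p = gF Y X p" using X Y G_commute[of X "K Y" p] by simp
  then show ?thesis
    using X Y G_commute[OF xb_VF, of _ p] G_commute[of U1 _ p] gF_commute[OF Y X, of p] gP_commute[OF Y X, of p]
      G_commute[OF Y X, of p]
    by (simp add: curvature_def D_U1 D_K D_metric torsion_free rs U1_xb power2_eq_square algebra_simps)
qed

lemma k_gradient:
  assumes Y: "Y \<in> VF"
  shows "k p * (G U1 Y p - \<kappa> * G Y xb p) = - 2 * \<beta> * dv (K Y) k p + 2 * \<beta> * \<tau> p * dv Y k p
    + 4 * \<beta>\<^sup>2 * k p * \<tau> p * G Y xb p - 4 * real n * \<beta>\<^sup>2 * \<kappa> * G Y xb p"
proof -
  have "Ric Y U1 p = Tr p (\<lambda>X. (- 2 * \<beta>) * (dv X k p * G X (K Y) p) + 2 * \<beta> * dv Y k p * gF X X p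
      + 4 * \<beta>\<^sup>2 * k p * G Y xb p * gF X X p - 4 * \<beta>\<^sup>2 * k p * (gF X Y p * G X xb p)
      - \<beta>\<^sup>2 * G U1 Y p * gP X X p + \<beta>\<^sup>2 * (gP X Y p * G X U1 p)
      - 2 * \<beta>\<^sup>2 * \<kappa> * G Y xb p * G X X p + 2 * \<beta>\<^sup>2 * \<kappa> * (G X Y p * G X xb p)
      + \<beta>\<^sup>2 * G Y xb p * (G X U1 p * G X xb p) - \<beta>\<^sup>2 * G U1 Y p * (G X xb p * G X xb p))"
    unfolding ricci_Tr[OF Y U1_VF] by (rule Tr_cong) (rule curvature_U1[OF _ Y])
  also have "\<dots> = - 2 * \<beta> * dv (K Y) k p + 2 * \<beta> * \<tau> p * dv Y k p + 4 * \<beta>\<^sup>2 * k p * \<tau> p * G Y xb p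
      - 2 * real n * \<beta>\<^sup>2 * G U1 Y p + \<beta>\<^sup>2 * gP Y U1 p - 2 * \<beta>\<^sup>2 * \<kappa> * G Y xb p * (2 * real n + 1)
      + 2 * \<beta>\<^sup>2 * \<kappa> * G Y xb p + \<beta>\<^sup>2 * G Y xb p * \<kappa> - \<beta>\<^sup>2 * G U1 Y p"
    using Y by (simp add: Tr_tensorial[OF dv_tensorial] Tr_GG Tr_gPG Tr_G_K Tr_gP Tr_G \<tau>_def[symmetric]
        U1_xb rs)
  finally show ?thesis
    using Y G_commute[OF Y U1_VF, of p] by (simp add: ricci_k gP_eq U1_xb algebra_simps)
qed

text \<open>\<open>k_gradient\<close> at Y = \<open>xb\<close>: the left side is 0, K
  \<open>xb\<close> = 0, and the two \<tau> terms cancel by \<open>k_xi\<close>, which leaves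
  4n\<beta>^2\<kappa> = 0.\<close>

lemma kappa [simp]: "\<kappa> = 0"
proof -
  have "dv (K xb) k p = 0" for p by (simp add: K_def dv_def)
  then show ?thesis
    using k_gradient[OF xb_VF] U1_xb k_xi n \<beta> by (simp add: rs power2_eq_square)
qed

section \<open>The corrected field and the Ricci tensor\<close>

lemma U1_xb0 [simp]: "G U1 xb p = 0" "G xb U1 p = 0"
  using U1_xb[of p] G_commute[OF xb_VF U1_VF, of p] by simp_all

text \<open>Along V the metric changes by a term -2k \<open>gF\<close>, and U1/(2\<beta>)
  contributes the same term. In the difference, the coefficients of \<open>gP\<close> and
  \<open>gF\<close> are constants.\<close>

definition "W1 = V - fscale (\<lambda>_. 1 / (2 * \<beta>)) U1"

lemma W1_VF [simp]: "W1 \<in> VF"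
  unfolding W1_def by simp

lemma lie_W1:
  assumes X: "X \<in> VF" and Y: "Y \<in> VF"
  shows "lie_deriv W1 g X Y = (\<lambda>p. 2 * lam * gP X Y p + 2 * \<beta>\<^sup>2 * gF X Y p
    + (G U1 X p * G Y xb p + G U1 Y p * G X xb p))" (is "_ = ?h")
proof
  fix p
  have "lie_deriv W1 g X Y p = lie_deriv V g X Y p - (1 / (2 * \<beta>)) * (G (D X U1) Y p + G X (D Y U1) p)"
    using X Y unfolding W1_def by (simp add: lie_deriv_D algebra_simps)
  also have "G X (D Y U1) p = G (D X U1) Y p"
    using D_U_sym[OF X Y one, of p] X Y G_commute[of X "D Y U1" p] by (simp add: U1_def[symmetric] del: One_nat_def)
  also have "G (D X U1) Y p = - 2 * \<beta> * k p * gF X Y p - \<beta> * (G U1 X p * G Y xb p + G X xb p * G U1 Y p)"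
    using X Y G_commute[OF xb_VF Y, of p] by (simp add: D_U1 algebra_simps)
  finally have L: "lie_deriv W1 g X Y p = lie_deriv V g X Y p - 1 / (2 * \<beta>) *
      (- 2 * \<beta> * k p * gF X Y p - \<beta> * (G U1 X p * G Y xb p + G X xb p * G U1 Y p) +
      (- 2 * \<beta> * k p * gF X Y p - \<beta> * (G U1 X p * G Y xb p + G X xb p * G U1 Y p)))" .
  have "1 / (2 * \<beta>) * (- 2 * \<beta> * x * y - \<beta> * z + (- 2 * \<beta> * x * y - \<beta> * z)) = - 2 * x * y - z" for x y z
    using \<beta> by (simp add: field_simps)
  note L = L[unfolded this]
  show "lie_deriv W1 g X Y p = ?h p"
    unfolding L using X Y by (simp add: lie_V c_k algebra_simps)
qed

text \<open>Koszul's formula for the explicit form in \<open>lie_W1\<close>; k comes back through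
  the Hessian of w.\<close>

lemma lie_conn_W1:
  assumes X: "X \<in> VF" and Y: "Y \<in> VF"
  shows "lie_conn W1 X Y = fscale (\<lambda>p. - 2 * \<beta> * (k p + \<beta>\<^sup>2) * gF X Y p - 2 * \<beta> * lam * gP X Y p
      - \<beta> * (G U1 X p * G Y xb p + G U1 Y p * G X xb p)) xb + fscale (\<lambda>p. \<beta> * gP X Y p) U1" (is "_ = ?S")
proof (rule field_eqI)
  fix Z p assume Z: "Z \<in> VF"
  define h where "h X Y p = 2 * lam * gP X Y p + 2 * \<beta>\<^sup>2 * gF X Y p
    + (G U1 X p * G Y xb p + G U1 Y p * G X xb p)" for X Y p
  have dh: "dv X (h Y Z) p - h (D X Y) Z p - h Y (D X Z) p =
      - 2 * lam * \<beta> * (gP X Y p * G Z xb p + G Y xb p * gP X Z p)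
      - 2 * \<beta> ^ 3 * (gF X Y p * G Z xb p + G Y xb p * gF X Z p)
      + (G (D X U1) Y p * G Z xb p + G U1 Y p * \<beta> * gP X Z p)
      + (G (D X U1) Z p * G Y xb p + G U1 Z p * \<beta> * gP X Y p)"
    if "X \<in> VF" "Y \<in> VF" "Z \<in> VF" for X Y Z
    using that unfolding h_def[abs_def]
    by (simp add: D_gP D_gF D_metric[OF that(1) U1_VF] D_metric[OF that(1) _ xb_VF] rs
        gP_commute[OF that(2,1)] gP_commute[OF that(3,1)]
        power2_eq_square power3_eq_cube algebra_simps)
  have DU: "G (D X U1) Y p = - 2 * \<beta> * k p * gF X Y p - \<beta> * (G U1 X p * G Y xb p + G X xb p * G U1 Y p)"
    if "X \<in> VF" "Y \<in> VF" for X Y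
    using that G_commute[OF xb_VF that(2), of p] by (simp add: D_U1 algebra_simps)
  have "2 * G (lie_conn W1 X Y) Z p =
    (dv X (h Y Z) p - h (D X Y) Z p - h Y (D X Z) p) +
    (dv Y (h X Z) p - h (D Y X) Z p - h X (D Y Z) p) -
    (dv Z (h X Y) p - h (D Z X) Y p - h X (D Z Y) p)"
    by (rule lie_conn_koszul[OF W1_VF _ X Y Z]) (simp add: lie_W1 h_def[abs_def])
  also have "\<dots> = 2 * G ?S Z p"
    unfolding dh[OF X Y Z] dh[OF Y X Z] dh[OF Z X Y] DU[OF X Y] DU[OF Y X] DU[OF X Z] DU[OF Y Z] DU[OF Z X] DU[OF Z Y]
    using X Y Z G_commute[OF xb_VF Z, of p] gP_commute[OF Y X, of p] gP_commute[OF Z X, of p] gP_commute[OF Z Y, of p]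
      gF_commute[OF Y X, of p] gF_commute[OF Z X, of p] gF_commute[OF Z Y, of p]
    by (simp add: power2_eq_square power3_eq_cube algebra_simps)
  finally show "G (lie_conn W1 X Y) Z p = G ?S Z p"
    by simp
qed (use X Y in auto)

lemma lie_conn_W1_trace:
  assumes X: "X \<in> VF" and Y: "Y \<in> VF" and Z: "Z \<in> VF"
    and h: "G X xb p = 0" "G Y xb p = 0"
  shows "G (lie_curv W1 Z X Y) Z p =
    (- 2 * \<beta> * gF X Y p) * (dv Z k p * G Z xb p)
    + \<beta> * (- 2 * \<beta> * (k p + \<beta>\<^sup>2) * gF X Y p - 2 * \<beta> * lam * gP X Y p) * gP Z Z p
    + (- 2 * \<beta>\<^sup>2 * k p * gP X Y p) * gF Z Z p
    + (2 * \<beta> * dv X k p) * (gF Z Y p * G Z xb p)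
    - (2 * \<beta>\<^sup>2 * (k p + \<beta>\<^sup>2) * gF X Y p + 2 * \<beta>\<^sup>2 * lam * gP X Y p + 2 * \<beta>\<^sup>2 * k p * gF X Y p) * (G Z xb p * G Z xb p)
    + (2 * \<beta>\<^sup>2 * (k p + \<beta>\<^sup>2)) * (gF Z Y p * G Z (Pr X) p) + (2 * \<beta>\<^sup>2 * lam) * (gP Z Y p * G Z (Pr X) p)
    + (2 * \<beta>\<^sup>2 * k p) * (gF Z X p * G Z (Pr Y) p)
    + \<beta>\<^sup>2 * G U1 Y p * (gP Z X p * G Z xb p)"
  using X Y Z h G_commute[OF xb_VF, of _ p] G_commute[of U1 U1 p] gP_commute[OF Z X, of p] gF_commute[OF Z X, of p]
    gP_commute[OF Z Y, of p] gF_commute[OF Z Y, of p]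
  by (simp add: lie_curv_def lie_conn_W1 D_gP D_gF D_metric D_U1 torsion_free rs power2_eq_square algebra_simps)

text \<open>The Lie derivative of Ric along W1, once from the form of Ric in \<open>ricci_k\<close>
  and once by contracting the Lie derivative of the curvature.\<close>

lemma W1_k_horizontal:
  assumes X: "X \<in> VF" and Y: "Y \<in> VF" and h: "G X xb p = 0" "G Y xb p = 0"
  shows "(dv W1 k p + 2 * k p * lam + 2 * \<beta>\<^sup>2 * k p * \<tau> p) * gP X Y p
    + \<beta>\<^sup>2 * k p * (4 * real n - 2) * gF X Y p = 0"
proof -
  have lg: "dv W1 (gP X Y) p - gP (br W1 X) Y p - gP X (br W1 Y) p = 2 * lam * gP X Y p + 2 * \<beta>\<^sup>2 * gF X Y p"
    using lie_gP[OF W1_VF X Y, of p] h unfolding sum1 xi1 by (simp add: lie_W1 X Y)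
  have lG: "dv W1 (G X Y) p - G (br W1 X) Y p - G X (br W1 Y) p = 2 * lam * gP X Y p + 2 * \<beta>\<^sup>2 * gF X Y p"
    using fun_cong[OF lie_W1[OF X Y], of p] h by (simp add: lie_deriv_G)
  have "dv W1 (Ric X Y) p = dv W1 k p * gP X Y p + k p * dv W1 (gP X Y) p
      - 2 * real n * \<beta>\<^sup>2 * dv W1 (G X Y) p"
    using X Y by (simp add: ricci_k del: D_metric)
  then have "dv W1 (Ric X Y) p - Ric (br W1 X) Y p - Ric X (br W1 Y) p =
      dv W1 k p * gP X Y p + k p * (dv W1 (gP X Y) p - gP (br W1 X) Y p - gP X (br W1 Y) p)
      - 2 * real n * \<beta>\<^sup>2 * (dv W1 (G X Y) p - G (br W1 X) Y p - G X (br W1 Y) p)"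
    using X Y by (simp add: ricci_k algebra_simps del: D_metric)
  also have "\<dots> = dv W1 k p * gP X Y p + (k p - 2 * real n * \<beta>\<^sup>2) * (2 * lam * gP X Y p + 2 * \<beta>\<^sup>2 * gF X Y p)"
    unfolding lg lG by (simp add: algebra_simps)
  finally have 1: "dv W1 (Ric X Y) p - Ric (br W1 X) Y p - Ric X (br W1 Y) p = \<dots>" .
  have "dv W1 (Ric X Y) p - Ric (br W1 X) Y p - Ric X (br W1 Y) p = Tr p (\<lambda>Z. G (lie_curv W1 Z X Y) Z p)"
    using lie_ricci[OF W1_VF X Y, of p] by simp
  also have "\<dots> = Tr p (\<lambda>Z. (- 2 * \<beta> * gF X Y p) * (dv Z k p * G Z xb p)
    + \<beta> * (- 2 * \<beta> * (k p + \<beta>\<^sup>2) * gF X Y p - 2 * \<beta> * lam * gP X Y p) * gP Z Z p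
    + (- 2 * \<beta>\<^sup>2 * k p * gP X Y p) * gF Z Z p
    + (2 * \<beta> * dv X k p) * (gF Z Y p * G Z xb p)
    - (2 * \<beta>\<^sup>2 * (k p + \<beta>\<^sup>2) * gF X Y p + 2 * \<beta>\<^sup>2 * lam * gP X Y p + 2 * \<beta>\<^sup>2 * k p * gF X Y p) * (G Z xb p * G Z xb p)
    + (2 * \<beta>\<^sup>2 * (k p + \<beta>\<^sup>2)) * (gF Z Y p * G Z (Pr X) p) + (2 * \<beta>\<^sup>2 * lam) * (gP Z Y p * G Z (Pr X) p)
    + (2 * \<beta>\<^sup>2 * k p) * (gF Z X p * G Z (Pr Y) p)
    + \<beta>\<^sup>2 * G U1 Y p * (gP Z X p * G Z xb p))"
    by (rule Tr_cong) (rule lie_conn_W1_trace[OF X Y _ h])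
  also have "\<dots> = 4 * \<beta>\<^sup>2 * k p * gF X Y p
    + \<beta> * (- 2 * \<beta> * (k p + \<beta>\<^sup>2) * gF X Y p - 2 * \<beta> * lam * gP X Y p) * (2 * real n)
    - 2 * \<beta>\<^sup>2 * k p * gP X Y p * \<tau> p"
    using X Y gF_commute[of Y X p] gP_commute[of Y X p]
    by (simp add: Tr_tensorial[OF dv_tensorial] Tr_GG Tr_gPG Tr_G_K Tr_gP \<tau>_def[symmetric] k_xi rs
        del: G_Pr) (simp add: power2_eq_square algebra_simps)
  finally show ?thesis unfolding 1 by (simp add: power2_eq_square algebra_simps)
qed

lemma W1_k_eq:
  assumes X: "X \<in> VF" and Y: "Y \<in> VF"
  shows "(dv W1 k p + 2 * k p * lam + 2 * \<beta>\<^sup>2 * k p * \<tau> p) * gP X Y p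
    + \<beta>\<^sup>2 * k p * (4 * real n - 2) * gF X Y p = 0"
  using W1_k_horizontal[of "Pr X" "Pr Y" p] X Y by simp

section \<open>Proportionality of the two horizontal forms where k is nonzero\<close>

definition "q p = \<tau> p / (2 * real n)"

text \<open>The trace of \<open>W1_k_eq\<close>, divided by 2n: the coefficient of q is 4n from the
  \<tau> term plus 4n - 2 from the \<open>gF\<close> term, each times \<beta>^2.\<close>

definition "L1 p = 2 * lam + \<beta>\<^sup>2 * (8 * real n - 2) * q p"

lemma q_SF [simp]: "q \<in> SF"
  using SF_mult[OF SF_const[of "inverse (2 * real n)"] tau_SF] by (simp add: q_def[abs_def] field_simps)

lemma tau_q: "\<tau> p = 2 * real n * q p"
  using n by (simp add: q_def)

lemma dv_q [simp]: "X \<in> VF \<Longrightarrow> dv X q p = 0"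
proof -
  assume X: "X \<in> VF"
  have "(\<lambda>p. 2 * real n * q p) = \<tau>" by (rule ext) (simp add: tau_q)
  then have "dv X (\<lambda>p. 2 * real n * q p) p = 0" using dv_tau[OF X, of p] by simp
  then show ?thesis using X n by simp
qed

lemma L1_SF [simp]: "L1 \<in> SF"
  unfolding L1_def[abs_def] by simp

lemma dv_L1 [simp]: "X \<in> VF \<Longrightarrow> dv X L1 p = 0"
  unfolding L1_def[abs_def] by simp

lemma W1_k: "dv W1 k p = - L1 p * k p"
proof -
  have "Tr p (\<lambda>Z. (dv W1 k p + 2 * k p * lam + 2 * \<beta>\<^sup>2 * k p * \<tau> p) * gP Z Z p
    + \<beta>\<^sup>2 * k p * (4 * real n - 2) * gF Z Z p) = Tr p (\<lambda>_. 0)"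
    by (rule Tr_cong) (rule W1_k_eq)
  then have "(dv W1 k p + 2 * k p * lam + 2 * \<beta>\<^sup>2 * k p * \<tau> p) * (2 * real n)
    + \<beta>\<^sup>2 * k p * (4 * real n - 2) * \<tau> p = 0"
    by (simp add: Tr_gP \<tau>_def[symmetric])
  then have "(dv W1 k p + L1 p * k p) * (2 * real n) = 0"
    by (simp add: tau_q L1_def algebra_simps)
  then show ?thesis using n by simp
qed

text \<open>Substituting the traced equation back leaves \<beta>^2 k (4n - 2) times the trace-free
  part of \<open>gF\<close>.\<close>

lemma gF_q:
  assumes k: "k p \<noteq> 0" and X: "X \<in> VF" and Y: "Y \<in> VF"
  shows "gF X Y p = q p * gP X Y p"
proof -
  have "\<beta>\<^sup>2 * k p * (4 * real n - 2) * (gF X Y p - q p * gP X Y p) = 0"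
    using W1_k_eq[OF X Y, of p] by (simp add: W1_k tau_q L1_def algebra_simps)
  moreover have "4 * real n - 2 \<noteq> 0" using n by simp
  ultimately show ?thesis using k \<beta> by simp
qed

lemma q_nonzero: "k p \<noteq> 0 \<Longrightarrow> q p \<noteq> 0"
proof -
  assume k: "k p \<noteq> 0"
  obtain X where "X \<in> VF" "gF X X p > 0" using exists_horizontal by blast
  then show ?thesis using gF_q[OF k, of X X] by auto
qed

definition "\<sigma> p = 2 * \<beta> * q p * (2 * real n - 1)"

lemma sigma_SF [simp]: "\<sigma> \<in> SF"
  unfolding \<sigma>_def[abs_def] by simp

lemma dv_sigma [simp]: "X \<in> VF \<Longrightarrow> dv X \<sigma> p = 0"
  unfolding \<sigma>_def[abs_def] by simp

text \<open>At such a point K is q times the projection, so \<open>k_gradient\<close> involves only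
  dk itself; \<sigma> collects the factor 2\<beta>(2n q - q).\<close>

lemma dv_k_eq:
  assumes k: "k p \<noteq> 0" and Y: "Y \<in> VF"
  shows "\<sigma> p * dv Y k p = k p * (G U1 Y p - 2 * \<beta> * \<sigma> p * G Y xb p)"
proof -
  have "K Y p = fscale q (Pr Y) p"
    by (rule field_eq_at) (use gF_q[OF k Y] Y in simp_all)
  then have "dv (K Y) k p = dv (fscale q (Pr Y)) k p" by (rule dv_cong_at)
  also have "Pr Y = Y - fscale (G Y xb) xb" unfolding Pr_def sum1 xi1 ..
  finally have "dv (K Y) k p = q p * (dv Y k p - G Y xb p * (- 2 * \<beta> * k p))"
    by (simp only: dv_field k_xi)
  then show ?thesis
    using k_gradient[OF Y, of p] by (simp add: tau_q \<sigma>_def power2_eq_square algebra_simps)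
qed

section \<open>The squared length of the gradient\<close>

definition "sqU = G U1 U1"

lemma sqU_SF [simp]: "sqU \<in> SF"
  unfolding sqU_def by simp

lemma gP_U1 [simp]: "X \<in> VF \<Longrightarrow> gP X U1 p = G U1 X p" "X \<in> VF \<Longrightarrow> gP U1 X p = G U1 X p"
  by (simp_all add: gP_eq G_commute)

lemma dv_sqU:
  assumes k: "k p \<noteq> 0" and X: "X \<in> VF"
  shows "dv X sqU p = - 4 * \<beta> * k p * q p * G U1 X p - 2 * \<beta> * G X xb p * sqU p"
  using X gF_q[OF k X U1_VF] G_commute[of U1 "K X" p] G_commute[of U1 "D X U1" p]
  unfolding sqU_def by (simp add: D_metric D_U1 algebra_simps)

text \<open>\<open>dv_k_eq\<close> at Y = W1, with W1(k) = -L1 k inserted and k cancelled.\<close>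

lemma W1_w:
  assumes k: "k p \<noteq> 0"
  shows "G U1 W1 p = \<sigma> p * (2 * \<beta> * w p - L1 p)"
proof -
  have "G W1 xb p = w p" unfolding W1_def w_eq by simp
  then have "k p * (G U1 W1 p - \<sigma> p * (2 * \<beta> * w p - L1 p)) = 0"
    using dv_k_eq[OF k W1_VF] by (simp add: W1_k algebra_simps)
  then show ?thesis using k by simp
qed

text \<open>Both W1(U1(w)) and U1(W1(w)) are known, hence so is [W1, U1](w), the inner product of
  the bracket with U1. The Lie derivative of g on (U1, U1) contains the same inner product
  twice.\<close>

lemma W1_sqU:
  assumes k: "k p \<noteq> 0"
  shows "dv W1 sqU p = (4 * \<beta> * \<sigma> p - 2 * lam - 2 * \<beta>\<^sup>2 * q p) * sqU p"
proof -
  have "dv U1 (\<lambda>p. G U1 W1 p - \<sigma> p * (2 * \<beta> * w p - L1 p)) p = 0"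
    by (rule dv_where_nonzero[OF U1_VF k_SF _ _ k]) (simp_all add: W1_w)
  then have 1: "dv U1 (G U1 W1) p = 2 * \<beta> * \<sigma> p * sqU p"
    by (simp add: dv_w sqU_def algebra_simps del: D_metric)
  have "G U1 W1 = dv W1 w" "sqU = dv U1 w" using dv_w by (simp_all add: fun_eq_iff sqU_def)
  then have "G (br W1 U1) U1 p = dv W1 sqU p - dv U1 (G U1 W1) p"
    using dv_w[of "br W1 U1" p] dv_bracket[of W1 U1 w p] G_commute[of "br W1 U1" U1 p] by simp
  moreover have "dv W1 sqU p = 2 * lam * sqU p + 2 * \<beta>\<^sup>2 * (q p * sqU p) + 2 * G (br W1 U1) U1 p"
    using fun_cong[OF lie_W1[OF U1_VF U1_VF], of p] gF_q[OF k U1_VF U1_VF] G_commute[of U1 "br W1 U1" p]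
    by (simp add: lie_deriv_G sqU_def del: D_metric)
  ultimately show ?thesis using 1 by (simp add: algebra_simps)
qed

lemma sqU_zero:
  assumes k: "k p \<noteq> 0"
  shows "sqU p = 0"
proof (rule ccontr)
  assume sqU: "sqU p \<noteq> 0"
  define c1 where "c1 p = 4 * \<beta> * \<sigma> p - 2 * lam - 2 * \<beta>\<^sup>2 * q p" for p
  have c1: "c1 \<in> SF" "dv U1 c1 p = 0" for p
    unfolding c1_def[abs_def] by simp_all
  \<comment> \<open>The value from \<open>W1_sqU\<close> is set equal to that of
    \<open>dv_sqU\<close> in direction W1.\<close>
  have I1: "(2 * \<beta> * w p + c1 p) * sqU p + 4 * \<beta> * q p * \<sigma> p * k p * (2 * \<beta> * w p - L1 p) = 0"
    if k: "k p \<noteq> 0" for p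
  proof -
    have "G W1 xb p = w p" unfolding W1_def w_eq by simp
    then show ?thesis
      using W1_sqU[OF k] dv_sqU[OF k W1_VF] W1_w[OF k] by (simp add: c1_def algebra_simps)
  qed
  \<comment> \<open>The factor d is what remains of the U1-derivative of I1 once the terms in w
    cancel and 2\<beta> \<open>sqU\<close> is divided out.\<close>
  define d where "d p = 2 * q p * (c1 p + L1 p) - 4 * \<beta> * q p * \<sigma> p" for p
  have d: "d \<in> SF" "dv U1 d p = 0" for p
    unfolding d_def[abs_def] using c1 by simp_all
  have sk: "\<sigma> p * dv U1 k p = k p * sqU p" if "k p \<noteq> 0" for p
    using dv_k_eq[OF that U1_VF] by (simp add: sqU_def)
  have Ux: "dv U1 sqU p = - 4 * \<beta> * k p * q p * sqU p" if "k p \<noteq> 0" for p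
    using dv_sqU[OF that U1_VF] by (simp add: sqU_def)
  have I2: "sqU p = d p * k p" if k: "k p \<noteq> 0" and sqU: "sqU p \<noteq> 0" for p
  proof -
    have "dv U1 (\<lambda>p. (2 * \<beta> * w p + c1 p) * sqU p + 4 * \<beta> * q p * \<sigma> p * k p * (2 * \<beta> * w p - L1 p)) p = 0"
      by (rule dv_where_nonzero[OF U1_VF k_SF _ I1 k]) (use c1 in simp_all)
    then have "2 * \<beta> * sqU p * sqU p + (2 * \<beta> * w p + c1 p) * dv U1 sqU p
        + 4 * \<beta> * q p * (\<sigma> p * dv U1 k p) * (2 * \<beta> * w p - L1 p) + 8 * \<beta>\<^sup>2 * q p * \<sigma> p * k p * sqU p = 0"
      using c1 by (simp add: dv_w sqU_def[symmetric] power2_eq_square algebra_simps)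
    then have "2 * \<beta> * sqU p * (sqU p - d p * k p) = 0"
      unfolding sk[OF k] Ux[OF k] d_def by (simp add: power2_eq_square algebra_simps)
    then show ?thesis using sqU \<beta> by simp
  qed
  \<comment> \<open>I2 holds only where k and \<open>sqU\<close> are both nonzero, hence the product
    as the nonvanishing function.\<close>
  have "dv U1 (\<lambda>p. sqU p - d p * k p) p = 0"
    by (rule dv_where_nonzero[OF U1_VF, of "\<lambda>p. k p * sqU p"]) (use I2 d k sqU in auto)
  then have "dv U1 sqU p = d p * dv U1 k p" using d by simp
  then have "\<sigma> p * dv U1 sqU p = d p * (\<sigma> p * dv U1 k p)" by (simp add: algebra_simps)
  then have "k p * sqU p * (4 * \<beta> * q p * \<sigma> p + d p) = 0"
    unfolding sk[OF k] Ux[OF k] by (simp add: algebra_simps)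
  then have "q p * (c1 p + L1 p) = 0" using k sqU by (simp add: d_def)
  then have "c1 p + L1 p = 0" using q_nonzero[OF k] by simp
  \<comment> \<open>4\<beta>\<sigma> contributes 16n - 8, the q terms of L1 and \<open>c1\<close>
    contribute 8n - 2 - 2, and \<lambda> cancels.\<close>
  then have "\<beta>\<^sup>2 * q p * (24 * real n - 12) = 0"
    by (simp add: c1_def L1_def \<sigma>_def power2_eq_square algebra_simps)
  moreover have "24 * real n - 12 \<noteq> 0" using n by simp
  ultimately show False using q_nonzero[OF k] \<beta> by simp
qed

text \<open>Where k is nonzero the gradient U1 is 0, and so is its covariant derivative; the Hessian
  in \<open>D_U1\<close> reduces to -2\<beta>k \<open>gF\<close>, which is nonzero on a suitable
  X.\<close>

lemma k_zero: "k p = 0"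
proof (rule ccontr)
  assume k: "k p \<noteq> 0"
  obtain X where X: "X \<in> VF" "gF X X p > 0" using exists_horizontal by blast
  have U0: "G U1 Y p = 0" if "k p \<noteq> 0" "Y \<in> VF" for Y p
  proof -
    have "U1 p = 0" using sqU_zero[OF that(1)] G_pos[OF U1_VF, of p] unfolding sqU_def by force
    then have "G U1 Y p = G 0 Y p" by (simp add: G_def)
    then show ?thesis using that by simp
  qed
  have "dv X (G U1 X) p = 0"
    by (rule dv_where_nonzero[OF X(1) k_SF _ _ k]) (use U0 X in simp_all)
  then have "G (D X U1) X p = 0" using X U0[OF k, of "D X X"] by (simp add: D_metric)
  then have "\<beta> * k p * gF X X p = 0" using X U0[OF k X(1)] by (simp add: D_U1)
  then show False using k X \<beta> by simp
qed

lemma a_eq: "a p = - 2 * real s * real n * \<beta>\<^sup>2"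
  using k_zero[of p] by (simp add: k_def rs)

end

theorem theorem5:
  fixes A :: "('m::{t2_space,second_countable_topology}, 'e::euclidean_space) chart set"
    and n s :: nat
    and f Q :: "'m endofield"
    and \<xi> :: "nat \<Rightarrow> 'm vfield"
    and \<eta> :: "nat \<Rightarrow> 'm oneform"
    and g :: "'m bilinfield"
    and D :: "'m connection"
    and \<beta> lam mu :: real
    and a b :: "'m \<Rightarrow> real"
    and V :: "'m vfield"
  assumes "n \<ge> 1" and "s \<ge> 1"
    and "weak_beta_f_kenmotsu A n s f Q \<xi> \<eta> g D (\<lambda>_. \<beta>)" and "\<beta> \<noteq> 0"
    and "eta_einstein A s \<eta> g D a b"
    and "star_eta_ricci_soliton A s f \<eta> g D V lam mu"
    and "s > 1 \<Longrightarrow> tangent_to_D s \<eta> V"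
  shows "(\<forall>p. a p = - 2 * real s * real n * \<beta>\<^sup>2) \<and>
    (\<forall>p. b p = 2 * (real s - 1) * real n * \<beta>\<^sup>2) \<and>
    (\<forall>p. scalar_curvature A g D p = - 2 * real s * real n * (2 * real n + 1) * \<beta>\<^sup>2) \<and>
    (s = 1 \<longrightarrow> einstein A g D)"
proof -
  interpret soliton A g D n s f Q \<xi> \<eta> \<beta> a b V lam mu
    using assms unfolding weak_beta_f_kenmotsu_def weak_metric_f_structure_def
    by unfold_locales (auto simp: weak_beta_f_kenmotsu_def weak_metric_f_structure_def)
  have a: "a p = - 2 * real s * real n * \<beta>\<^sup>2" for p
  proof (cases "s = 1")
    case True
    then interpret soliton1 A g D n s f Q \<xi> \<eta> \<beta> a b V lam mu by unfold_locales
    show ?thesis by (rule a_eq)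
  next
    case False
    then have "tangent_to_D s \<eta> V" using assms(2,7) by simp
    then have "G V (\<xi> i) q = 0" if "i \<in> {1..s}" for i q
      using that eta_G[OF that V_VF, of q] unfolding tangent_to_D_def by simp
    then show ?thesis by (rule a_if_horizontal)
  qed
  moreover have "b p = 2 * (real s - 1) * real n * \<beta>\<^sup>2" for p
    using ab[of p] a[of p] by (simp add: algebra_simps)
  moreover have "scalar_curvature A g D p = - 2 * real s * real n * (2 * real n + 1) * \<beta>\<^sup>2" for p
    unfolding scalar_curvature_a a by (simp add: algebra_simps)
  moreover have "einstein A g D" if "s = 1" using a that by (rule einstein_if)
  ultimately show ?thesis by blast
qed

end
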